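(* Let $\rho$ be an algebraic number, $d\ge 1$, let $\phi$ be a $\mathbb{Z}[\rho]$-linear automorphism of $\mathbb{Z}[\rho]^d$, and let $G=\mathbb{Z}[\rho]^d\rtimes_\phi\mathbb{Z}$, assumed to be finitely generated. Suppose the characteristic polynomial $p_\phi$ of $\phi$ can be factored over $\mathbb{Z}$ as $p_\phi=p_+p_0$, where 1. $p_+$ has a multiple in $\mathbb{Z}[t,t^{-1}]$ which satisfies (EDP), 2. the roots of $p_+$ are distinct and have modulus distinct from $1$, and 3. the roots of $p_0$ are distinct and have modulus $1$. Then there exist adapted random walks on $G$ with escape exponent $1/2$.
   Context: $G=\mathbb{Z}[\rho]^d\rtimes_\phi\mathbb{Z}$ has multiplication $(\mathbf v,m)(\mathbf w,n)=(\mathbf v+\phi^m\mathbf w,\,m+n)$. "Factored over $\mathbb{Z}$" means $p_+,p_0\in\mathbb{Z}[t]$. A multiple of a polynomial in $\mathbb{Z}[t,t^{-1}]$ means a Laurent polynomial with integer coefficients that is divisible by that polynomial in $\mathbb{C}[t,t^{-1}]$. Property (EDP): for $p=\sum_i p_it^i\in\mathbb{Z}[t,t^{-1}]$ with at least two nonzero coefficients, let $\max^{(1)}_i|p_i|\ge \max^{(2)}_i|p_i|$ be the largest and second largest of the numbers $|p_i|$, counted with multiplicity. Then $p$ has property (EDP) if $$\textstyle\max^{(1)}_i|p_i|\left(1+\frac{1}{\max^{(2)}_i|p_i|}\right)>\sum_i|p_i|.$$ Adapted random walk: $X_0=e$, $X_n=\xi_1\cdots\xi_n$ with $\xi_i$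 i.i.d. of law $\mu$, where $\mu(g)=\mu(g^{-1})$ for all $g$ and the support of $\mu$ is a finite generating set of the finitely generated group $G$. $|\cdot|_G$ denotes the word length for some fixed finite symmetric generating set of $G$. Escape exponent: a random walk $X_n$ on $G$ with law $\mu$ has escape exponent $\alpha$ if all three of the following hold. (i) ($\alpha$-tight degree of escape) There exist $\gamma,\delta>0$ such that $P(|X_n|_G>\gamma n^\alpha)\ge\delta$ for all $n\ge 1$; and there exist $\beta,c,C>0$ such that $P(|X_n|_G>xn^\alpha)\le C\exp(-cx^\beta)$ for all $x\ge 0$ and all $n\ge 0$. (ii) (Displacement exponent $\alpha$) $\mathbb{E}_\mu|X_n|_G\simeq n^\alpha$, where $f\preceq g$ means there is $c>0$ with $f(x)\le c\,g(cx)$ for all $x\ge 0$ (functions on $\mathbb{N}$ being extended piecewise linearly), and $f\simeq g$ means $f\preceq g$ and $g\preceq f$. (iii) ($\alpha$-law of iterated logarithm) $0<\limsup_{n\to\infty}\frac{|X_n|_G}{(n\log\log n)^\alpha}<\infty$ almost surely. *)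

theory Defs
  imports
    "HOL-Probability.Probability"
    "HOL-Algebra.Generated_Groups"
    "HOL-Library.Poly_Mapping"
    "HOL-Library.Multiset"
    "Jordan_Normal_Form.Char_Poly"
begin

definition int_adjoin :: "complex \<Rightarrow> complex set" where
  "int_adjoin \<rho> = range (\<lambda>p :: int poly. poly (map_poly of_int p) \<rho>)"

definition adjoin_vec :: "complex \<Rightarrow> nat \<Rightarrow> complex vec set" where
  "adjoin_vec \<rho> d = {v \<in> carrier_vec d. \<forall>i<d. v $ i \<in> int_adjoin \<rho>}"

text \<open>Only the values of \<open>\<phi>\<close> on \<open>\<int>[\<rho>]\<^sup>d\<close> matter, here and below.\<close>

definition linear_automorphism :: "complex \<Rightarrow> nat \<Rightarrow> (complex vec \<Rightarrow> complex vec) \<Rightarrow> bool" where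
  "linear_automorphism \<rho> d \<phi> \<longleftrightarrow>
     bij_betw \<phi> (adjoin_vec \<rho> d) (adjoin_vec \<rho> d) \<and>
     (\<forall>v\<in>adjoin_vec \<rho> d. \<forall>w\<in>adjoin_vec \<rho> d. \<phi> (v + w) = \<phi> v + \<phi> w) \<and>
     (\<forall>a\<in>int_adjoin \<rho>. \<forall>v\<in>adjoin_vec \<rho> d. \<phi> (a \<cdot>\<^sub>v v) = a \<cdot>\<^sub>v \<phi> v)"

definition matrix_of :: "nat \<Rightarrow> (complex vec \<Rightarrow> complex vec) \<Rightarrow> complex mat" where
  "matrix_of d \<phi> = mat d d (\<lambda>(i, j). \<phi> (unit_vec d j) $ i)"

definition int_funpow :: "'a set \<Rightarrow> ('a \<Rightarrow> 'a) \<Rightarrow> int \<Rightarrow> 'a \<Rightarrow> 'a" where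
  "int_funpow A f m = (if m \<ge> 0 then f ^^ nat m else inv_into A f ^^ nat (- m))"

definition semidirect_Z ::
    "complex \<Rightarrow> nat \<Rightarrow> (complex vec \<Rightarrow> complex vec) \<Rightarrow> (complex vec \<times> int) monoid" where
  "semidirect_Z \<rho> d \<phi> =
     \<lparr>carrier = adjoin_vec \<rho> d \<times> UNIV,
      mult = (\<lambda>(v, m) (w, n). (v + int_funpow (adjoin_vec \<rho> d) \<phi> m w, m + n)),
      one = (0\<^sub>v d, 0)\<rparr>"

text \<open>A finitely supported function on \<open>\<int>\<close>, with convolution as multiplication, is a Laurent
  polynomial; the value at \<open>i\<close> is the coefficient of \<open>t\<^sup>i\<close>.\<close>

type_synonym 'a laurent = "int \<Rightarrow>\<^sub>0 'a"

definition laurent_of_poly :: "'a::comm_monoid_add poly \<Rightarrow> 'a laurent" where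
  "laurent_of_poly p = (\<Sum>i\<le>degree p. Poly_Mapping.single (int i) (coeff p i))"

definition laurent_multiple :: "int poly \<Rightarrow> int laurent \<Rightarrow> bool" where
  "laurent_multiple p q \<longleftrightarrow>
     laurent_of_poly (map_poly of_int p :: complex poly) dvd (Poly_Mapping.map of_int q :: complex laurent)"

definition abs_coeffs :: "int laurent \<Rightarrow> int multiset" where
  "abs_coeffs p = image_mset (\<lambda>i. \<bar>Poly_Mapping.lookup p i\<bar>) (mset_set (Poly_Mapping.keys p))"

definition max1_coeff :: "int laurent \<Rightarrow> int" where
  "max1_coeff p = Max_mset (abs_coeffs p)"

definition max2_coeff :: "int laurent \<Rightarrow> int" where
  "max2_coeff p = Max_mset (abs_coeffs p - {#max1_coeff p#})"

definition EDP :: "int laurent \<Rightarrow> bool" where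
  "EDP p \<longleftrightarrow> card (Poly_Mapping.keys p) \<ge> 2 \<and>
     real_of_int (max1_coeff p) * (1 + 1 / real_of_int (max2_coeff p))
       > real_of_int (\<Sum>i\<in>Poly_Mapping.keys p. \<bar>Poly_Mapping.lookup p i\<bar>)"

text \<open>A group has such a set iff it is finitely generated.\<close>

definition finite_sym_generating_set :: "('a, 'b) monoid_scheme \<Rightarrow> 'a set \<Rightarrow> bool" where
  "finite_sym_generating_set G S \<longleftrightarrow>
     finite S \<and> S \<subseteq> carrier G \<and> (\<forall>s\<in>S. inv\<^bsub>G\<^esub> s \<in> S) \<and> generate G S = carrier G"

definition word_length :: "('a, 'b) monoid_scheme \<Rightarrow> 'a set \<Rightarrow> 'a \<Rightarrow> nat" where
  "word_length G S g =
     (LEAST n. \<exists>ws. length ws = n \<and> set ws \<subseteq> S \<and> foldr (\<otimes>\<^bsub>G\<^esub>) ws \<one>\<^bsub>G\<^esub> = g)"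

definition adapted :: "('a, 'b) monoid_scheme \<Rightarrow> 'a pmf \<Rightarrow> bool" where
  "adapted G \<mu> \<longleftrightarrow>
     set_pmf \<mu> \<subseteq> carrier G \<and> finite (set_pmf \<mu>) \<and> generate G (set_pmf \<mu>) = carrier G \<and>
     (\<forall>g\<in>carrier G. pmf \<mu> g = pmf \<mu> (inv\<^bsub>G\<^esub> g))"

text \<open>The space of sequences of independent increments with law \<open>\<mu>\<close>. The increments are
  restricted to the carrier because products of discrete measurable spaces are well behaved only
  when these are countable, which the underlying type need not be.\<close>

definition increments :: "('a, 'b) monoid_scheme \<Rightarrow> 'a pmf \<Rightarrow> (nat \<Rightarrow> 'a) measure" where
  "increments G \<mu> = Pi\<^sub>M UNIV (\<lambda>_. restrict_space (measure_pmf \<mu>) (carrier G))"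

text \<open>The increment \<open>\<xi>\<^sub>n\<close> of the walk is \<open>\<xi> (n - 1)\<close>.\<close>

primrec walk :: "('a, 'b) monoid_scheme \<Rightarrow> nat \<Rightarrow> (nat \<Rightarrow> 'a) \<Rightarrow> 'a" where
  "walk G 0 \<xi> = \<one>\<^bsub>G\<^esub>"
| "walk G (Suc n) \<xi> = walk G n \<xi> \<otimes>\<^bsub>G\<^esub> \<xi> n"

definition walk_length ::
    "('a, 'b) monoid_scheme \<Rightarrow> 'a set \<Rightarrow> nat \<Rightarrow> (nat \<Rightarrow> 'a) \<Rightarrow> real" where
  "walk_length G S n \<xi> = real (word_length G S (walk G n \<xi>))"

definition tight_degree_of_escape ::
    "('a, 'b) monoid_scheme \<Rightarrow> 'a set \<Rightarrow> 'a pmf \<Rightarrow> real \<Rightarrow> bool" where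
  "tight_degree_of_escape G S \<mu> \<alpha> \<longleftrightarrow>
     (\<exists>\<gamma>>0. \<exists>\<delta>>0. \<forall>n\<ge>1.
        \<P>(\<xi> in increments G \<mu>. walk_length G S n \<xi> > \<gamma> * real n powr \<alpha>) \<ge> \<delta>) \<and>
     (\<exists>\<beta>>0. \<exists>c>0. \<exists>C>0. \<forall>x\<ge>0. \<forall>n.
        \<P>(\<xi> in increments G \<mu>. walk_length G S n \<xi> > x * real n powr \<alpha>) \<le> C * exp (- c * x powr \<beta>))"

text \<open>Functions are compared through their piecewise linear extensions from \<open>\<nat>\<close>, and this includes
  \<open>n \<mapsto> n powr \<alpha>\<close>: for \<open>\<alpha> < 1\<close>, the function \<open>x powr \<alpha>\<close> of real \<open>x\<close> is not dominated near \<open>0\<close> by any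
  piecewise linear function vanishing at \<open>0\<close>.\<close>

definition piecewise_linear :: "(nat \<Rightarrow> real) \<Rightarrow> real \<Rightarrow> real" where
  "piecewise_linear f x = (1 - frac x) * f (nat \<lfloor>x\<rfloor>) + frac x * f (nat \<lfloor>x\<rfloor> + 1)"

definition dominated :: "(nat \<Rightarrow> real) \<Rightarrow> (nat \<Rightarrow> real) \<Rightarrow> bool" where
  "dominated f g \<longleftrightarrow>
     (\<exists>c>0. \<forall>x\<ge>0. piecewise_linear f x \<le> c * piecewise_linear g (c * x))"

definition same_growth :: "(nat \<Rightarrow> real) \<Rightarrow> (nat \<Rightarrow> real) \<Rightarrow> bool" where
  "same_growth f g \<longleftrightarrow> dominated f g \<and> dominated g f"

definition displacement_exponent ::
    "('a, 'b) monoid_scheme \<Rightarrow> 'a set \<Rightarrow> 'a pmf \<Rightarrow> real \<Rightarrow> bool" where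
  "displacement_exponent G S \<mu> \<alpha> \<longleftrightarrow>
     same_growth (\<lambda>n. \<integral>\<xi>. walk_length G S n \<xi> \<partial>increments G \<mu>) (\<lambda>n. real n powr \<alpha>)"

definition law_of_iterated_logarithm ::
    "('a, 'b) monoid_scheme \<Rightarrow> 'a set \<Rightarrow> 'a pmf \<Rightarrow> real \<Rightarrow> bool" where
  "law_of_iterated_logarithm G S \<mu> \<alpha> \<longleftrightarrow>
     (AE \<xi> in increments G \<mu>.
        let L = limsup (\<lambda>n. ereal (walk_length G S n \<xi> / (real n * ln (ln (real n))) powr \<alpha>))
        in 0 < L \<and> L < \<infinity>)"

definition escape_exponent ::
    "('a, 'b) monoid_scheme \<Rightarrow> 'a set \<Rightarrow> 'a pmf \<Rightarrow> real \<Rightarrow> bool" where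
  "escape_exponent G S \<mu> \<alpha> \<longleftrightarrow>
     tight_degree_of_escape G S \<mu> \<alpha> \<and>
     displacement_exponent G S \<mu> \<alpha> \<and>
     law_of_iterated_logarithm G S \<mu> \<alpha>"

end

theory Submission
  imports
    Defs
    "Jordan_Normal_Form.Jordan_Normal_Form_Existence"
begin

text \<open>The walk takes uniformly distributed steps among \<open>(0, \<plusminus>1)\<close> and \<open>(u, 0)\<close>, where \<open>u\<close> ranges over a
  finite symmetric set of vectors. Its height \<open>m\<^sub>n\<close>, the \<open>\<int>\<close>-component, is a lazy simple random walk, and
  \<open>|X\<^sub>n| \<ge> c |m\<^sub>n|\<close>. Conversely, the roots of \<open>p_zero\<close> are roots of unity by Kronecker's theorem, say of
  order dividing \<open>N\<close>, and \<open>q(\<phi>) (\<phi>\<^sup>N - 1) = 0\<close> for a multiple \<open>q\<close> of \<open>p_plus\<close> with a coefficient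
  larger than the sum of all the others in absolute value. Up to the image of \<open>\<phi>\<^sup>N - 1\<close>, a step \<open>b\<close> made
  at height \<open>m\<close> only matters through \<open>m mod N\<close>; these contributions are finitely many additive
  functionals of the height with bounded centred increments. On the image of \<open>\<phi>\<^sup>N - 1\<close>, where \<open>q(\<phi>)\<close>
  vanishes, subtracting multiples of \<open>q\<close> makes all coefficients of a Laurent polynomial in \<open>\<phi>\<close> bounded
  after \<open>O(ln n)\<close> rounds, and Horner's scheme then writes the vector as a word whose length is
  proportional to the degree. So \<open>|X\<^sub>n|\<close> is at most a constant times the sum of
  \<open>ln n\<close>, of \<open>max |m\<^sub>k|\<close> and of the absolute values of the functionals. The bounds follow from the
  exponential maximal inequality and from the second and fourth moments of the height.\<close>

section \<open>Reducing coefficients by a polynomial with a dominant coefficient\<close>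

text \<open>Horner's scheme pays for every unit of every coefficient, while after n steps a
  coefficient of the displacement may be of order n. Reduction by q cures this, but a polynomial
  with a dominant coefficient has no zero on the unit circle, so it cannot act as zero on the
  eigenvectors that belong to \<open>p_zero\<close>. There the coefficients, collected by residues
  modulo N, are paid in full. They stay of order sqrt n only through the choice of the walk: a step
  changes either the height or the vector, and u and -u are equally likely, so the signed count of
  the steps b and -b in each residue class is a martingale. Simplicity of the roots makes \<phi>
  diagonalizable, which is why a single factor \<phi>^N - 1 suffices. The lower bounds come from the
  height alone, since the projection to the integers is Lipschitz.\<close>

lemma int_div_mod_bounds:
  fixes a c :: int
  assumes "c \<noteq> 0"
  shows "\<bar>a mod c\<bar> < \<bar>c\<bar>" "real_of_int \<bar>a div c\<bar> \<le> real_of_int \<bar>a\<bar> / real_of_int \<bar>c\<bar> + 1"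
proof -
  show mod: "\<bar>a mod c\<bar> < \<bar>c\<bar>"
    using assms by (simp add: abs_mod_less)
  have "\<bar>a div c\<bar> * \<bar>c\<bar> = \<bar>a - a mod c\<bar>"
    by (simp add: abs_mult[symmetric] minus_mod_eq_div_mult)
  also have "\<dots> \<le> \<bar>a\<bar> + \<bar>c\<bar>" using mod by linarith
  finally have "real_of_int (\<bar>a div c\<bar> * \<bar>c\<bar>) \<le> real_of_int (\<bar>a\<bar> + \<bar>c\<bar>)" by linarith
  then show "real_of_int \<bar>a div c\<bar> \<le> real_of_int \<bar>a\<bar> / real_of_int \<bar>c\<bar> + 1"
    using assms by (simp add: field_simps)
qed

text \<open>The factor \<open>monom 1 m\<close> lines up each coefficient of P with the entry c of
  q, so subtracting its quotient by c leaves a remainder below |c| there. The other coefficients of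
  q spill at most r (B/|c| + 1) onto a given place, and r \<le> |c| bounds this by |c| + (r/|c|)
  B.\<close>

lemma topple_coeff_bound:
  fixes P q :: "int poly" and B :: real
  assumes c_def: "c = coeff q m" and c: "c \<noteq> 0" and P: "\<And>i. \<bar>real_of_int (coeff P i)\<bar> \<le> B"
    and rest: "(\<Sum>i\<in>{..degree q} - {m}. \<bar>coeff q i\<bar>) \<le> r" and r: "r \<le> \<bar>c\<bar>"
  shows "\<bar>real_of_int (coeff (monom 1 m * P - map_poly (\<lambda>x. x div c) P * q) i)\<bar>
    \<le> 2 * real_of_int \<bar>c\<bar> + real_of_int r / real_of_int \<bar>c\<bar> * B"
proof -
  let ?F = "map_poly (\<lambda>x. x div c) P"
  have F: "coeff ?F i = coeff P i div c" for i by (simp add: coeff_map_poly)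
  have B0: "0 \<le> B" using P[of 0] by (meson abs_ge_zero order_trans)
  have r0: "0 \<le> r" by (rule order_trans[OF sum_nonneg rest]) simp
  have fb: "\<bar>real_of_int (coeff ?F j)\<bar> \<le> B / \<bar>c\<bar> + 1" for j
  proof -
    have "\<bar>real_of_int (coeff ?F j)\<bar> \<le> \<bar>real_of_int (coeff P j)\<bar> / \<bar>c\<bar> + 1"
      using int_div_mod_bounds(2)[OF c, of "coeff P j"] by (simp add: F)
    also have "\<dots> \<le> B / \<bar>c\<bar> + 1" using P[of j] by (simp add: divide_right_mono)
    finally show ?thesis .
  qed
  have qF: "coeff (?F * q) i = (\<Sum>j\<le>i. coeff q j * coeff ?F (i - j))"
    by (simp only: mult.commute[of ?F q] coeff_mult)
  define S where "S = (\<Sum>j\<in>{..i} - {m}. coeff q j * coeff ?F (i - j))"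
  have "\<bar>coeff (monom 1 m * P - ?F * q) i + S\<bar> \<le> \<bar>c\<bar>"
  proof (cases "m \<le> i")
    case True
    then have "coeff (?F * q) i = c * coeff ?F (i - m) + S"
      unfolding qF S_def using sum.remove[of "{..i}" m "\<lambda>j. coeff q j * coeff ?F (i - j)"]
      by (simp add: c_def)
    moreover have "coeff (monom 1 m * P) i = coeff P (i - m)" using True by (simp add: coeff_monom_mult)
    ultimately have "coeff (monom 1 m * P - ?F * q) i + S = coeff P (i - m) mod c"
      by (simp add: F minus_mult_div_eq_mod)
    then show ?thesis using int_div_mod_bounds(1)[OF c, of "coeff P (i - m)"] by simp
  next
    case False
    then have "{..i} - {m} = {..i}" by auto
    then show ?thesis using False by (simp add: coeff_monom_mult qF S_def)
  qed
  then have 1: "\<bar>real_of_int (coeff (monom 1 m * P - ?F * q) i) + real_of_int S\<bar> \<le> \<bar>c\<bar>"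
    by (metis of_int_abs of_int_add of_int_le_iff)
  have "\<bar>real_of_int S\<bar> \<le> (\<Sum>j\<in>{..i} - {m}. \<bar>real_of_int (coeff q j)\<bar> * \<bar>real_of_int (coeff ?F (i - j))\<bar>)"
    unfolding S_def of_int_sum of_int_mult abs_mult[symmetric] by (rule sum_abs)
  also have "\<dots> \<le> (\<Sum>j\<in>{..i} - {m}. \<bar>real_of_int (coeff q j)\<bar> * (B / \<bar>c\<bar> + 1))"
    by (intro sum_mono mult_left_mono fb) auto
  also have "\<dots> = real_of_int (\<Sum>j\<in>{..i} - {m}. \<bar>coeff q j\<bar>) * (B / \<bar>c\<bar> + 1)"
    by (simp add: sum_distrib_right)
  also have "\<dots> \<le> real_of_int r * (B / \<bar>c\<bar> + 1)"
  proof (rule mult_right_mono)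
    have "(\<Sum>j\<in>{..i} - {m}. \<bar>coeff q j\<bar>) = (\<Sum>j\<in>{..i} \<inter> {..degree q} - {m}. \<bar>coeff q j\<bar>)"
      by (intro sum.mono_neutral_right) (auto intro: le_degree)
    also have "\<dots> \<le> (\<Sum>j\<in>{..degree q} - {m}. \<bar>coeff q j\<bar>)"
      by (intro sum_mono2) auto
    finally show "real_of_int (\<Sum>j\<in>{..i} - {m}. \<bar>coeff q j\<bar>) \<le> real_of_int r"
      using rest by linarith
  qed (use B0 in simp)
  also have "\<dots> \<le> \<bar>c\<bar> + r / \<bar>c\<bar> * B" using r by (simp add: algebra_simps)
  finally show ?thesis using 1 by linarith
qed

text \<open>\<open>L R P\<close> is the length of the group element \<open>\<phi>\<^sup>-\<^sup>R P(\<phi>) u\<close>, where \<open>q(\<phi>) u = 0\<close>.\<close>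

lemma length_log_bound:
  fixes L :: "nat \<Rightarrow> int poly \<Rightarrow> real" and q :: "int poly"
  assumes shift: "\<And>R P. L (Suc R) (pCons 0 P) = L R P"
    and reduce: "\<And>R P F. L R (P - F * q) = L R P"
    and K: "0 \<le> K"
    and horner: "\<And>R P B. (\<And>i. \<bar>real_of_int (coeff P i)\<bar> \<le> B) \<Longrightarrow>
      L R P \<le> K * (real R + real (degree P) + 1) * (B + 1)"
    and dominant: "(\<Sum>i\<in>{..degree q} - {m}. \<bar>coeff q i\<bar>) < \<bar>coeff q m\<bar>"
  obtains C where "0 \<le> C"
    "\<And>R P n. (\<And>i. \<bar>coeff P i\<bar> \<le> int n) \<Longrightarrow>
      L R P \<le> C * (real R + real (degree P) + ln (real n + 2) + 1)"
proof -
  define c where "c = coeff q m"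
  define r where "r = (\<Sum>i\<in>{..degree q} - {m}. \<bar>coeff q i\<bar>)"
  define D where "D = real (m + degree q)"
  have r0: "0 \<le> r" unfolding r_def by (rule sum_nonneg) simp
  have rc: "r < \<bar>c\<bar>" using dominant by (simp add: r_def c_def)
  then have c: "c \<noteq> 0" using r0 by auto
  have m: "m \<le> degree q" using c unfolding c_def by (meson coeff_eq_0 not_le)
  \<comment> \<open>The midpoint of r/|c| and 1: still a contraction factor, and positive even for r
    = 0, so that ln (1/\<theta>) makes sense.\<close>
  define \<theta> where "\<theta> = (real_of_int r + \<bar>real_of_int c\<bar>) / (2 * \<bar>real_of_int c\<bar>)"
  have rc': "real_of_int r < \<bar>real_of_int c\<bar>" using rc by linarith
  have \<theta>: "0 < \<theta>" "\<theta> < 1" "r / \<bar>c\<bar> \<le> \<theta>"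
    using c r0 rc' unfolding \<theta>_def by (auto simp: field_simps)
  \<comment> \<open>The fixed point of x \<mapsto> 2|c| + \<theta> x, the map that bounds the
    coefficients after one round.\<close>
  define b where "b = 2 * \<bar>c\<bar> / (1 - \<theta>)"
  have b: "0 \<le> b" "2 * real_of_int \<bar>c\<bar> + \<theta> * b = b"
    using \<theta> by (simp_all add: b_def field_simps)
  have L_monom: "L (R + k) (monom 1 k * P) = L R P" for R k P
    by (induction k) (simp_all add: monom_Suc shift)
  \<comment> \<open>Here x is the excess over b. Each round multiplies it by \<theta>, raises R by m
    and the degree by at most \<open>degree q\<close>; the last two add up to D.\<close>
  have iter: "L R P \<le> K * (real R + real (degree P) + real k * D + 1) * (b + \<theta> ^ k * x + 1)"
    if "0 \<le> x" "\<And>i. \<bar>real_of_int (coeff P i)\<bar> \<le> b + x" for R P k x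
    using that
  proof (induction k arbitrary: R P x)
    case 0
    then show ?case using horner[of P "b + x" R] by simp
  next
    case (Suc k)
    define P' where "P' = monom 1 m * P - map_poly (\<lambda>x. x div c) P * q"
    have "L R P = L (R + m) P'"
      unfolding P'_def reduce L_monom ..
    also have "\<dots> \<le> K * (real (R + m) + real (degree P') + real k * D + 1) * (b + \<theta> ^ k * (\<theta> * x) + 1)"
    proof (rule Suc.IH)
      show "0 \<le> \<theta> * x" using \<theta> Suc.prems by simp
      fix i
      have "\<bar>real_of_int (coeff P' i)\<bar> \<le> 2 * real_of_int \<bar>c\<bar> + real_of_int r / real_of_int \<bar>c\<bar> * (b + x)"
        unfolding P'_def
        by (rule topple_coeff_bound[OF c_def c Suc.prems(2)]) (use rc in \<open>simp_all add: r_def\<close>)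
      also have "\<dots> \<le> 2 * real_of_int \<bar>c\<bar> + \<theta> * (b + x)"
        using \<theta> b Suc.prems by (intro add_left_mono mult_right_mono) auto
      also have "\<dots> = b + \<theta> * x" using b(2) by (simp add: distrib_left)
      finally show "\<bar>real_of_int (coeff P' i)\<bar> \<le> b + \<theta> * x" .
    qed
    also have "\<dots> \<le> K * (real R + real (degree P) + real (Suc k) * D + 1) * (b + \<theta> ^ k * (\<theta> * x) + 1)"
    proof (intro mult_right_mono mult_left_mono K)
      have "degree P' \<le> degree P + degree q"
        unfolding P'_def
      proof (rule degree_diff_le)
        show "degree (monom 1 m * P) \<le> degree P + degree q"
          using degree_mult_le[of "monom 1 m" P] degree_monom_le[of "1 :: int" m] m by linarith
        show "degree (map_poly (\<lambda>x. x div c) P * q) \<le> degree P + degree q"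
        proof -
          have "degree (map_poly (\<lambda>x. x div c) P) \<le> degree P"
            by (rule degree_le) (simp add: coeff_map_poly coeff_eq_0)
          then show ?thesis using degree_mult_le[of "map_poly (\<lambda>x. x div c) P" q] by linarith
        qed
      qed
      then show "real (R + m) + real (degree P') + real k * D + 1
          \<le> real R + real (degree P) + real (Suc k) * D + 1"
        unfolding D_def by (simp add: algebra_simps)
      show "0 \<le> b + \<theta> ^ k * (\<theta> * x) + 1" using b \<theta> Suc.prems by simp
    qed
    finally show ?case by (simp add: mult.assoc mult.left_commute)
  qed
  define l where "l = ln (1 / \<theta>)"
  have l: "0 < l" using \<theta> by (simp add: l_def)
  define C where "C = K * (b + 2) * (1 + D / l + D)"
  have bound: "L R P \<le> C * (real R + real (degree P) + ln (real n + 2) + 1)"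
    if P: "\<And>i. \<bar>coeff P i\<bar> \<le> int n" for R P n
  proof -
    \<comment> \<open>Enough rounds for \<theta>^k \<le> 1/(n + 2), which brings the excess n down
      to at most 1.\<close>
    define k where "k = nat \<lceil>ln (real n + 2) / l\<rceil>"
    have k: "ln (real n + 2) / l \<le> real k" "real k \<le> ln (real n + 2) / l + 1"
    proof -
      have "0 \<le> ln (real n + 2) / l" using l by simp
      then show "ln (real n + 2) / l \<le> real k" "real k \<le> ln (real n + 2) / l + 1"
        unfolding k_def by linarith+
    qed
    have "\<theta> ^ k * real n \<le> 1"
    proof -
      have "\<theta> ^ k = exp (- (l * real k))"
        using \<theta> by (simp add: l_def ln_div exp_of_nat2_mult)
      also have "\<dots> \<le> exp (- ln (real n + 2))"
        using k(1) l by (simp add: field_simps)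
      also have "\<dots> = 1 / (real n + 2)" by (simp add: exp_minus inverse_eq_divide)
      finally have "\<theta> ^ k * real n \<le> 1 / (real n + 2) * real n" by (intro mult_right_mono) auto
      also have "\<dots> \<le> 1" by (simp add: field_simps)
      finally show ?thesis .
    qed
    have D: "0 \<le> D" by (simp add: D_def)
    have ln0: "0 \<le> ln (real n + 2)" by simp
    have "\<bar>real_of_int (coeff P i)\<bar> \<le> b + real n" for i
      using P[of i] b(1) by linarith
    then have "L R P \<le> K * (real R + real (degree P) + real k * D + 1) * (b + \<theta> ^ k * real n + 1)"
      by (intro iter) auto
    also have "\<dots> \<le> K * (real R + real (degree P) + (ln (real n + 2) / l + 1) * D + 1) * (b + 1 + 1)"
      using K D b \<theta> k(2) \<open>\<theta> ^ k * real n \<le> 1\<close> l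
      by (intro mult_mono mult_left_mono add_mono mult_right_mono order_refl) auto
    also have "\<dots> = K * (b + 2) * (real R + real (degree P) + (ln (real n + 2) / l + 1) * D + 1)"
      by simp
    also have "\<dots> \<le> K * (b + 2) * ((1 + D / l + D) * (real R + real (degree P) + ln (real n + 2) + 1))"
    proof (rule mult_left_mono)
      have "0 \<le> D / l" using D l by simp
      define u where "u = real R + real (degree P)"
      have "0 \<le> u" by (simp add: u_def)
      have "0 \<le> ln (real n + 2) + (D / l + D) * u + D / l + D * ln (real n + 2)"
        using ln0 D \<open>0 \<le> D / l\<close> \<open>0 \<le> u\<close> by (intro add_nonneg_nonneg mult_nonneg_nonneg) auto
      then show "real R + real (degree P) + (ln (real n + 2) / l + 1) * D + 1
          \<le> (1 + D / l + D) * (real R + real (degree P) + ln (real n + 2) + 1)"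
        unfolding u_def by (simp add: algebra_simps)
      show "0 \<le> K * (b + 2)" using K b by simp
    qed
    finally show ?thesis by (simp add: C_def mult.assoc)
  qed
  have "0 \<le> C" using K b l by (simp add: C_def D_def)
  then show thesis using bound by (rule that)
qed

section \<open>Polynomials acting on vectors\<close>

text \<open>This is p(A) v, computed by Horner's rule so that only products of a matrix with a
  vector occur. The zero vector takes its dimension from v.\<close>

definition poly_act :: "complex mat \<Rightarrow> complex poly \<Rightarrow> complex vec \<Rightarrow> complex vec" where
  "poly_act A p v = fold_coeffs (\<lambda>a w. a \<cdot>\<^sub>v v + A *\<^sub>v w) p (0\<^sub>v (dim_vec v))"

lemma poly_act_0 [simp]: "poly_act A 0 v = 0\<^sub>v (dim_vec v)"
  by (simp add: poly_act_def)

context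
  fixes A :: "complex mat" and d :: nat
  assumes A: "A \<in> carrier_mat d d"
begin

lemma poly_act_pCons:
  assumes "v \<in> carrier_vec d"
  shows "poly_act A (pCons a p) v = a \<cdot>\<^sub>v v + A *\<^sub>v poly_act A p v"
proof (cases "p = 0 \<and> a = 0")
  case True
  moreover have "A *\<^sub>v 0\<^sub>v d = 0\<^sub>v d" using A by (intro eq_vecI) auto
  ultimately show ?thesis using assms by (auto intro!: eq_vecI)
next
  case False
  then show ?thesis by (auto simp: poly_act_def)
qed

lemma poly_act_carrier: "v \<in> carrier_vec d \<Longrightarrow> poly_act A p v \<in> carrier_vec d"
proof (induction p)
  case (pCons a p)
  then show ?case using A by (simp add: poly_act_pCons)
qed simp

lemma poly_act_add:
  assumes v: "v \<in> carrier_vec d"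
  shows "poly_act A (p + q) v = poly_act A p v + poly_act A q v"
proof (induction p arbitrary: q)
  case 0
  then show ?case using poly_act_carrier[OF v, of q] v by simp
next
  case (pCons a p)
  obtain b q' where q: "q = pCons b q'" by (cases q)
  let ?p = "poly_act A p v" and ?q = "poly_act A q' v"
  have c: "?p \<in> carrier_vec d" "?q \<in> carrier_vec d" by (rule poly_act_carrier[OF v])+
  have "poly_act A (pCons a p + q) v = (a + b) \<cdot>\<^sub>v v + A *\<^sub>v (?p + ?q)"
    by (simp add: q poly_act_pCons[OF v] pCons.IH)
  also have "A *\<^sub>v (?p + ?q) = A *\<^sub>v ?p + A *\<^sub>v ?q"
    by (rule mult_add_distrib_mat_vec[OF A c])
  also have "(a + b) \<cdot>\<^sub>v v = a \<cdot>\<^sub>v v + b \<cdot>\<^sub>v v" by (rule add_smult_distrib_vec)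
  also have "a \<cdot>\<^sub>v v + b \<cdot>\<^sub>v v + (A *\<^sub>v ?p + A *\<^sub>v ?q) = (a \<cdot>\<^sub>v v + A *\<^sub>v ?p) + (b \<cdot>\<^sub>v v + A *\<^sub>v ?q)"
    using v A c by (intro eq_vecI) auto
  finally show ?case by (simp add: q poly_act_pCons[OF v])
qed

lemma poly_act_smult:
  assumes v: "v \<in> carrier_vec d"
  shows "poly_act A (Polynomial.smult c p) v = c \<cdot>\<^sub>v poly_act A p v"
proof (induction p)
  case 0
  then show ?case using v by (intro eq_vecI) auto
next
  case (pCons a p)
  let ?p = "poly_act A p v"
  have c: "?p \<in> carrier_vec d" by (rule poly_act_carrier[OF v])
  have "poly_act A (Polynomial.smult c (pCons a p)) v = (c * a) \<cdot>\<^sub>v v + A *\<^sub>v (c \<cdot>\<^sub>v ?p)"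
    by (simp add: poly_act_pCons[OF v] pCons.IH)
  also have "A *\<^sub>v (c \<cdot>\<^sub>v ?p) = c \<cdot>\<^sub>v (A *\<^sub>v ?p)" by (rule mult_mat_vec[OF A c])
  also have "(c * a) \<cdot>\<^sub>v v + c \<cdot>\<^sub>v (A *\<^sub>v ?p) = c \<cdot>\<^sub>v (a \<cdot>\<^sub>v v + A *\<^sub>v ?p)"
    using v A c by (intro eq_vecI) (auto simp: algebra_simps)
  finally show ?case by (simp add: poly_act_pCons[OF v])
qed

lemma poly_act_minus:
  assumes v: "v \<in> carrier_vec d"
  shows "poly_act A (p - q) v = poly_act A p v - poly_act A q v"
proof -
  have "poly_act A (p - q) v = poly_act A p v + (- 1) \<cdot>\<^sub>v poly_act A q v"
    using poly_act_add[OF v, of p "Polynomial.smult (- 1) q"] by (simp add: poly_act_smult[OF v, symmetric])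
  also have "\<dots> = poly_act A p v - poly_act A q v"
    using poly_act_carrier[OF v] by (intro eq_vecI) auto
  finally show ?thesis .
qed

lemma poly_act_mult:
  assumes v: "v \<in> carrier_vec d"
  shows "poly_act A (p * q) v = poly_act A p (poly_act A q v)"
proof (induction p)
  case 0
  then show ?case using v poly_act_carrier[OF v, of q] by simp
next
  case (pCons a p)
  have c: "poly_act A q v \<in> carrier_vec d" by (rule poly_act_carrier[OF v])
  have "poly_act A (pCons a p * q) v = a \<cdot>\<^sub>v poly_act A q v + (0 \<cdot>\<^sub>v v + A *\<^sub>v poly_act A p (poly_act A q v))"
    by (simp add: poly_act_add[OF v] poly_act_smult[OF v] poly_act_pCons[OF v] pCons.IH)
  also have "0 \<cdot>\<^sub>v v + A *\<^sub>v poly_act A p (poly_act A q v) = A *\<^sub>v poly_act A p (poly_act A q v)"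
    using v A poly_act_carrier[OF c] by (intro eq_vecI) auto
  finally show ?case by (simp add: poly_act_pCons[OF c])
qed

lemma poly_act_zero_vec: "poly_act A p (0\<^sub>v d) = 0\<^sub>v d"
proof (induction p)
  case (pCons a p)
  then show ?case using A by (intro eq_vecI) (auto simp: poly_act_pCons)
qed simp

text \<open>In the coordinates w = Q v, the matrix A multiplies the i-th entry by l i, so f(A) v is
  P applied to the vector with entries f(l i) w i, by induction on f. For f = p all these entries
  vanish.\<close>

lemma poly_act_diagonalizable:
  assumes P: "P \<in> carrier_mat d d" and Q: "Q \<in> carrier_mat d d"
    and D: "D \<in> carrier_mat d d"
    and diag: "\<And>i j. i < d \<Longrightarrow> j < d \<Longrightarrow> D $$ (i, j) = (if i = j then l i else 0)"
    and AD: "A * P = P * D" and PQ: "P * Q = 1\<^sub>m d"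
    and zero: "\<And>i. i < d \<Longrightarrow> poly p (l i) = 0" and v: "v \<in> carrier_vec d"
  shows "poly_act A p v = 0\<^sub>v d"
proof -
  let ?w = "Q *\<^sub>v v"
  have w: "?w \<in> carrier_vec d" using Q v by simp
  have vw: "v = P *\<^sub>v ?w"
    using PQ P Q v by (simp add: assoc_mult_mat_vec[symmetric])
  have "poly_act A f v = P *\<^sub>v vec d (\<lambda>i. poly f (l i) * ?w $ i)" for f
  proof (induction f)
    case 0
    then show ?case using v P by (intro eq_vecI) (auto simp: scalar_prod_def)
  next
    case (pCons a f)
    let ?u = "vec d (\<lambda>i. poly f (l i) * ?w $ i)"
    have u: "?u \<in> carrier_vec d" by simp
    have "poly_act A (pCons a f) v = a \<cdot>\<^sub>v (P *\<^sub>v ?w) + A *\<^sub>v (P *\<^sub>v ?u)"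
      by (simp only: poly_act_pCons[OF v] pCons.IH vw[symmetric])
    also have "A *\<^sub>v (P *\<^sub>v ?u) = P *\<^sub>v (D *\<^sub>v ?u)"
      using assoc_mult_mat_vec[OF A P u] assoc_mult_mat_vec[OF P D u] by (simp only: AD)
    also have "a \<cdot>\<^sub>v (P *\<^sub>v ?w) = P *\<^sub>v (a \<cdot>\<^sub>v ?w)" by (rule mult_mat_vec[OF P w, symmetric])
    also have "P *\<^sub>v (a \<cdot>\<^sub>v ?w) + P *\<^sub>v (D *\<^sub>v ?u) = P *\<^sub>v (a \<cdot>\<^sub>v ?w + D *\<^sub>v ?u)"
      using w D by (intro mult_add_distrib_mat_vec[OF P, symmetric]) auto
    also have "a \<cdot>\<^sub>v ?w + D *\<^sub>v ?u = vec d (\<lambda>i. poly (pCons a f) (l i) * ?w $ i)"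
    proof (rule eq_vecI)
      fix i
      assume "i < dim_vec (vec d (\<lambda>i. poly (pCons a f) (l i) * ?w $ i))"
      then have i: "i < d" by simp
      have "(D *\<^sub>v ?u) $ i = (\<Sum>j = 0..<d. D $$ (i, j) * ?u $ j)"
        using i D by (simp add: scalar_prod_def row_def)
      also have "\<dots> = (\<Sum>j = 0..<d. if j = i then l i * ?u $ i else 0)"
        using i diag by (intro sum.cong) auto
      also have "\<dots> = l i * ?u $ i" using i by simp
      finally show "(a \<cdot>\<^sub>v ?w + D *\<^sub>v ?u) $ i = vec d (\<lambda>i. poly (pCons a f) (l i) * ?w $ i) $ i"
        using i w D Q v by (simp add: algebra_simps)
    qed (use D Q in auto)
    finally show ?case .
  qed
  moreover have "vec d (\<lambda>i. poly p (l i) * ?w $ i) = 0\<^sub>v d" using zero by (intro eq_vecI) auto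
  moreover have "P *\<^sub>v 0\<^sub>v d = 0\<^sub>v d" using P by (intro eq_vecI) auto
  ultimately show ?thesis by simp
qed

end

lemma sum_list_fst_ones:
  assumes "\<forall>x\<in>set xs. fst x = (1 :: nat)"
  shows "sum_list (map fst xs) = length xs"
  using assms by (induction xs) auto

lemma jordan_matrix_diagonal:
  assumes "\<forall>x\<in>set n_as. fst x = 1" "i < length n_as" "j < length n_as"
  shows "jordan_matrix n_as $$ (i, j) = (if i = j then snd (n_as ! i) else 0)"
  using assms
proof (induction n_as arbitrary: i j)
  case (Cons x n_as)
  obtain a where x: "x = (1, a)" using Cons.prems(1) by (cases x) auto
  have "sum_list (map fst n_as) = length n_as"
    using Cons.prems(1) by (intro sum_list_fst_ones) simp
  then show ?case
    using Cons.prems Cons.IH[of "i - 1" "j - 1"]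
    by (cases i; cases j) (auto simp: x jordan_matrix_Cons)
qed simp

text \<open>The order of an eigenvalue bounds the size of its Jordan blocks, so simple roots make A
  diagonalizable. This reduces the vanishing of p(A) to a comparison of complex roots, without any
  divisibility between integer polynomials.\<close>

lemma poly_act_eq_zero:
  assumes A: "A \<in> carrier_mat d d" and simple: "\<And>z. Polynomial.order z (char_poly A) \<le> 1"
    and roots: "\<And>z. poly (char_poly A) z = 0 \<Longrightarrow> poly p z = 0" and v: "v \<in> carrier_vec d"
  shows "poly_act A p v = 0\<^sub>v d"
proof -
  obtain as where "char_poly A = (\<Prod>a\<leftarrow>as. [:- a, 1:])" using char_poly_factorized[OF A] by blast
  from jordan_nf_exists[OF A this] obtain n_as where jnf: "jordan_nf A n_as" by blast
  have one: "n = 1" if "(n, a) \<in> set n_as" for n a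
  proof -
    have "n \<le> 1" using jordan_nf_block_size_order_bound[OF jnf that] simple[of a] by linarith
    moreover have "n \<noteq> 0" using jnf that unfolding jordan_nf_def by (metis fst_conv image_eqI)
    ultimately show ?thesis by linarith
  qed
  then have ones: "\<forall>x\<in>set n_as. fst x = 1" by auto
  obtain P Q where wit: "similar_mat_wit A (jordan_matrix n_as) P Q"
    using jnf unfolding jordan_nf_def similar_mat_def by blast
  let ?D = "jordan_matrix n_as"
  have d: "P \<in> carrier_mat d d" "Q \<in> carrier_mat d d" "?D \<in> carrier_mat d d"
    and PQ: "P * Q = 1\<^sub>m d" "Q * P = 1\<^sub>m d" and AP: "A = P * ?D * Q"
    using wit A unfolding similar_mat_wit_def Let_def by auto
  have len: "length n_as = d"
  proof -
    have "sum_list (map fst n_as) = length n_as" by (rule sum_list_fst_ones[OF ones])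
    then show ?thesis using d(3) by (metis carrier_matD(1) jordan_matrix_dim(1))
  qed
  show ?thesis
  proof (rule poly_act_diagonalizable[OF A d(1,2,3), where l = "\<lambda>i. snd (n_as ! i)"])
    show "?D $$ (i, j) = (if i = j then snd (n_as ! i) else 0)" if "i < d" "j < d" for i j
      using jordan_matrix_diagonal[OF ones, of i j] that len by blast
    have "P * ?D * Q * P = P * ?D * (Q * P)"
      using d by (intro assoc_mult_mat[of _ d d _ d _ d]) auto
    also have "\<dots> = P * ?D"
      unfolding PQ using d by (intro right_mult_one_mat[of _ d]) auto
    finally show "A * P = P * ?D" by (simp add: AP[symmetric])
    show "P * Q = 1\<^sub>m d" by (rule PQ)
    show "poly p (snd (n_as ! i)) = 0" if "i < d" for i
    proof (rule roots)
      have mem: "(1, snd (n_as ! i)) \<in> set n_as"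
        using one that len by (metis nth_mem prod.collapse)
      then have "1 \<le> Polynomial.order (snd (n_as ! i)) (char_poly A)"
        by (rule jordan_nf_block_size_order_bound[OF jnf])
      then show "poly (char_poly A) (snd (n_as ! i)) = 0"
        by (metis not_one_le_zero order_root order_0I)
    qed
    show "v \<in> carrier_vec d" by (rule v)
  qed
qed

section \<open>Kronecker's theorem on integer polynomials with roots on the unit circle\<close>

lemma card_roots_rsquarefree:
  fixes p :: "complex poly"
  assumes "rsquarefree p"
  shows "card {z. poly p z = 0} = degree p"
proof -
  have p: "p \<noteq> 0" using assms by (simp add: rsquarefree_def)
  then have fin: "finite {z. poly p z = 0}" by (rule poly_roots_finite)
  have "degree p = degree (Polynomial.smult (lead_coeff p) (\<Prod>z|poly p z = 0. [:-z, 1:]))"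
    by (simp only: complex_poly_decompose_rsquarefree[OF assms])
  also have "\<dots> = (\<Sum>z|poly p z = 0. degree [:-z, 1:])"
    using p by (simp add: degree_prod_sum_eq)
  finally show ?thesis by simp
qed

text \<open>Lagrange interpolation at the points of Z: the coefficients are fixed linear
  combinations of the values of p, so B depends on Z only.\<close>

lemma interpolation_coeff_bound:
  fixes Z :: "complex set"
  assumes "finite Z"
  obtains B :: real where
    "\<And>p i. degree p < card Z \<Longrightarrow> (\<And>z. z \<in> Z \<Longrightarrow> cmod (poly p z) \<le> 1) \<Longrightarrow> i < card Z \<Longrightarrow> cmod (coeff p i) \<le> B"
proof -
  define L where "L z = (\<Prod>y\<in>Z - {z}. Polynomial.smult (1 / (z - y)) [:- y, 1:])" for z
  have L_eval: "poly (L z) x = (if x = z then 1 else 0)" if "z \<in> Z" "x \<in> Z" for x z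
  proof -
    have "poly (L z) x = (\<Prod>y\<in>Z - {z}. (x - y) / (z - y))"
      by (simp add: L_def poly_prod diff_divide_distrib)
    then show ?thesis
      using that assms by (cases "x = z") (auto intro!: prod.neutral)
  qed
  have L_deg: "degree (L z) < card Z" if "z \<in> Z" for z
  proof -
    have "degree (L z) \<le> (\<Sum>y\<in>Z - {z}. degree (Polynomial.smult (1 / (z - y)) [:- y, 1:]))"
      unfolding L_def using degree_prod_sum_le[of "Z - {z}" "\<lambda>y. Polynomial.smult (1 / (z - y)) [:- y, 1:]"] assms
      by (simp add: o_def)
    also have "\<dots> \<le> (\<Sum>y\<in>Z - {z}. 1)" by (intro sum_mono) simp
    also have "\<dots> = card Z - 1" using that by simp
    also have "\<dots> < card Z" using that assms by (metis card_gt_0_iff diff_less emptyE less_one)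
    finally show ?thesis .
  qed
  define B where "B = (\<Sum>i<card Z. \<Sum>z\<in>Z. cmod (coeff (L z) i))"
  have "cmod (coeff p i) \<le> B"
    if deg: "degree p < card Z" and le: "\<And>z. z \<in> Z \<Longrightarrow> cmod (poly p z) \<le> 1" and i: "i < card Z" for p i
  proof -
    let ?q = "\<Sum>z\<in>Z. Polynomial.smult (poly p z) (L z)"
    have "p = ?q"
    proof (rule poly_eqI_degree[of Z])
      fix x
      assume x: "x \<in> Z"
      have "poly ?q x = (\<Sum>z\<in>Z. poly p z * poly (L z) x)" by (simp add: poly_sum)
      also have "\<dots> = (\<Sum>z\<in>Z. if z = x then poly p x else 0)"
        using x by (intro sum.cong) (auto simp: L_eval)
      also have "\<dots> = poly p x" using x assms by simp
      finally show "poly p x = poly ?q x" by simp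
    next
      have "degree ?q < card Z \<or> Z = {}"
        by (cases "Z = {}") (auto intro!: degree_sum_less L_deg le_less_trans[OF degree_smult_le] simp: card_gt_0_iff assms)
      then show "degree ?q < card Z" using i by auto
    qed (rule deg)
    from arg_cong[OF this, of "\<lambda>f. coeff f i"]
    have "coeff p i = (\<Sum>z\<in>Z. poly p z * coeff (L z) i)" by (simp add: coeff_sum)
    also have "cmod \<dots> \<le> (\<Sum>z\<in>Z. cmod (poly p z) * cmod (coeff (L z) i))"
      unfolding norm_mult[symmetric] by (rule norm_sum)
    also have "\<dots> \<le> (\<Sum>z\<in>Z. 1 * cmod (coeff (L z) i))"
      by (intro sum_mono mult_right_mono le) auto
    also have "\<dots> \<le> B"
      unfolding B_def using i member_le_sum[of i "{..<card Z}" "\<lambda>i. \<Sum>z\<in>Z. cmod (coeff (L z) i)"]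
      by (simp add: sum_nonneg)
    finally show ?thesis .
  qed
  then show thesis by (rule that)
qed

lemma finite_bounded_int_polys:
  "finite {p :: int poly. degree p < n \<and> (\<forall>i<n. \<bar>coeff p i\<bar> \<le> b)}" (is "finite ?S")
proof (rule finite_imageD)
  let ?f = "\<lambda>p :: int poly. restrict (coeff p) {..<n}"
  have "?f ` ?S \<subseteq> {..<n} \<rightarrow>\<^sub>E {- b..b}" by (auto simp: abs_le_iff minus_le_iff split: if_splits)
  then show "finite (?f ` ?S)" by (rule finite_subset) (intro finite_PiE, auto)
  show "inj_on ?f ?S"
  proof (rule inj_onI, rule poly_eqI)
    fix p q i
    assume "p \<in> ?S" "q \<in> ?S" and eq: "?f p = ?f q"
    show "coeff p i = coeff q i"
      using \<open>p \<in> ?S\<close> \<open>q \<in> ?S\<close> fun_cong[OF eq, of i] by (cases "i < n") (auto simp: coeff_eq_0)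
  qed
qed

text \<open>Let \<open>r k\<close> be the remainder of t^k modulo p, which is integral because the
  leading coefficient is a unit. Its values z^k at the roots have modulus 1, so interpolation bounds
  its coefficients uniformly in k and only finitely many remainders occur. Hence
  \<open>r a = r b\<close> for some a < b, and z^a = z^b at every root.\<close>

lemma roots_of_unity_if_unit_circle:
  fixes p :: "int poly"
  assumes lead: "lead_coeff p = 1 \<or> lead_coeff p = - 1"
    and sqf: "rsquarefree (of_int_poly p :: complex poly)"
    and unit: "\<And>z :: complex. poly (of_int_poly p) z = 0 \<Longrightarrow> cmod z = 1"
  obtains N where "0 < N" "\<And>z :: complex. poly (of_int_poly p) z = 0 \<Longrightarrow> z ^ N = 1"
proof (cases "degree p = 0")
  case True
  then obtain a where a: "p = [:a:]" by (rule degree_eq_zeroE)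
  then have "a \<noteq> 0" using lead by auto
  then show thesis using that[of 1] by (simp add: a)
next
  case False
  define D where "D = degree p"
  define Z where "Z = {z :: complex. poly (of_int_poly p) z = 0}"
  \<comment> \<open>The leading coefficient is its own inverse, so the subtracted multiple of p
    cancels the coefficient of t^D.\<close>
  define r where "r = rec_nat (1 :: int poly)
    (\<lambda>_ f. pCons 0 f - Polynomial.smult (coeff (pCons 0 f) D * lead_coeff p) p)"
  have r_0: "r 0 = 1" and r_Suc: "r (Suc k) = pCons 0 (r k) - Polynomial.smult (coeff (pCons 0 (r k)) D * lead_coeff p) p" for k
    by (simp_all add: r_def)
  have D: "0 < D" using False by (simp add: D_def)
  have cardZ: "card Z = D"
    unfolding Z_def by (subst card_roots_rsquarefree[OF sqf]) (simp add: D_def)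
  have finZ: "finite Z" using cardZ D by (metis card.infinite less_irrefl)
  have deg: "degree (r k) < D" for k
  proof (induction k)
    case (Suc k)
    have "coeff (r (Suc k)) i = 0" if "D \<le> i" for i
    proof (cases "i = D")
      case True
      then show ?thesis using lead by (auto simp: r_Suc D_def)
    next
      case False
      then have "D < i" using that by simp
      then have "coeff p i = 0" "coeff (pCons 0 (r k)) i = 0"
        using Suc by (auto simp: coeff_eq_0 D_def coeff_pCons split: nat.split)
      then show ?thesis by (simp add: r_Suc)
    qed
    then have "r (Suc k) = 0" if "D \<le> degree (r (Suc k))"
      using that leading_coeff_0_iff by blast
    then show ?case using D by (cases "D \<le> degree (r (Suc k))") auto
  qed (simp add: r_0 D)
  have eval: "poly (of_int_poly (r k)) z = z ^ k" if "z \<in> Z" for z k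
  proof (induction k)
    case (Suc k)
    then show ?case using that by (simp add: r_Suc hom_distribs Z_def)
  qed (simp add: r_0)
  obtain B where B: "\<And>f i. degree f < card Z \<Longrightarrow> (\<And>z. z \<in> Z \<Longrightarrow> cmod (poly f z) \<le> 1) \<Longrightarrow> i < card Z \<Longrightarrow> cmod (coeff f i) \<le> B"
    using interpolation_coeff_bound[OF finZ] by blast
  have "\<bar>coeff (r k) i\<bar> \<le> \<lceil>B\<rceil>" if "i < D" for k i
  proof -
    have "cmod (coeff (of_int_poly (r k)) i) \<le> B"
    proof (rule B)
      show "degree (of_int_poly (r k) :: complex poly) < card Z" using deg[of k] by (simp add: cardZ)
      show "cmod (poly (of_int_poly (r k)) z) \<le> 1" if "z \<in> Z" for z
        using unit[of z] that by (simp add: eval norm_power Z_def)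
    qed (use that in \<open>simp add: cardZ\<close>)
    then have "real_of_int \<bar>coeff (r k) i\<bar> \<le> B" by simp
    then show ?thesis by linarith
  qed
  then have "range r \<subseteq> {f. degree f < D \<and> (\<forall>i<D. \<bar>coeff f i\<bar> \<le> \<lceil>B\<rceil>)}" using deg by auto
  then have "finite (range r)" by (rule finite_subset) (rule finite_bounded_int_polys)
  then have "\<not> inj r" using finite_imageD infinite_UNIV_nat by blast
  then obtain a b where "a < b" "r a = r b"
    unfolding inj_def by (metis linorder_neqE_nat)
  show thesis
  proof (rule that[of "b - a"])
    show "0 < b - a" using \<open>a < b\<close> by simp
    fix z :: complex
    assume z: "poly (of_int_poly p) z = 0"
    then have "z ^ a = z ^ b" using eval[of z a] eval[of z b] \<open>r a = r b\<close> by (simp add: Z_def)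
    moreover have "z ^ b = z ^ a * z ^ (b - a)" using \<open>a < b\<close> by (simp add: power_add[symmetric])
    moreover have "z \<noteq> 0" using unit[OF z] by auto
    ultimately show "z ^ (b - a) = 1" by simp
  qed
qed

section \<open>Laurent polynomials\<close>

definition laurent_eval :: "complex \<Rightarrow> complex laurent \<Rightarrow> complex" where
  "laurent_eval z f = (\<Sum>k\<in>Poly_Mapping.keys f. Poly_Mapping.lookup f k * z powi k)"

lemma laurent_eval_superset:
  assumes "finite X" "Poly_Mapping.keys f \<subseteq> X"
  shows "laurent_eval z f = (\<Sum>k\<in>X. Poly_Mapping.lookup f k * z powi k)"
  unfolding laurent_eval_def by (rule sum.mono_neutral_left) (use assms in \<open>auto simp: in_keys_iff\<close>)

lemma laurent_eval_add: "laurent_eval z (f + g) = laurent_eval z f + laurent_eval z g"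
proof -
  let ?X = "Poly_Mapping.keys f \<union> Poly_Mapping.keys g"
  have "laurent_eval z h = (\<Sum>k\<in>?X. Poly_Mapping.lookup h k * z powi k)"
    if "h = f + g \<or> h = f \<or> h = g" for h
    using that by (intro laurent_eval_superset) (auto simp: in_keys_iff lookup_add)
  then show ?thesis by (simp add: lookup_add distrib_right sum.distrib)
qed

lemma laurent_eval_sum: "laurent_eval z (\<Sum>i\<in>I. f i) = (\<Sum>i\<in>I. laurent_eval z (f i))"
proof (induction I rule: infinite_finite_induct)
  case (insert i I)
  then show ?case by (simp add: laurent_eval_add)
qed (simp_all add: laurent_eval_def)

lemma laurent_eval_single: "laurent_eval z (Poly_Mapping.single k a) = a * z powi k"
  by (subst laurent_eval_superset[of "{k}"]) auto

lemma sum_single_keys: "(\<Sum>k\<in>Poly_Mapping.keys f. Poly_Mapping.single k (Poly_Mapping.lookup f k)) = f"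
proof (rule poly_mapping_eqI)
  fix i
  have "Poly_Mapping.lookup (\<Sum>k\<in>Poly_Mapping.keys f. Poly_Mapping.single k (Poly_Mapping.lookup f k)) i
      = (\<Sum>k\<in>Poly_Mapping.keys f. if k = i then Poly_Mapping.lookup f i else 0)"
    unfolding lookup_sum by (intro sum.cong) (auto simp: lookup_single when_def)
  also have "\<dots> = Poly_Mapping.lookup f i" by (simp add: in_keys_iff)
  finally show "Poly_Mapping.lookup (\<Sum>k\<in>Poly_Mapping.keys f. Poly_Mapping.single k (Poly_Mapping.lookup f k)) i
      = Poly_Mapping.lookup f i" .
qed

lemma laurent_eval_mult:
  assumes "z \<noteq> 0"
  shows "laurent_eval z (f * g) = laurent_eval z f * laurent_eval z g"
proof -
  let ?s = "\<lambda>f k. Poly_Mapping.single k (Poly_Mapping.lookup f k)"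
  have "f * g = (\<Sum>i\<in>Poly_Mapping.keys f. \<Sum>j\<in>Poly_Mapping.keys g. ?s f i * ?s g j)"
    by (simp only: sum_product[symmetric] sum_single_keys)
  then have "laurent_eval z (f * g) = (\<Sum>i\<in>Poly_Mapping.keys f. \<Sum>j\<in>Poly_Mapping.keys g.
      (Poly_Mapping.lookup f i * z powi i) * (Poly_Mapping.lookup g j * z powi j))"
    by (simp add: laurent_eval_sum mult_single laurent_eval_single power_int_add assms mult_ac)
  then show ?thesis by (simp only: sum_product[symmetric] laurent_eval_def)
qed

lemma laurent_eval_of_poly: "laurent_eval z (laurent_of_poly p) = poly p z"
  by (simp add: laurent_of_poly_def laurent_eval_sum laurent_eval_single poly_altdef)

text \<open>The second largest absolute value is a positive integer, so the factor in (EDP) is at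
  most 2 and the sum of all absolute values is less than twice the largest one.\<close>

lemma EDP_dominant:
  assumes "EDP q"
  obtains k where "k \<in> Poly_Mapping.keys q"
    "(\<Sum>i\<in>Poly_Mapping.keys q - {k}. \<bar>Poly_Mapping.lookup q i\<bar>) < \<bar>Poly_Mapping.lookup q k\<bar>"
proof -
  let ?K = "Poly_Mapping.keys q" and ?a = "\<lambda>i. \<bar>Poly_Mapping.lookup q i\<bar>"
  have card: "card ?K \<ge> 2"
    and gt: "real_of_int (max1_coeff q) * (1 + 1 / real_of_int (max2_coeff q)) > real_of_int (\<Sum>i\<in>?K. ?a i)"
    using assms by (auto simp: EDP_def)
  have size: "size (abs_coeffs q) = card ?K" by (simp add: abs_coeffs_def)
  have pos: "1 \<le> x" if "x \<in># abs_coeffs q" for x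
    using that by (auto simp: abs_coeffs_def in_keys_iff)
  have "abs_coeffs q \<noteq> {#}" using size card by auto
  then have max1: "max1_coeff q \<in># abs_coeffs q"
    unfolding max1_coeff_def by (intro Max_in) auto
  then obtain k where k: "k \<in> ?K" "max1_coeff q = ?a k"
    by (auto simp: abs_coeffs_def)
  let ?R = "abs_coeffs q - {#max1_coeff q#}"
  have "size ?R = card ?K - 1" using max1 size by (simp add: size_Diff_singleton)
  then have "?R \<noteq> {#}" using card by auto
  then have "max2_coeff q \<in># ?R" unfolding max2_coeff_def by (intro Max_in) auto
  then have "1 \<le> max2_coeff q" using pos by (meson in_diffD)
  then have "1 / real_of_int (max2_coeff q) \<le> 1" by simp
  moreover have "0 \<le> real_of_int (max1_coeff q)" using k by simp
  ultimately have "real_of_int (max1_coeff q) * (1 + 1 / real_of_int (max2_coeff q)) \<le> real_of_int (max1_coeff q) * 2"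
    by (intro mult_left_mono) auto
  then have "(\<Sum>i\<in>?K. ?a i) < 2 * max1_coeff q" using gt by linarith
  moreover have "(\<Sum>i\<in>?K. ?a i) = ?a k + (\<Sum>i\<in>?K - {k}. ?a i)"
    by (rule sum.remove) (use k in auto)
  ultimately show thesis using k by (intro that[of k]) auto
qed

text \<open>Multiplication by t^(-s), with s the lowest exponent, turns the Laurent multiple into a
  polynomial with the same coefficients and the same nonzero roots. Divisibility passes to the roots
  by evaluation at z \<noteq> 0.\<close>

lemma dominant_polynomial_multiple:
  assumes mult: "laurent_multiple p ql" and edp: "EDP ql"
  obtains q :: "int poly" and m where
    "(\<Sum>i\<in>{..degree q} - {m}. \<bar>coeff q i\<bar>) < \<bar>coeff q m\<bar>"
    "\<And>z :: complex. z \<noteq> 0 \<Longrightarrow> poly (of_int_poly p) z = 0 \<Longrightarrow> poly (of_int_poly q) z = 0"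
proof -
  let ?K = "Poly_Mapping.keys ql" and ?l = "Poly_Mapping.lookup ql"
  obtain k where k: "k \<in> ?K" "(\<Sum>i\<in>?K - {k}. \<bar>?l i\<bar>) < \<bar>?l k\<bar>" by (rule EDP_dominant[OF edp])
  define s where "s = Min ?K"
  have s: "s \<le> i" if "i \<in> ?K" for i using that by (simp add: s_def)
  let ?e = "\<lambda>i. nat (i - s)"
  define q where "q = (\<Sum>i\<in>?K. monom (?l i) (?e i))"
  have inj: "inj_on ?e ?K" using s by (intro inj_onI) (metis eq_nat_nat_iff diff_ge_0_iff_ge diff_add_cancel)
  have coeff_q: "coeff q (?e j) = ?l j" if j: "j \<in> ?K" for j
  proof -
    have "coeff q (?e j) = (\<Sum>i\<in>?K. if i = j then ?l j else 0)"
      unfolding q_def coeff_sum using inj_onD[OF inj] j by (intro sum.cong) (auto simp: coeff_monom)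
    also have "\<dots> = ?l j" using j by simp
    finally show ?thesis .
  qed
  have coeff_q_0: "coeff q n = 0" if "n \<notin> ?e ` ?K" for n
    unfolding q_def coeff_sum using that by (intro sum.neutral) (auto simp: coeff_monom)
  have sub: "?e ` ?K \<subseteq> {..degree q}"
    using coeff_q by (auto simp: in_keys_iff intro!: le_degree)
  have "(\<Sum>i\<in>{..degree q} - {?e k}. \<bar>coeff q i\<bar>) = (\<Sum>i\<in>?e ` ?K - {?e k}. \<bar>coeff q i\<bar>)"
    using sub coeff_q_0 by (intro sum.mono_neutral_right) auto
  also have "?e ` ?K - {?e k} = ?e ` (?K - {k})"
    using inj k(1) by (simp add: inj_on_image_set_diff)
  also have "(\<Sum>i\<in>?e ` (?K - {k}). \<bar>coeff q i\<bar>) = (\<Sum>i\<in>?K - {k}. \<bar>?l i\<bar>)"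
    using inj by (subst sum.reindex) (auto simp: coeff_q intro: inj_on_subset)
  also have "\<dots> < \<bar>coeff q (?e k)\<bar>" using k by (simp add: coeff_q)
  finally have dom: "(\<Sum>i\<in>{..degree q} - {?e k}. \<bar>coeff q i\<bar>) < \<bar>coeff q (?e k)\<bar>" .
  have root: "poly (of_int_poly q) z = 0" if z: "z \<noteq> 0" "poly (of_int_poly p) z = 0" for z :: complex
  proof -
    let ?c = "Poly_Mapping.map of_int ql :: complex laurent"
    have keys: "Poly_Mapping.keys ?c \<subseteq> ?K"
      by (auto simp: in_keys_iff Poly_Mapping.map.rep_eq when_def)
    obtain g where "?c = laurent_of_poly (of_int_poly p) * g"
      using mult unfolding laurent_multiple_def by (auto elim: dvdE)
    then have "0 = laurent_eval z ?c"
      using z by (simp add: laurent_eval_mult laurent_eval_of_poly)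
    also have "\<dots> = (\<Sum>i\<in>?K. of_int (?l i) * z powi i)"
      using keys by (subst laurent_eval_superset[of ?K]) (auto simp: Poly_Mapping.map.rep_eq when_def intro!: sum.cong)
    also have "\<dots> = z powi s * (\<Sum>i\<in>?K. of_int (?l i) * z ^ ?e i)"
      unfolding sum_distrib_left
    proof (rule sum.cong)
      fix i
      assume i: "i \<in> ?K"
      have "z powi i = z powi (s + int (?e i))" using s[OF i] by simp
      also have "\<dots> = z powi s * z ^ ?e i" using z(1) s[OF i] by (subst power_int_add) (auto simp: power_int_def)
      finally show "of_int (?l i) * z powi i = z powi s * (of_int (?l i) * z ^ ?e i)" by simp
    qed simp
    also have "(\<Sum>i\<in>?K. of_int (?l i) * z ^ ?e i) = poly (of_int_poly q) z"
      by (simp add: q_def hom_distribs poly_sum poly_monom)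
    finally show ?thesis using z(1) by simp
  qed
  show thesis using dom root by (rule that)
qed

text \<open>The additional factor \<open>t\<close> covers a possible root \<open>0\<close> of \<open>p_plus\<close>, which need not be a root
  of \<open>q\<close>; it is harmless because \<open>\<phi>\<close> is injective.\<close>

lemma annihilating_polynomial:
  fixes A :: "complex mat" and p_plus p_zero :: "int poly"
  assumes A: "A \<in> carrier_mat d d"
    and char: "char_poly A = of_int_poly (p_plus * p_zero)"
    and mult: "laurent_multiple p_plus ql" and edp: "EDP ql"
    and plus: "rsquarefree (of_int_poly p_plus :: complex poly)"
      "\<And>z :: complex. poly (of_int_poly p_plus) z = 0 \<Longrightarrow> cmod z \<noteq> 1"
    and zero: "rsquarefree (of_int_poly p_zero :: complex poly)"
      "\<And>z :: complex. poly (of_int_poly p_zero) z = 0 \<Longrightarrow> cmod z = 1"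
  obtains N :: nat and q :: "int poly" and m where "0 < N"
    "(\<Sum>i\<in>{..degree q} - {m}. \<bar>coeff q i\<bar>) < \<bar>coeff q m\<bar>"
    "\<And>v. v \<in> carrier_vec d \<Longrightarrow> poly_act A (of_int_poly (pCons 0 (q * (monom 1 N - 1)))) v = 0\<^sub>v d"
proof -
  \<comment> \<open>The characteristic polynomial is monic, so both integer leading coefficients are
    units; Kronecker's theorem requires this of \<open>p_zero\<close>.\<close>
  have "lead_coeff (of_int_poly (p_plus * p_zero) :: complex poly) = 1"
    using degree_monic_char_poly[OF A] by (simp add: char)
  then have "of_int (lead_coeff (p_plus * p_zero)) = (1 :: complex)" by simp
  then have "lead_coeff p_plus * lead_coeff p_zero = 1"
    by (simp only: lead_coeff_mult of_int_eq_1_iff)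
  then have "lead_coeff p_zero = 1 \<or> lead_coeff p_zero = - 1"
    by (metis mult.commute zmult_eq_1_iff)
  from roots_of_unity_if_unit_circle[OF this zero]
  obtain N where N: "0 < N" "\<And>z :: complex. poly (of_int_poly p_zero) z = 0 \<Longrightarrow> z ^ N = 1" by blast
  obtain q m where dom: "(\<Sum>i\<in>{..degree q} - {m}. \<bar>coeff q i\<bar>) < \<bar>coeff q m\<bar>"
    and q: "\<And>z :: complex. z \<noteq> 0 \<Longrightarrow> poly (of_int_poly p_plus) z = 0 \<Longrightarrow> poly (of_int_poly q) z = 0"
    by (rule dominant_polynomial_multiple[OF mult edp]) (rule that)
  have c: "char_poly A = of_int_poly p_plus * of_int_poly p_zero" by (simp add: char hom_distribs)
  have nz: "of_int_poly p_plus * of_int_poly p_zero \<noteq> (0 :: complex poly)"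
    using plus(1) zero(1) by (simp add: rsquarefree_def)
  \<comment> \<open>The moduli of their roots keep the two squarefree factors from sharing a
    root.\<close>
  have simple: "Polynomial.order z (char_poly A) \<le> 1" for z
  proof -
    have "Polynomial.order z (of_int_poly p_plus :: complex poly) = 0
        \<or> Polynomial.order z (of_int_poly p_zero :: complex poly) = 0"
      using plus(2) zero(2) by (metis order_0I)
    then show ?thesis
      using plus(1) zero(1) unfolding c order_mult[OF nz] rsquarefree_def
      by (metis add.left_neutral add.right_neutral le_refl zero_le)
  qed
  have "poly (of_int_poly (pCons 0 (q * (monom 1 N - 1)))) z = 0" if "poly (char_poly A) z = 0" for z
  proof -
    have "poly (of_int_poly p_plus) z = 0 \<or> poly (of_int_poly p_zero) z = 0"
      using that by (simp add: c)
    then show ?thesis using N(2)[of z] q[of z]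
      by (cases "z = 0") (auto simp: hom_distribs poly_monom)
  qed
  from poly_act_eq_zero[OF A simple this]
  have "poly_act A (of_int_poly (pCons 0 (q * (monom 1 N - 1)))) v = 0\<^sub>v d"
    if "v \<in> carrier_vec d" for v using that by blast
  with N(1) dom show thesis by (rule that)
qed

section \<open>Independent increments with values in a countable set\<close>

text \<open>This stands in for measurability with respect to the first n steps: with countably many
  states and a finite support, such a function is automatically measurable, and integrable if it is
  real valued.\<close>

definition depends_below :: "nat \<Rightarrow> ((nat \<Rightarrow> 'a) \<Rightarrow> 'b) \<Rightarrow> bool" where
  "depends_below n F \<longleftrightarrow> (\<forall>w w'. (\<forall>k<n. w k = w' k) \<longrightarrow> F w = F w')"

lemma depends_belowI: "(\<And>w w'. (\<And>k. k < n \<Longrightarrow> w k = w' k) \<Longrightarrow> F w = F w') \<Longrightarrow> depends_below n F"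
  unfolding depends_below_def by blast

lemma depends_belowD: "depends_below n F \<Longrightarrow> (\<And>k. k < n \<Longrightarrow> w k = w' k) \<Longrightarrow> F w = F w'"
  unfolding depends_below_def by blast

lemma depends_below_comp: "depends_below n F \<Longrightarrow> depends_below n (\<lambda>w. f (F w))"
  unfolding depends_below_def by metis

lemma depends_below_case_nat:
  assumes "depends_below (Suc n) F"
  shows "depends_below n (\<lambda>w. F (case_nat x w))"
proof (rule depends_belowI)
  fix w w' :: "nat \<Rightarrow> 'a"
  assume "\<And>k. k < n \<Longrightarrow> w k = w' k"
  then show "F (case_nat x w) = F (case_nat x w')"
    by (intro depends_belowD[OF assms]) (auto split: nat.split)
qed

locale countable_iid =
  fixes \<mu> :: "'a pmf" and A :: "'a set"
  assumes countable_A: "countable A"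
    and finite_support: "finite (set_pmf \<mu>)"
    and support: "set_pmf \<mu> \<subseteq> A"
begin

abbreviation step :: "'a measure" where
  "step \<equiv> restrict_space (measure_pmf \<mu>) A"

text \<open>With A the carrier of G this is \<open>increments G \<mu>\<close>.\<close>

definition \<Omega> :: "(nat \<Rightarrow> 'a) measure" where
  "\<Omega> = Pi\<^sub>M UNIV (\<lambda>_. step)"

abbreviation Pr :: "((nat \<Rightarrow> 'a) \<Rightarrow> bool) \<Rightarrow> real" where
  "Pr Q \<equiv> measure \<Omega> {w \<in> space \<Omega>. Q w}"

lemma space_step: "space step = A" by (simp add: space_restrict_space)

lemma sets_step: "sets step = Pow A"
  by (auto simp: sets_restrict_space)

lemma AE_in_A: "AE x in measure_pmf \<mu>. x \<in> A"
  using support by (auto simp: AE_measure_pmf_iff)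

lemma prob_space_step: "prob_space step"
  by (intro prob_space_restrict_space measure_pmf.emeasure_eq_1_AE AE_in_A) auto

sublocale seq: sequence_space step
proof -
  interpret prob_space step by (rule prob_space_step)
  show "sequence_space step" by unfold_locales
qed

sublocale \<Omega>: prob_space \<Omega>
  unfolding \<Omega>_def by (rule seq.P.prob_space_axioms)

lemma integral_step: "integral\<^sup>L step (f :: 'a \<Rightarrow> real) = measure_pmf.expectation \<mu> f"
proof -
  have "integral\<^sup>L step f = measure_pmf.expectation \<mu> (\<lambda>x. indicator A x *\<^sub>R f x)"
    by (rule integral_restrict_space) simp
  also have "\<dots> = measure_pmf.expectation \<mu> f"
    by (rule integral_cong_AE) (use AE_in_A in \<open>auto elim!: eventually_mono\<close>)
  finally show ?thesis .
qed

text \<open>With the last coordinate fixed to i, the function \<open>F (w(n := i))\<close> depends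
  on one coordinate less. F is glued from these functions over the countably many values i in
  A.\<close>

lemma measurable_depends_below:
  assumes "depends_below n F"
  shows "F \<in> measurable \<Omega> (count_space UNIV)"
  using assms
proof (induction n arbitrary: F)
  case 0
  then have "F = (\<lambda>_. F undefined)"
    unfolding depends_below_def by blast
  then show ?case by (metis measurable_const UNIV_I space_count_space)
next
  case (Suc n)
  have "(\<lambda>w. (\<lambda>i w. F (w(n := i))) (w n) w) \<in> measurable \<Omega> (count_space UNIV)"
  proof (rule measurable_compose_countable'[where f = "\<lambda>i w. F (w(n := i))" and g = "\<lambda>w. w n" and I = A])
    show "countable A" by (rule countable_A)
    have "(\<lambda>w. w n) \<in> measurable \<Omega> step"
      unfolding \<Omega>_def by (rule measurable_component_singleton) simp
    then show "(\<lambda>w. w n) \<in> measurable \<Omega> (count_space A)"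
      by (simp add: measurable_def sets_step space_step)
    fix i
    show "(\<lambda>w. F (w(n := i))) \<in> measurable \<Omega> (count_space UNIV)"
      by (rule Suc.IH, rule depends_belowI, rule depends_belowD[OF Suc.prems]) (auto simp: less_Suc_eq)
  qed
  then show ?case by simp
qed

lemma borel_measurable_depends_below:
  "depends_below n F \<Longrightarrow> F \<in> borel_measurable \<Omega>"
  using measurable_compose[OF measurable_depends_below, of n F "\<lambda>x. x"] by simp

lemma pred_depends_below: "depends_below n Q \<Longrightarrow> Measurable.pred \<Omega> Q"
  by (rule measurable_depends_below)

lemma sets_depends_below: "depends_below n Q \<Longrightarrow> {w \<in> space \<Omega>. Q w} \<in> sets \<Omega>"
  using pred_depends_below by (simp add: pred_def)

lemma AE_support: "AE w in \<Omega>. \<forall>k. w k \<in> set_pmf \<mu>"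
proof -
  have "AE w in \<Omega>. w k \<in> set_pmf \<mu>" for k
    unfolding \<Omega>_def
  proof (rule AE_PiM_component)
    show "AE x in step. x \<in> set_pmf \<mu>"
      by (simp add: AE_restrict_space_iff AE_measure_pmf_iff)
  qed (auto intro: prob_space_step)
  then show ?thesis by (simp add: AE_all_countable)
qed

text \<open>Only finitely many initial segments of length n have all their entries in the
  support.\<close>

lemma bounded_depends_below:
  fixes F :: "(nat \<Rightarrow> 'a) \<Rightarrow> real"
  assumes "depends_below n F"
  obtains B where "\<And>w. (\<forall>k. w k \<in> set_pmf \<mu>) \<Longrightarrow> \<bar>F w\<bar> \<le> B"
proof -
  let ?W = "{..<n} \<rightarrow>\<^sub>E set_pmf \<mu>"
  have "finite ?W" using finite_support by (intro finite_PiE) auto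
  then have "finite ((\<lambda>w. \<bar>F w\<bar>) ` ?W)" by simp
  then have "\<bar>F w\<bar> \<le> Max ((\<lambda>w. \<bar>F w\<bar>) ` ?W)" if "\<forall>k. w k \<in> set_pmf \<mu>" for w
  proof -
    have "F w = F (restrict w {..<n})" by (rule depends_belowD[OF assms]) auto
    moreover have "restrict w {..<n} \<in> ?W" using that by auto
    ultimately show ?thesis using \<open>finite ?W\<close> by (auto intro!: Max_ge)
  qed
  then show thesis by (rule that)
qed

lemma integrable_depends_below:
  fixes F :: "(nat \<Rightarrow> 'a) \<Rightarrow> real"
  assumes "depends_below n F"
  shows "integrable \<Omega> F"
proof -
  obtain B where "\<And>w. (\<forall>k. w k \<in> set_pmf \<mu>) \<Longrightarrow> \<bar>F w\<bar> \<le> B"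
    using bounded_depends_below[OF assms] by blast
  then have "AE w in \<Omega>. norm (F w) \<le> B"
    using AE_support by (auto elim!: eventually_mono)
  then show ?thesis
    by (rule \<Omega>.integrable_const_bound) (rule borel_measurable_depends_below[OF assms])
qed

lemma integrable_\<mu>: "integrable (measure_pmf \<mu>) (f :: 'a \<Rightarrow> real)"
  by (rule integrable_measure_pmf_finite[OF finite_support])

text \<open>Conditioning on the first step: \<open>case_nat x w\<close> puts x in front of the
  independent path w. The maximal inequality and the moment formulas are proved by induction with
  it.\<close>

lemma expectation_split:
  fixes F :: "(nat \<Rightarrow> 'a) \<Rightarrow> real"
  assumes "depends_below n F"
  shows "integral\<^sup>L \<Omega> F = (\<integral>x. (\<integral>w. F (case_nat x w) \<partial>\<Omega>) \<partial>measure_pmf \<mu>)"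
proof -
  interpret pair_sigma_finite step \<Omega>
    unfolding \<Omega>_def by unfold_locales
  have m: "(\<lambda>(s, w). case_nat s w) \<in> measurable (step \<Otimes>\<^sub>M \<Omega>) \<Omega>"
    unfolding \<Omega>_def by measurable
  have D: "distr (step \<Otimes>\<^sub>M \<Omega>) \<Omega> (\<lambda>(s, w). case_nat s w) = \<Omega>"
    unfolding \<Omega>_def by (rule seq.PiM_iter)
  have F: "F \<in> borel_measurable \<Omega>" by (rule borel_measurable_depends_below[OF assms])
  have "integral\<^sup>L \<Omega> F = integral\<^sup>L (distr (step \<Otimes>\<^sub>M \<Omega>) \<Omega> (\<lambda>(s, w). case_nat s w)) F"
    by (simp only: D)
  also have "\<dots> = integral\<^sup>L (step \<Otimes>\<^sub>M \<Omega>) (\<lambda>z. F ((\<lambda>(s, w). case_nat s w) z))"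
    by (rule integral_distr[OF m F])
  also have "\<dots> = (\<integral>x. (\<integral>w. F (case_nat x w) \<partial>\<Omega>) \<partial>step)"
  proof -
    have "integrable (distr (step \<Otimes>\<^sub>M \<Omega>) \<Omega> (\<lambda>(s, w). case_nat s w)) F"
      unfolding D by (rule integrable_depends_below[OF assms])
    then have "integrable (step \<Otimes>\<^sub>M \<Omega>) (\<lambda>z. F ((\<lambda>(s, w). case_nat s w) z))"
      by (rule integrable_distr[OF m])
    from integral_fst'[OF this] show ?thesis by simp
  qed
  also have "\<dots> = (\<integral>x. (\<integral>w. F (case_nat x w) \<partial>\<Omega>) \<partial>measure_pmf \<mu>)"
    by (rule integral_step)
  finally show ?thesis .
qed

lemma Pr_eq_expectation:
  assumes "depends_below n Q"
  shows "Pr Q = (\<integral>w. of_bool (Q w) \<partial>\<Omega>)"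
proof -
  have "(\<integral>w. of_bool (Q w) \<partial>\<Omega>) = (\<integral>w. indicator {w \<in> space \<Omega>. Q w} w \<partial>\<Omega>)"
    by (rule Bochner_Integration.integral_cong) (auto simp: indicator_def)
  also have "\<dots> = Pr Q"
    using sets_depends_below[OF assms] by (simp add: Int_absorb1 subset_iff)
  finally show ?thesis by simp
qed

lemma Pr_split:
  assumes "depends_below (Suc n) Q"
  shows "Pr Q = (\<integral>x. Pr (\<lambda>w. Q (case_nat x w)) \<partial>measure_pmf \<mu>)"
  unfolding Pr_eq_expectation[OF assms] Pr_eq_expectation[OF depends_below_case_nat[OF assms]]
  by (rule expectation_split[OF depends_below_comp[OF assms]])

lemma Pr_mono:
  assumes "Measurable.pred \<Omega> R" "\<And>w. Q w \<Longrightarrow> R w"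
  shows "Pr Q \<le> Pr R"
  by (rule \<Omega>.finite_measure_mono) (use assms in \<open>auto simp: pred_def\<close>)

lemma Pr_mono_AE:
  assumes "Measurable.pred \<Omega> R" "AE w in \<Omega>. Q w \<longrightarrow> R w"
  shows "Pr Q \<le> Pr R"
  by (rule \<Omega>.finite_measure_mono_AE) (use assms in \<open>auto simp: pred_def elim!: eventually_mono\<close>)

text \<open>Independence of the first n steps and the path after time n: cutting paths at n
  identifies \<Omega> with the product of two copies of itself.\<close>

lemma Pr_shift:
  assumes Q: "depends_below n Q" and R: "Measurable.pred \<Omega> R"
  shows "Pr (\<lambda>w. Q w \<and> R (\<lambda>k. w (k + n))) = Pr Q * Pr R"
proof -
  interpret pair_sigma_finite \<Omega> \<Omega>
    unfolding \<Omega>_def by unfold_locales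
  let ?f = "\<lambda>(w, w'). comb_seq n w w'"
  have m: "?f \<in> measurable (\<Omega> \<Otimes>\<^sub>M \<Omega>) \<Omega>"
    unfolding \<Omega>_def by measurable
  have D: "distr (\<Omega> \<Otimes>\<^sub>M \<Omega>) \<Omega> ?f = \<Omega>"
    unfolding \<Omega>_def by (rule seq.PiM_comb_seq)
  have sQ: "{w \<in> space \<Omega>. Q w} \<in> sets \<Omega>" by (rule sets_depends_below[OF Q])
  have sR: "{w \<in> space \<Omega>. R w} \<in> sets \<Omega>" using R by (simp add: pred_def)
  have shift: "(\<lambda>w k. w (k + n)) \<in> measurable \<Omega> \<Omega>"
    unfolding \<Omega>_def
    by (rule measurable_PiM_single') (auto simp: space_PiM PiE_iff intro!: measurable_component_singleton)
  have "Measurable.pred \<Omega> (\<lambda>w. R (\<lambda>k. w (k + n)))"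
    by (rule measurable_compose[OF shift R])
  then have sE: "{w \<in> space \<Omega>. Q w \<and> R (\<lambda>k. w (k + n))} \<in> sets \<Omega>"
    using pred_depends_below[OF Q] by measurable
  have Q': "Q (comb_seq n w w') = Q w" for w w'
    by (rule depends_belowD[OF Q]) (simp add: comb_seq_less)
  have "?f -` {w \<in> space \<Omega>. Q w \<and> R (\<lambda>k. w (k + n))} \<inter> space (\<Omega> \<Otimes>\<^sub>M \<Omega>)
      = {w \<in> space \<Omega>. Q w} \<times> {w \<in> space \<Omega>. R w}"
    using measurable_space[OF m] by (auto simp: space_pair_measure Q' comb_seq_add)
  then have "emeasure \<Omega> {w \<in> space \<Omega>. Q w \<and> R (\<lambda>k. w (k + n))}
      = emeasure (\<Omega> \<Otimes>\<^sub>M \<Omega>) ({w \<in> space \<Omega>. Q w} \<times> {w \<in> space \<Omega>. R w})"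
    using emeasure_distr[OF m sE] by (simp add: D)
  also have "\<dots> = emeasure \<Omega> {w \<in> space \<Omega>. Q w} * emeasure \<Omega> {w \<in> space \<Omega>. R w}"
    by (rule \<Omega>.emeasure_pair_measure_Times[OF sQ sR])
  finally show ?thesis
    by (simp add: measure_def enn2real_mult)
qed

end

section \<open>Additive functionals of an integer valued walk\<close>

text \<open>The starting height s is a parameter because an induction by the first step restarts the
  walk at a new height.\<close>

definition height :: "('a \<Rightarrow> int) \<Rightarrow> int \<Rightarrow> nat \<Rightarrow> (nat \<Rightarrow> 'a) \<Rightarrow> int" where
  "height h s n w = s + (\<Sum>k<n. h (w k))"

text \<open>The increment may depend on the height before the step. If every \<open>g s\<close> has
  mean zero, the partial sums form a martingale.\<close>

definition functional :: "('a \<Rightarrow> int) \<Rightarrow> (int \<Rightarrow> 'a \<Rightarrow> real) \<Rightarrow> int \<Rightarrow> nat \<Rightarrow> (nat \<Rightarrow> 'a) \<Rightarrow> real" where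
  "functional h g s n w = (\<Sum>k<n. g (height h s k w) (w k))"

lemma height_0 [simp]: "height h s 0 w = s" by (simp add: height_def)

lemma functional_0 [simp]: "functional h g s 0 w = 0" by (simp add: functional_def)

lemma height_case_nat: "height h s (Suc k) (case_nat x w) = height h (s + h x) k w"
  unfolding height_def by (subst sum.lessThan_Suc_shift) simp

lemma functional_case_nat:
  "functional h g s (Suc k) (case_nat x w) = g s x + functional h g (s + h x) k w"
  unfolding functional_def by (subst sum.lessThan_Suc_shift) (simp add: height_case_nat)

lemma height_add: "height h s (k + n) w = height h s k w + (\<Sum>j<n. h (w (j + k)))"
  by (induction n) (auto simp: height_def add.commute)

lemma depends_below_height: "k \<le> n \<Longrightarrow> depends_below n (height h s k)"
  by (auto simp: depends_below_def height_def intro!: sum.cong)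

lemma depends_below_functional: "k \<le> n \<Longrightarrow> depends_below n (functional h g s k)"
proof (rule depends_belowI)
  fix w w' :: "nat \<Rightarrow> 'a"
  assume k: "k \<le> n" and eq: "\<And>k. k < n \<Longrightarrow> w k = w' k"
  have "height h s j w = height h s j w'" if "j \<le> n" for j
    by (rule depends_belowD[OF depends_below_height[OF that] eq])
  then show "functional h g s k w = functional h g s k w'"
    using k eq unfolding functional_def by (intro sum.cong) auto
qed

lemma depends_below_Ex_functional:
  "n \<le> N \<Longrightarrow> depends_below N (\<lambda>w. \<exists>k\<le>n. a \<le> functional h g s k w)"
  using depends_below_functional[of _ N h g s] unfolding depends_below_def
  by (metis (no_types, lifting) order_trans)

context countable_iid
begin

text \<open>Hoeffding's lemma on the interval [-1, 1], where (1 - (-1))^2 / 8 = 1/2.\<close>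

lemma expectation_exp_le:
  fixes f :: "'a \<Rightarrow> real"
  assumes bound: "\<And>x. x \<in> set_pmf \<mu> \<Longrightarrow> \<bar>f x\<bar> \<le> 1"
    and mean: "measure_pmf.expectation \<mu> f = 0" and l: "0 \<le> l"
  shows "measure_pmf.expectation \<mu> (\<lambda>x. exp (l * f x)) \<le> exp (l\<^sup>2 / 2)"
proof (cases "l = 0")
  case False
  interpret interval_bounded_random_variable "measure_pmf \<mu>" f "- 1" 1
    by unfold_locales (use bound in \<open>auto simp: AE_measure_pmf_iff abs_le_iff minus_le_iff\<close>)
  have "ennreal (measure_pmf.expectation \<mu> (\<lambda>x. exp (l * f x))) = nn_integral (measure_pmf \<mu>) (\<lambda>x. exp (l * f x))"
    by (rule nn_integral_eq_integral[symmetric]) (auto intro: integrable_\<mu>)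
  also have "\<dots> \<le> ennreal (exp (l\<^sup>2 * (1 - - 1)\<^sup>2 / 8))"
    using False l mean by (intro Hoeffdings_lemma_nn_integral_0) auto
  finally show ?thesis by simp
qed simp

text \<open>An induction by the first step takes the place of Doob's inequality. For a > 0 the level
  is not reached at time 0, so the first step x moves the threshold to a - g s x; this contributes a
  factor exp (l g s x), whose mean is at most exp (l^2/2). For a \<le> 0 the bound is at least
  1.\<close>

lemma maximal_inequality:
  assumes bound: "\<And>s x. x \<in> set_pmf \<mu> \<Longrightarrow> \<bar>g s x\<bar> \<le> 1"
    and mean: "\<And>s. measure_pmf.expectation \<mu> (g s) = 0" and l: "0 \<le> l"
  shows "Pr (\<lambda>w. \<exists>k\<le>n. a \<le> functional h g s k w) \<le> exp (real n * l\<^sup>2 / 2 - l * a)"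
proof (induction n arbitrary: a s)
  case 0
  show ?case
  proof (cases "a \<le> 0")
    case True
    then have "1 \<le> exp (real 0 * l\<^sup>2 / 2 - l * a)"
      using l mult_nonneg_nonpos[of l a] by simp
    then show ?thesis using \<Omega>.prob_le_1 order_trans by blast
  next
    case False
    then have "{w \<in> space \<Omega>. \<exists>k\<le>0. a \<le> functional h g s k w} = {}" by auto
    then show ?thesis by (simp only: measure_empty exp_ge_zero)
  qed
next
  case (Suc n)
  show ?case
  proof (cases "a \<le> 0")
    case True
    then have "0 \<le> real (Suc n) * l\<^sup>2 / 2 - l * a"
      using l mult_nonneg_nonpos[of l a] by (smt (verit) mult_nonneg_nonneg of_nat_0_le_iff zero_le_divide_iff zero_le_power2)
    then have "1 \<le> exp (real (Suc n) * l\<^sup>2 / 2 - l * a)" by simp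
    then show ?thesis using \<Omega>.prob_le_1 order_trans by blast
  next
    case False
    have eq: "(\<exists>k\<le>Suc n. a \<le> functional h g s k (case_nat x w))
        \<longleftrightarrow> (\<exists>k\<le>n. a - g s x \<le> functional h g (s + h x) k w)" for x w
    proof -
      have "(\<exists>k\<le>Suc n. a \<le> functional h g s k (case_nat x w))
        \<longleftrightarrow> (\<exists>k\<le>n. a \<le> functional h g s (Suc k) (case_nat x w))"
        using False by (metis Suc_le_mono functional_0 not0_implies_Suc)
      then show ?thesis by (auto simp: functional_case_nat algebra_simps)
    qed
    have "Pr (\<lambda>w. \<exists>k\<le>Suc n. a \<le> functional h g s k w)
        = (\<integral>x. Pr (\<lambda>w. \<exists>k\<le>n. a - g s x \<le> functional h g (s + h x) k w) \<partial>measure_pmf \<mu>)"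
      by (subst Pr_split[OF depends_below_Ex_functional[OF order_refl]]) (simp only: eq)
    also have "\<dots> \<le> (\<integral>x. exp (real n * l\<^sup>2 / 2 - l * a) * exp (l * g s x) \<partial>measure_pmf \<mu>)"
    proof (intro integral_mono integrable_\<mu>)
      fix x
      show "Pr (\<lambda>w. \<exists>k\<le>n. a - g s x \<le> functional h g (s + h x) k w)
          \<le> exp (real n * l\<^sup>2 / 2 - l * a) * exp (l * g s x)"
      proof -
        have "exp (real n * l\<^sup>2 / 2 - l * a) * exp (l * g s x) = exp (real n * l\<^sup>2 / 2 - l * (a - g s x))"
          by (simp add: exp_add[symmetric] algebra_simps)
        then show ?thesis using Suc.IH[of "a - g s x" "s + h x"] by (simp only:)
      qed
    qed
    also have "\<dots> \<le> exp (real n * l\<^sup>2 / 2 - l * a) * exp (l\<^sup>2 / 2)"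
      using expectation_exp_le[OF bound mean l] by simp
    also have "\<dots> = exp (real (Suc n) * l\<^sup>2 / 2 - l * a)"
      by (simp add: exp_add[symmetric] algebra_simps add_divide_distrib)
    finally show ?thesis .
  qed
qed

lemma maximal_inequality_abs:
  assumes bound: "\<And>s x. x \<in> set_pmf \<mu> \<Longrightarrow> \<bar>g s x\<bar> \<le> 1"
    and mean: "\<And>s. measure_pmf.expectation \<mu> (g s) = 0" and l: "0 \<le> l"
  shows "Pr (\<lambda>w. \<exists>k\<le>n. a \<le> \<bar>functional h g s k w\<bar>) \<le> 2 * exp (real n * l\<^sup>2 / 2 - l * a)"
proof -
  let ?P = "\<lambda>w. \<exists>k\<le>n. a \<le> functional h g s k w"
  let ?N = "\<lambda>w. \<exists>k\<le>n. a \<le> functional h (\<lambda>s x. - g s x) s k w"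
  have neg: "functional h (\<lambda>s x. - g s x) s k w = - functional h g s k w" for k w
    by (simp add: functional_def sum_negf)
  have abs: "a \<le> \<bar>x\<bar> \<longleftrightarrow> a \<le> x \<or> a \<le> - x" for x :: real
    by linarith
  have "{w \<in> space \<Omega>. \<exists>k\<le>n. a \<le> \<bar>functional h g s k w\<bar>}
      = {w \<in> space \<Omega>. ?P w} \<union> {w \<in> space \<Omega>. ?N w}"
    unfolding neg abs by blast
  then have "Pr (\<lambda>w. \<exists>k\<le>n. a \<le> \<bar>functional h g s k w\<bar>) \<le> Pr ?P + Pr ?N"
    by (simp add: measure_Un_le sets_depends_below[OF depends_below_Ex_functional[OF order_refl]])
  also have "\<dots> \<le> exp (real n * l\<^sup>2 / 2 - l * a) + exp (real n * l\<^sup>2 / 2 - l * a)"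
    using bound mean by (intro add_mono maximal_inequality l) auto
  finally show ?thesis by simp
qed

end

section \<open>Moments and lower tail bounds of the height\<close>

locale lazy_walk = countable_iid \<mu> A for \<mu> :: "'a pmf" and A +
  fixes h :: "'a \<Rightarrow> int" and p :: real
  assumes p_pos: "0 < p" and p_le_1: "p \<le> 1"
    and height_law: "\<And>F :: int \<Rightarrow> real.
      measure_pmf.expectation \<mu> (\<lambda>x. F (h x)) = p / 2 * F 1 + p / 2 * F (- 1) + (1 - p) * F 0"
begin

lemma expectation_height_Suc:
  fixes F :: "int \<Rightarrow> real"
  shows "(\<integral>w. F (height h s (Suc n) w) \<partial>\<Omega>)
    = p / 2 * (\<integral>w. F (height h (s + 1) n w) \<partial>\<Omega>)
      + p / 2 * (\<integral>w. F (height h (s - 1) n w) \<partial>\<Omega>) + (1 - p) * (\<integral>w. F (height h s n w) \<partial>\<Omega>)"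
proof -
  have "(\<integral>w. F (height h s (Suc n) w) \<partial>\<Omega>)
      = (\<integral>x. (\<integral>w. F (height h (s + h x) n w) \<partial>\<Omega>) \<partial>measure_pmf \<mu>)"
    by (subst expectation_split[OF depends_below_comp[OF depends_below_height[OF order_refl]]])
      (simp only: height_case_nat)
  also have "\<dots> = p / 2 * (\<integral>w. F (height h (s + 1) n w) \<partial>\<Omega>)
      + p / 2 * (\<integral>w. F (height h (s + - 1) n w) \<partial>\<Omega>) + (1 - p) * (\<integral>w. F (height h (s + 0) n w) \<partial>\<Omega>)"
    by (rule height_law[of "\<lambda>i. \<integral>w. F (height h (s + i) n w) \<partial>\<Omega>"])
  finally show ?thesis by simp
qed

lemma expectation_height: "(\<integral>w. real_of_int (height h s n w) \<partial>\<Omega>) = of_int s"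
proof (induction n arbitrary: s)
  case (Suc n)
  then show ?case
    by (simp add: expectation_height_Suc[where F = real_of_int] field_simps)
qed (simp add: \<Omega>.prob_space)

lemma expectation_height_power2: "(\<integral>w. (real_of_int (height h s n w))\<^sup>2 \<partial>\<Omega>) = (of_int s)\<^sup>2 + p * n"
proof (induction n arbitrary: s)
  case (Suc n)
  have "(\<integral>w. (real_of_int (height h s (Suc n) w))\<^sup>2 \<partial>\<Omega>)
      = p / 2 * ((of_int (s + 1))\<^sup>2 + p * n) + p / 2 * ((of_int (s - 1))\<^sup>2 + p * n)
        + (1 - p) * ((of_int s)\<^sup>2 + p * n)"
    by (simp only: expectation_height_Suc[where F = "\<lambda>i. (real_of_int i)\<^sup>2"] Suc.IH)
  then show ?case by (simp add: field_simps power2_eq_square)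
qed (simp add: \<Omega>.prob_space)

lemma expectation_height_power4:
  "(\<integral>w. (real_of_int (height h s n w)) ^ 4 \<partial>\<Omega>)
    = (of_int s) ^ 4 + 6 * (of_int s)\<^sup>2 * p * n + 3 * p\<^sup>2 * n * (real n - 1) + p * n"
proof (induction n arbitrary: s)
  case (Suc n)
  let ?f = "\<lambda>s. (real_of_int s) ^ 4 + 6 * (of_int s)\<^sup>2 * p * n + 3 * p\<^sup>2 * n * (real n - 1) + p * n"
  have "(\<integral>w. (real_of_int (height h s (Suc n) w)) ^ 4 \<partial>\<Omega>)
      = p / 2 * ?f (s + 1) + p / 2 * ?f (s - 1) + (1 - p) * ?f s"
    by (simp only: expectation_height_Suc[where F = "\<lambda>i. (real_of_int i) ^ 4"] Suc.IH)
  then show ?case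
    by (simp add: field_simps power2_eq_square power4_eq_xxxx)
qed (simp add: \<Omega>.prob_space)

text \<open>A quartic minorant of an indicator function: its expectation is known from the moments and
  bounds the probability from below.\<close>

lemma quartic_test_function:
  fixes y :: real
  shows "3 * y + y\<^sup>2 - y ^ 4 / 8 - p / 4 \<le> 11 * of_bool (p / 16 \<le> y)"
proof (cases "p / 16 \<le> y")
  case True
  \<comment> \<open>Added up, these squares give 3y + y^2 - y^4/8 \<le> 41/4, which is below the
    factor 11.\<close>
  have "0 \<le> (y - 3 / 2)\<^sup>2" "0 \<le> (y\<^sup>2 - 8)\<^sup>2 / 8" by simp_all
  then have "3 * y \<le> y\<^sup>2 + 9 / 4" "2 * y\<^sup>2 \<le> y ^ 4 / 8 + 8"
    by (simp_all add: power2_eq_square power4_eq_xxxx algebra_simps)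
  then show ?thesis using True p_pos by simp
next
  case False
  have y4: "0 \<le> y ^ 4 / 8" by simp
  \<comment> \<open>Each range has its own reason: y^2 \<le> y for 0 \<le> y < p/16, then y (3 + y)
    \<le> 0, and y^2 \<le> y^4/8 far out on the negative side.\<close>
  consider "0 \<le> y" | "y < 0" "- 3 \<le> y" | "y < - 3" by linarith
  then have "3 * y + y\<^sup>2 - y ^ 4 / 8 - p / 4 \<le> 0"
  proof cases
    case 1
    have "y\<^sup>2 \<le> y * 1"
      unfolding power2_eq_square by (rule mult_left_mono) (use False 1 p_le_1 in auto)
    then show ?thesis using False y4 by linarith
  next
    case 2
    then have "y * (3 + y) \<le> 0" by (intro mult_nonpos_nonneg) auto
    then have "3 * y + y\<^sup>2 \<le> 0" by (simp add: power2_eq_square algebra_simps)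
    then show ?thesis using y4 p_pos by linarith
  next
    case 3
    then have "9 \<le> y\<^sup>2"
      using power_mono[of 3 "- y" 2] by simp
    then have "8 * y\<^sup>2 \<le> y\<^sup>2 * y\<^sup>2" by (intro mult_right_mono) auto
    then have "y\<^sup>2 \<le> y ^ 4 / 8" by (simp add: power2_eq_square power4_eq_xxxx)
    then show ?thesis using 3 p_pos by linarith
  qed
  then show ?thesis using False by simp
qed

lemma integrable_height: "integrable \<Omega> (\<lambda>w. F (height h s n w) :: real)"
  by (rule integrable_depends_below[OF depends_below_comp[OF depends_below_height[OF order_refl]]])

text \<open>For y, the height divided by sqrt n, the first, second and fourth moments are 0, p and
  at most 4p, so the test function has mean at least p - p/2 - p/4 = p/4; dividing by 11 gives p/44.
  The event is one-sided so that the rises of successive runs can be added.\<close>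

lemma Pr_height_ge:
  assumes "1 \<le> n"
  shows "p / 44 \<le> Pr (\<lambda>w. p / 16 * sqrt n \<le> height h 0 n w)"
proof -
  let ?y = "\<lambda>w. height h 0 n w / sqrt n"
  let ?Q = "\<lambda>w. p / 16 * sqrt n \<le> height h 0 n w"
  have n: "0 < sqrt n" using assms by simp
  have s4: "sqrt n ^ 4 = (real n)\<^sup>2"
    by (metis mult_2 numeral_Bit0 of_nat_0_le_iff power2_eq_square power_add real_sqrt_pow2)
  have 1: "(\<integral>w. ?y w \<partial>\<Omega>) = 0"
    using expectation_height[of 0 n] by simp
  have 2: "(\<integral>w. (?y w)\<^sup>2 \<partial>\<Omega>) = p"
    using expectation_height_power2[of 0 n] assms by (simp add: power_divide)
  have "(\<integral>w. (?y w) ^ 4 \<partial>\<Omega>) = (3 * p\<^sup>2 * n * (real n - 1) + p * n) / (real n)\<^sup>2"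
    using expectation_height_power4[of 0 n] assms by (simp add: power_divide s4)
  also have "\<dots> \<le> (4 * p * (real n)\<^sup>2) / (real n)\<^sup>2"
  proof (rule divide_right_mono)
    have "p\<^sup>2 \<le> p" using p_pos p_le_1 by (simp add: power2_eq_square mult_left_le)
    then have "3 * p\<^sup>2 * n * (real n - 1) \<le> 3 * p * n * real n"
      using assms p_pos by (intro mult_mono) auto
    moreover have "p * n * 1 \<le> p * n * real n"
      using assms p_pos by (intro mult_left_mono) auto
    ultimately show "3 * p\<^sup>2 * n * (real n - 1) + p * n \<le> 4 * p * (real n)\<^sup>2"
      by (simp add: power2_eq_square)
  qed simp
  finally have 4: "(\<integral>w. (?y w) ^ 4 \<partial>\<Omega>) \<le> 4 * p" using assms by simp
  have int: "integrable \<Omega> (\<lambda>w. F (?y w))" for F :: "real \<Rightarrow> real"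
    by (rule integrable_height[of "\<lambda>i. F (i / sqrt n)"])
  have "p / 4 \<le> p - 4 * p / 8 - p / 4" using p_pos by simp
  also have "\<dots> \<le> 3 * 0 + p - (\<integral>w. (?y w) ^ 4 \<partial>\<Omega>) / 8 - p / 4" using 4 by simp
  also have "\<dots> = (\<integral>w. 3 * ?y w + (?y w)\<^sup>2 - (?y w) ^ 4 / 8 - p / 4 \<partial>\<Omega>)"
  proof -
    have "(\<integral>w. 3 * f1 w + f2 w - f4 w / 8 - c \<partial>\<Omega>) = 3 * (\<integral>w. f1 w \<partial>\<Omega>) + (\<integral>w. f2 w \<partial>\<Omega>) - (\<integral>w. f4 w \<partial>\<Omega>) / 8 - c"
      if "integrable \<Omega> f1" "integrable \<Omega> f2" "integrable \<Omega> f4" for f1 f2 f4 :: "(nat \<Rightarrow> 'a) \<Rightarrow> real" and c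
      using that by (simp add: \<Omega>.prob_space)
    from this[OF int[of "\<lambda>y. y"] int[of "\<lambda>y. y\<^sup>2"] int[of "\<lambda>y. y ^ 4"], of "p / 4"]
    show ?thesis by (simp only: 1 2)
  qed
  also have "\<dots> \<le> (\<integral>w. 11 * of_bool (p / 16 \<le> ?y w) \<partial>\<Omega>)"
    by (rule integral_mono[OF int[of "\<lambda>y. 3 * y + y\<^sup>2 - y ^ 4 / 8 - p / 4"]
        int[of "\<lambda>y. 11 * of_bool (p / 16 \<le> y)"]]) (rule quartic_test_function)
  also have "\<dots> = 11 * (\<integral>w. of_bool (?Q w) \<partial>\<Omega>)"
    using n by (simp add: pos_le_divide_eq)
  also have "\<dots> = 11 * Pr ?Q"
    by (subst Pr_eq_expectation[OF depends_below_comp[OF depends_below_height[OF order_refl]]]) simp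
  finally show ?thesis by simp
qed

text \<open>If k successive runs of length n, which are independent, each rise by at least b, the
  total rise is at least k b.\<close>

lemma Pr_height_blocks:
  fixes b :: real
  assumes "0 \<le> b"
  shows "Pr (\<lambda>w. b \<le> height h 0 n w) ^ k \<le> Pr (\<lambda>w. real k * b \<le> height h 0 (k * n) w)"
proof (induction k)
  case 0
  then show ?case by (simp add: \<Omega>.prob_space)
next
  case (Suc k)
  let ?Q = "\<lambda>w. b \<le> height h 0 n w" and ?R = "\<lambda>w. real k * b \<le> height h 0 (k * n) w"
  have Q: "depends_below n ?Q" and R: "depends_below (k * n) ?R"
    by (rule depends_below_comp[OF depends_below_height[OF order_refl]])+
  have "Pr ?Q ^ Suc k \<le> Pr ?Q * Pr ?R"
    using Suc.IH by (simp add: mult_left_mono)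
  also have "\<dots> = Pr (\<lambda>w. ?Q w \<and> ?R (\<lambda>k. w (k + n)))"
    by (rule Pr_shift[OF Q pred_depends_below[OF R], symmetric])
  also have "\<dots> \<le> Pr (\<lambda>w. real (Suc k) * b \<le> height h 0 (Suc k * n) w)"
  proof (rule Pr_mono)
    show "Measurable.pred \<Omega> (\<lambda>w. real (Suc k) * b \<le> height h 0 (Suc k * n) w)"
      by (rule pred_depends_below[OF depends_below_comp[OF depends_below_height[OF order_refl]]])
    fix w :: "nat \<Rightarrow> 'a"
    assume "?Q w \<and> ?R (\<lambda>k. w (k + n))"
    moreover have "height h 0 (Suc k * n) w = height h 0 n w + height h 0 (k * n) (\<lambda>k. w (k + n))"
      using height_add[of h 0 n "k * n" w] by (simp add: height_def)
    ultimately show "real (Suc k) * b \<le> height h 0 (Suc k * n) w"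
      by (simp add: algebra_simps)
  qed
  finally show ?case .
qed

end

section \<open>A Borel-Cantelli lemma for consecutive blocks of steps\<close>

context countable_iid
begin

lemma Pr_compl: "Measurable.pred \<Omega> R \<Longrightarrow> Pr (\<lambda>w. \<not> R w) = 1 - Pr R"
  using \<Omega>.prob_compl[of "{w \<in> space \<Omega>. R w}"] by (simp add: pred_def set_diff_eq conj_commute cong: conj_cong)

text \<open>The events concern disjoint blocks, so m consecutive ones all fail with probability at
  most the product of the 1 - q j, hence at most exp of minus the sum of the q j. Divergence of the
  series sends this to 0.\<close>

lemma AE_infinitely_many_blocks:
  fixes T L :: "nat \<Rightarrow> nat" and q :: "nat \<Rightarrow> real"
  assumes T: "\<And>j. T (Suc j) = T j + L j"
    and R: "\<And>j. depends_below (L j) (R j)"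
    and q: "\<And>j. 0 \<le> q j" "\<And>j. q j \<le> Pr (R j)" and div: "\<not> summable q"
  shows "AE w in \<Omega>. \<exists>\<^sub>\<infinity>j. R j (\<lambda>i. w (i + T j))"
proof -
  let ?A = "\<lambda>j w. R j (\<lambda>i. w (i + T j))"
  have T_mono: "T i \<le> T j" if "i \<le> j" for i j
    using that by (rule lift_Suc_mono_le[of T, rotated]) (simp add: T)
  have A: "depends_below (T (Suc j)) (?A j)" for j
    by (rule depends_belowI, rule depends_belowD[OF R]) (simp add: T)
  have Q: "depends_below (T (J + m)) (\<lambda>w. \<forall>i<m. \<not> ?A (J + i) w)" for J m
  proof (rule depends_belowI)
    fix w w' :: "nat \<Rightarrow> 'a"
    assume "\<And>k. k < T (J + m) \<Longrightarrow> w k = w' k"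
    then have "?A (J + i) w = ?A (J + i) w'" if "i < m" for i
      using T_mono[of "Suc (J + i)" "J + m"] that by (intro depends_belowD[OF A]) auto
    then show "(\<forall>i<m. \<not> ?A (J + i) w) = (\<forall>i<m. \<not> ?A (J + i) w')" by blast
  qed
  have bound: "Pr (\<lambda>w. \<forall>i<m. \<not> ?A (J + i) w) \<le> exp (- (\<Sum>i<m. q (J + i)))" for J m
  proof (induction m)
    case 0
    then show ?case by (simp add: \<Omega>.prob_space)
  next
    case (Suc m)
    have R': "Measurable.pred \<Omega> (\<lambda>w. \<not> R (J + m) w)"
      by (rule pred_depends_below[OF depends_below_comp[OF R]])
    have "Pr (\<lambda>w. \<forall>i<Suc m. \<not> ?A (J + i) w)
        = Pr (\<lambda>w. (\<forall>i<m. \<not> ?A (J + i) w) \<and> \<not> ?A (J + m) w)"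
      by (simp only: less_Suc_eq) (metis)
    also have "\<dots> = Pr (\<lambda>w. \<forall>i<m. \<not> ?A (J + i) w) * Pr (\<lambda>w. \<not> R (J + m) w)"
      by (rule Pr_shift[OF Q R'])
    also have "\<dots> \<le> exp (- (\<Sum>i<m. q (J + i))) * exp (- q (J + m))"
    proof (rule mult_mono)
      have "Pr (\<lambda>w. \<not> R (J + m) w) \<le> 1 - q (J + m)"
        using q(2)[of "J + m"] by (simp add: Pr_compl[OF pred_depends_below[OF R]])
      also have "\<dots> \<le> exp (- q (J + m))"
        using exp_ge_add_one_self[of "- q (J + m)"] by simp
      finally show "Pr (\<lambda>w. \<not> R (J + m) w) \<le> exp (- q (J + m))" .
    qed (use Suc.IH in auto)
    also have "\<dots> = exp (- (\<Sum>i<Suc m. q (J + i)))"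
      by (simp add: exp_add[symmetric])
    finally show ?case .
  qed
  have "AE w in \<Omega>. \<exists>j\<ge>J. ?A j w" for J
  proof -
    let ?N = "\<lambda>w. \<forall>j\<ge>J. \<not> ?A j w"
    have "Pr ?N \<le> e" if "e > 0" for e
    proof -
      have "\<not> summable (\<lambda>i. q (i + J))" using div summable_iff_shift[of q J] by blast
      then have "\<not> (\<forall>m. (\<Sum>i<m. q (i + J)) \<le> - ln e)"
        using summableI_nonneg_bounded[of "\<lambda>i. q (i + J)" "- ln e"] q(1) by blast
      then obtain m where m: "- ln e < (\<Sum>i<m. q (i + J))" by (auto simp: not_le)
      have "Pr ?N \<le> Pr (\<lambda>w. \<forall>i<m. \<not> ?A (J + i) w)"
        by (rule Pr_mono[OF pred_depends_below[OF Q]]) simp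
      also have "\<dots> \<le> exp (- (\<Sum>i<m. q (J + i)))" by (rule bound)
      also have "\<dots> \<le> exp (ln e)" using m by (simp add: add.commute)
      finally show ?thesis using that by simp
    qed
    then have "Pr ?N \<le> 0" by (rule field_le_epsilon) (simp only: add_0)
    then have "Pr ?N = 0" by (intro order_antisym measure_nonneg)
    moreover have "{w \<in> space \<Omega>. ?N w} = (\<Inter>j\<in>{J..}. {w \<in> space \<Omega>. \<not> ?A j w})"
      by auto
    moreover have "{w \<in> space \<Omega>. \<not> ?A j w} \<in> sets \<Omega>" for j
      by (rule sets_depends_below[OF depends_below_comp[OF A]])
    ultimately have "{w \<in> space \<Omega>. ?N w} \<in> null_sets \<Omega>"
      by (simp add: null_sets_def \<Omega>.emeasure_eq_measure sets.countable_INT'')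
    then show ?thesis
      by (rule AE_I') auto
  qed
  then have "AE w in \<Omega>. \<forall>J. \<exists>j\<ge>J. ?A j w" by (simp add: AE_all_countable)
  then show ?thesis by (simp add: INFM_nat_le)
qed

end

context lazy_walk
begin

text \<open>Block \<open>j\<close> consists of \<open>k j\<close> runs of length \<open>4\<^sup>j\<close>, with \<open>k j\<close> of order \<open>ln j\<close>. With probability
  of order \<open>1 / j\<close> each of these runs raises the walk by a multiple of \<open>2\<^sup>j\<close>, so that the whole block
  raises it by a multiple of \<open>2\<^sup>j ln j\<close>.\<close>

lemma height_infinitely_often_large:
  obtains c where "0 < c"
    "AE w in \<Omega>. \<exists>\<^sub>\<infinity>n. c * sqrt (real n * ln (ln (real n))) \<le> \<bar>real_of_int (height h 0 n w)\<bar>"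
proof -
  define \<gamma> where "\<gamma> = p / 16"
  define \<delta> where "\<delta> = p / 44"
  \<comment> \<open>Chosen so that \<delta> to the power \<epsilon> ln (j + 2) is 1/(j + 2);
    rounding the exponent up to k j costs at most one more factor \<delta>.\<close>
  define \<epsilon> where "\<epsilon> = 1 / ln (1 / \<delta>)"
  define k where "k j = nat \<lceil>\<epsilon> * ln (real j + 2)\<rceil>" for j
  define T where "T j = (\<Sum>i<j. k i * 4 ^ i)" for j
  have \<gamma>: "0 < \<gamma>" using p_pos by (simp add: \<gamma>_def)
  have \<delta>: "0 < \<delta>" "\<delta> < 1" using p_pos p_le_1 by (simp_all add: \<delta>_def)
  have ln\<delta>: "0 < ln (1 / \<delta>)" using \<delta> by simp
  then have \<epsilon>: "0 < \<epsilon>" by (simp add: \<epsilon>_def)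
  have k_ge: "\<epsilon> * ln (real j + 2) \<le> real (k j)" for j
    unfolding k_def by linarith
  have k_le: "real (k j) \<le> \<epsilon> * ln (real j + 2) + 1" for j
  proof -
    have "0 \<le> \<epsilon> * ln (real j + 2)" using \<epsilon> by simp
    then show ?thesis unfolding k_def by linarith
  qed
  have k_pos: "1 \<le> k j" for j
  proof -
    have "0 < \<epsilon> * ln (real j + 2)" using \<epsilon> by (intro mult_pos_pos) auto
    then show ?thesis using k_ge[of j] by linarith
  qed
  have k_mono: "k j \<le> k (Suc j)" for j
    unfolding k_def using \<epsilon> by (intro nat_mono ceiling_mono mult_left_mono) auto
  have T_Suc: "T (Suc j) = T j + k j * 4 ^ j" for j by (simp add: T_def)
  \<comment> \<open>All earlier blocks together are no longer than block j, so times up to the end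
    of block j are at most twice its length.\<close>
  have T_le: "T j \<le> k j * 4 ^ j" for j
  proof (induction j)
    case (Suc j)
    have "T (Suc j) \<le> 4 * (k j * 4 ^ j)" using Suc by (simp add: T_Suc)
    also have "\<dots> \<le> k (Suc j) * 4 ^ Suc j" using k_mono[of j] by simp
    finally show ?case .
  qed (simp add: T_def)
  have T_ge: "j \<le> T j" for j
  proof (induction j)
    case (Suc j)
    have "1 \<le> k j * 4 ^ j" using k_pos[of j] by simp
    then show ?case using Suc unfolding T_Suc by linarith
  qed simp
  let ?R = "\<lambda>j w. real (k j) * (\<gamma> * 2 ^ j) \<le> height h 0 (k j * 4 ^ j) w"
  have AE_blocks: "AE w in \<Omega>. \<exists>\<^sub>\<infinity>j. ?R j (\<lambda>i. w (i + T j))"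
  proof (rule AE_infinitely_many_blocks[where q = "\<lambda>j. \<delta> / (real j + 2)"])
    show "T (Suc j) = T j + k j * 4 ^ j" for j by (rule T_Suc)
    show "depends_below (k j * 4 ^ j) (?R j)" for j
      by (rule depends_below_comp[OF depends_below_height[OF order_refl]])
    show "0 \<le> \<delta> / (real j + 2)" for j using \<delta> by simp
    show "\<delta> / (real j + 2) \<le> Pr (?R j)" for j
    proof -
      have "\<delta> / (real j + 2) = \<delta> powr (\<epsilon> * ln (real j + 2) + 1)"
      proof -
        have "\<delta> powr (\<epsilon> * ln (real j + 2)) = exp (- ln (real j + 2))"
          using \<delta> ln\<delta> by (simp add: powr_def \<epsilon>_def ln_div field_simps)
        then show ?thesis using \<delta> by (simp add: powr_add exp_minus field_simps)
      qed
      also have "\<dots> \<le> \<delta> powr real (k j)"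
        using k_le[of j] \<delta> by (intro powr_mono') auto
      also have "\<dots> = \<delta> ^ k j" using \<delta> by (simp add: powr_realpow)
      also have "\<dots> \<le> Pr (\<lambda>w. \<gamma> * 2 ^ j \<le> height h 0 (4 ^ j) w) ^ k j"
      proof (rule power_mono)
        have "sqrt (real (4 ^ j)) = 2 ^ j"
          by (simp add: real_sqrt_power flip: power_mult_distrib)
        then show "\<delta> \<le> Pr (\<lambda>w. \<gamma> * 2 ^ j \<le> height h 0 (4 ^ j) w)"
          using Pr_height_ge[of "4 ^ j"] by (simp add: \<delta>_def \<gamma>_def)
      qed (use \<delta> in simp)
      also have "\<dots> \<le> Pr (?R j)"
        by (rule Pr_height_blocks) (use \<gamma> in simp)
      finally show ?thesis .
    qed
    show "\<not> summable (\<lambda>j. \<delta> / (real j + 2))"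
    proof
      assume "summable (\<lambda>j. \<delta> / (real j + 2))"
      from summable_mult[OF this, of "1 / \<delta>"] have "summable (\<lambda>j. 1 / real (j + 2))"
        using \<delta> by (simp add: add.commute)
      then have "summable (\<lambda>j. 1 / real j)"
        by (subst (asm) summable_iff_shift[of "\<lambda>j. 1 / real j" 2])
      then show False
        using not_summable_harmonic[where 'a = real] by (simp add: inverse_eq_divide)
    qed
  qed
  \<comment> \<open>Chosen so that ln (\<epsilon> + 4) + ln (j + 2) \<le> B ln (j + 2), by ln 2
    \<le> ln (j + 2).\<close>
  define B where "B = ln (\<epsilon> + 4) / ln 2 + 1"
  have B: "0 < B" using \<epsilon> by (simp add: B_def add_nonneg_pos)
  have lnln: "ln (ln (real n)) \<le> B / \<epsilon> * k j" if "3 \<le> n" "n \<le> 2 * (k j * 4 ^ j)" for n j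
  proof -
    have "exp 1 \<le> real n" using exp_le that(1) by linarith
    then have ln1: "1 \<le> ln (real n)" using that(1) by (subst ln_ge_iff) auto
    have kp: "0 < real (k j)" using k_pos[of j] by linarith
    have "ln (real n) \<le> ln (2 * (real (k j) * 4 ^ j))"
      using that by (subst ln_le_cancel_iff) (use kp of_nat_mono[OF that(2), where 'a = real] in auto)
    also have "\<dots> = ln 2 + ln (real (k j)) + real j * ln 4"
      using kp by (simp add: ln_mult ln_realpow)
    also have "\<dots> \<le> 1 + real (k j) + real j * 2"
    proof -
      have "ln 4 \<le> (2 :: real)"
        using ln_realpow[of 2 2] ln_le_minus_one[of "2 :: real"] by simp
      then have "real j * ln 4 \<le> real j * 2" by (intro mult_left_mono) auto
      moreover have "ln 2 \<le> (1 :: real)" using ln_le_minus_one[of "2 :: real"] by simp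
      moreover have "ln (real (k j)) \<le> real (k j)" using ln_le_minus_one[OF kp] by simp
      ultimately show ?thesis by linarith
    qed
    also have "\<dots> \<le> (\<epsilon> + 4) * (real j + 2)"
    proof -
      have "\<epsilon> * ln (real j + 2) \<le> \<epsilon> * (real j + 2)"
        using \<epsilon> ln_le_minus_one[of "real j + 2"] by (intro mult_left_mono) auto
      then show ?thesis using k_le[of j] by (simp add: algebra_simps)
    qed
    finally have "ln (ln (real n)) \<le> ln ((\<epsilon> + 4) * (real j + 2))"
      using ln1 \<epsilon> by (subst ln_le_cancel_iff) auto
    also have "\<dots> = ln (\<epsilon> + 4) + ln (real j + 2)" using \<epsilon> by (subst ln_mult) auto
    also have "\<dots> \<le> B * ln (real j + 2)"
    proof -
      have "ln (\<epsilon> + 4) / ln 2 * ln 2 \<le> ln (\<epsilon> + 4) / ln 2 * ln (real j + 2)"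
        using \<epsilon> by (intro mult_left_mono) auto
      then show ?thesis by (simp add: B_def distrib_right)
    qed
    also have "\<dots> = B / \<epsilon> * (\<epsilon> * ln (real j + 2))" using \<epsilon> by simp
    also have "\<dots> \<le> B / \<epsilon> * k j" using k_ge[of j] B \<epsilon> by (intro mult_left_mono) auto
    finally show ?thesis .
  qed
  \<comment> \<open>The root comes from n ln ln n \<le> 2 (B/\<epsilon>) (k j 2^j)^2, the other
    factor 2 from halving the rise of a block.\<close>
  define c where "c = \<gamma> / (2 * sqrt (2 * (B / \<epsilon>)))"
  have c: "0 < c" using \<gamma> B \<epsilon> by (simp add: c_def)
  have c_bound: "c * sqrt (real n * ln (ln (real n))) \<le> real (k j) * (\<gamma> * 2 ^ j) / 2"
    if "3 \<le> n" "n \<le> 2 * (k j * 4 ^ j)" for n j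
  proof -
    have "real n * ln (ln (real n)) \<le> real n * (B / \<epsilon> * k j)"
      using lnln[OF that] by (intro mult_left_mono) auto
    also have "\<dots> \<le> (2 * (real (k j) * 4 ^ j)) * (B / \<epsilon> * k j)"
      using of_nat_mono[OF that(2), where 'a = real] B \<epsilon> by (intro mult_right_mono) auto
    also have "\<dots> = 2 * (B / \<epsilon>) * (real (k j) * 2 ^ j)\<^sup>2"
      by (simp add: power2_eq_square field_simps flip: power_mult_distrib)
    finally have "sqrt (real n * ln (ln (real n))) \<le> sqrt (2 * (B / \<epsilon>) * (real (k j) * 2 ^ j)\<^sup>2)"
      by (rule real_sqrt_le_mono)
    also have "\<dots> = sqrt (2 * (B / \<epsilon>)) * (real (k j) * 2 ^ j)"
      by (simp only: real_sqrt_mult real_sqrt_abs) simp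
    finally have "c * sqrt (real n * ln (ln (real n))) \<le> c * (sqrt (2 * (B / \<epsilon>)) * (real (k j) * 2 ^ j))"
      using c by (intro mult_left_mono) auto
    also have "\<dots> = real (k j) * (\<gamma> * 2 ^ j) / 2"
      using B \<epsilon> unfolding c_def by (simp add: field_simps)
    finally show ?thesis .
  qed
  have "\<exists>\<^sub>\<infinity>n. c * sqrt (real n * ln (ln (real n))) \<le> \<bar>real_of_int (height h 0 n w)\<bar>"
    if io: "\<exists>\<^sub>\<infinity>j. ?R j (\<lambda>i. w (i + T j))" for w
    unfolding INFM_nat_le
  proof
    fix m
    obtain j where j: "max 3 m \<le> j" and R: "?R j (\<lambda>i. w (i + T j))"
      using io[unfolded INFM_nat_le, THEN spec, of "max 3 m"] by blast
    have "height h 0 (T (Suc j)) w = height h 0 (T j) w + height h 0 (k j * 4 ^ j) (\<lambda>i. w (i + T j))"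
      using height_add[of h 0 "T j" "k j * 4 ^ j" w] by (simp add: T_Suc height_def)
    \<comment> \<open>Whatever the height at the start of the block, a rise over the block forces an
      absolute height of at least half the rise at one of its two ends.\<close>
    then have "real (k j) * (\<gamma> * 2 ^ j) / 2 \<le> \<bar>real_of_int (height h 0 (T (Suc j)) w)\<bar>
        \<or> real (k j) * (\<gamma> * 2 ^ j) / 2 \<le> \<bar>real_of_int (height h 0 (T j) w)\<bar>"
      using R by linarith
    then obtain n where "n = T j \<or> n = T (Suc j)"
      and n: "real (k j) * (\<gamma> * 2 ^ j) / 2 \<le> \<bar>real_of_int (height h 0 n w)\<bar>" by blast
    then have "max 3 m \<le> n" "n \<le> 2 * (k j * 4 ^ j)"
      using j T_ge[of j] T_le[of j] by (auto simp: T_Suc)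
    then show "\<exists>n\<ge>m. c * sqrt (real n * ln (ln (real n))) \<le> \<bar>real_of_int (height h 0 n w)\<bar>"
      using c_bound[of n j] n by (intro exI[of _ n]) auto
  qed
  with AE_blocks have "AE w in \<Omega>. \<exists>\<^sub>\<infinity>n. c * sqrt (real n * ln (ln (real n))) \<le> \<bar>real_of_int (height h 0 n w)\<bar>"
    by (auto elim!: eventually_mono)
  with c show thesis by (rule that)
qed

end

section \<open>Probabilistic consequences of length bounds that hold path by path\<close>

locale walk_length_bounds = lazy_walk \<mu> A h p for \<mu> :: "'a pmf" and A h p +
  fixes len :: "nat \<Rightarrow> (nat \<Rightarrow> 'a) \<Rightarrow> real" and I :: "'i set"
    and g :: "'i \<Rightarrow> int \<Rightarrow> 'a \<Rightarrow> real" and c C :: real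
  assumes finite_I: "finite I" and I_nonempty: "I \<noteq> {}"
    and g_bound: "\<And>i s x. i \<in> I \<Longrightarrow> x \<in> set_pmf \<mu> \<Longrightarrow> \<bar>g i s x\<bar> \<le> 1"
    and g_mean: "\<And>i s. i \<in> I \<Longrightarrow> measure_pmf.expectation \<mu> (g i s) = 0"
    and depends_len: "\<And>n. depends_below n (len n)"
    and len_0: "\<And>w. len 0 w = 0"
    and c_pos: "0 < c" and C_pos: "0 < C"
    and len_ge: "\<And>n w. (\<forall>k. w k \<in> set_pmf \<mu>) \<Longrightarrow> c * \<bar>real_of_int (height h 0 n w)\<bar> \<le> len n w"
    and len_le: "\<And>n w. (\<forall>k. w k \<in> set_pmf \<mu>) \<Longrightarrow>
      len n w \<le> C * (1 + ln (real n + 2)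
        + (\<Sum>i\<in>I. Max ((\<lambda>k. \<bar>functional h (g i) 0 k w\<bar>) ` {..n})))"
begin

definition maxfun :: "'i \<Rightarrow> nat \<Rightarrow> (nat \<Rightarrow> 'a) \<Rightarrow> real" where
  "maxfun i n w = Max ((\<lambda>k. \<bar>functional h (g i) 0 k w\<bar>) ` {..n})"

lemma maxfun_ge_iff: "a \<le> maxfun i n w \<longleftrightarrow> (\<exists>k\<le>n. a \<le> \<bar>functional h (g i) 0 k w\<bar>)"
  unfolding maxfun_def by (subst Max_ge_iff) auto

lemma maxfun_mono: "m \<le> n \<Longrightarrow> maxfun i m w \<le> maxfun i n w"
  using maxfun_ge_iff[of "maxfun i m w" i m w] maxfun_ge_iff[of "maxfun i m w" i n w] by auto

lemma depends_below_maxfun: "depends_below n (maxfun i n)"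
proof (rule depends_belowI)
  fix w w' :: "nat \<Rightarrow> 'a"
  assume eq: "\<And>k. k < n \<Longrightarrow> w k = w' k"
  have "functional h (g i) 0 k w = functional h (g i) 0 k w'" if "k \<le> n" for k
    by (rule depends_belowD[OF depends_below_functional[OF that] eq])
  then show "maxfun i n w = maxfun i n w'" unfolding maxfun_def by (simp cong: image_cong_simp)
qed

lemma Pr_maxfun_ge:
  assumes "i \<in> I" "0 \<le> l"
  shows "Pr (\<lambda>w. a \<le> maxfun i n w) \<le> 2 * exp (real n * l\<^sup>2 / 2 - l * a)"
  unfolding maxfun_ge_iff by (rule maximal_inequality_abs) (use assms g_bound g_mean in auto)

lemma pred_len: "Measurable.pred \<Omega> (\<lambda>w. Q (len n w))"
  by (rule pred_depends_below[OF depends_below_comp[OF depends_len]])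

lemma ln_le_sqrt:
  assumes "1 \<le> n"
  shows "1 + ln (real n + 2) \<le> 5 * sqrt (real n)"
proof -
  have "sqrt (real n + 2) \<le> sqrt (2\<^sup>2 * real n)"
    using assms by (subst real_sqrt_le_iff) simp
  also have "\<dots> = 2 * sqrt (real n)" by (simp add: real_sqrt_mult)
  finally have s: "sqrt (real n + 2) \<le> 2 * sqrt (real n)" .
  have "ln (real n + 2) = 2 * ln (sqrt (real n + 2))"
    by (simp add: ln_sqrt)
  moreover have "ln (sqrt (real n + 2)) \<le> sqrt (real n + 2) - 1"
    by (rule ln_le_minus_one) simp
  moreover have "0 \<le> sqrt (real n)" by simp
  ultimately show ?thesis using s by linarith
qed

lemma len_le_maxfun:
  assumes "\<forall>k. w k \<in> set_pmf \<mu>" "1 \<le> n"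
  shows "len n w \<le> C * (5 * sqrt n + (\<Sum>i\<in>I. maxfun i n w))"
proof -
  have "len n w \<le> C * (1 + ln (real n + 2) + (\<Sum>i\<in>I. maxfun i n w))"
    using len_le[OF assms(1)] by (simp add: maxfun_def)
  also have "\<dots> \<le> C * (5 * sqrt n + (\<Sum>i\<in>I. maxfun i n w))"
    using ln_le_sqrt[OF assms(2)] C_pos by (intro mult_left_mono add_right_mono) auto
  finally show ?thesis .
qed

lemma Pr_len_gt_lower:
  obtains \<gamma> \<delta> where "0 < \<gamma>" "0 < \<delta>" "\<And>n. 1 \<le> n \<Longrightarrow> \<delta> \<le> Pr (\<lambda>w. \<gamma> * sqrt n < len n w)"
proof (rule that)
  \<comment> \<open>Half of c times the p/16 of \<open>Pr_height_ge\<close>, which makes the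
    inequality strict.\<close>
  show "0 < c * p / 32" "0 < p / 44" using c_pos p_pos by simp_all
  fix n :: nat
  assume n: "1 \<le> n"
  have "p / 44 \<le> Pr (\<lambda>w. p / 16 * sqrt n \<le> height h 0 n w)" by (rule Pr_height_ge[OF n])
  also have "\<dots> \<le> Pr (\<lambda>w. c * p / 32 * sqrt n < len n w)"
  proof (rule Pr_mono_AE[OF pred_len])
    have "c * p / 32 * sqrt n < len n w"
      if "\<forall>k. w k \<in> set_pmf \<mu>" "p / 16 * sqrt n \<le> height h 0 n w" for w
    proof -
      have "c * p / 32 * sqrt n < c * (p / 16 * sqrt n)"
        using c_pos p_pos n by simp
      also have "\<dots> \<le> c * \<bar>real_of_int (height h 0 n w)\<bar>"
        using that(2) c_pos by (intro mult_left_mono) auto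
      finally show ?thesis using len_ge[OF that(1), of n] by linarith
    qed
    then show "AE w in \<Omega>. p / 16 * sqrt n \<le> height h 0 n w \<longrightarrow> c * p / 32 * sqrt n < len n w"
      using AE_support by (auto elim!: eventually_mono)
  qed
  finally show "p / 44 \<le> Pr (\<lambda>w. c * p / 32 * sqrt n < len n w)" .
qed

text \<open>If the length exceeds x sqrt n, one of the finitely many maxima reaches its share. The
  maximal inequality with l = 1 / sqrt n keeps n l^2 / 2 constant and leaves exponential decay in x,
  uniformly in n.\<close>

lemma Pr_len_gt_upper:
  obtains b D where "0 < b" "0 < D" "\<And>n x. 0 \<le> x \<Longrightarrow> Pr (\<lambda>w. x * sqrt n < len n w) \<le> D * exp (- b * x)"
proof -
  define r where "r = real (card I)"
  have r: "0 < r" using finite_I I_nonempty by (simp add: r_def card_gt_0_iff)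
  define b where "b = 1 / (C * r)"
  define D where "D = r * (2 * exp (1 / 2 + 5 / r))"
  have b: "0 < b" using r C_pos by (simp add: b_def)
  have D: "0 < D" using r by (simp add: D_def)
  have "Pr (\<lambda>w. x * sqrt n < len n w) \<le> D * exp (- b * x)" if x: "0 \<le> x" for n x
  proof (cases "n = 0")
    case True
    then show ?thesis using D by (simp add: len_0 measure_def less_imp_le)
  next
    case False
    then have n: "1 \<le> n" by simp
    \<comment> \<open>The solution of C (5 sqrt n + r a) = x sqrt n. It is negative for small x,
      where the bound for \<open>maxfun\<close> remains valid.\<close>
    define a where "a = (x / C - 5) / r * sqrt n"
    have "Pr (\<lambda>w. x * sqrt n < len n w) \<le> Pr (\<lambda>w. \<exists>i\<in>I. a \<le> maxfun i n w)"
    proof (rule Pr_mono_AE)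
      show "Measurable.pred \<Omega> (\<lambda>w. \<exists>i\<in>I. a \<le> maxfun i n w)"
        using finite_I by (intro pred_intros_finite pred_depends_below[OF depends_below_comp[OF depends_below_maxfun]])
      have "\<exists>i\<in>I. a \<le> maxfun i n w" if w: "\<forall>k. w k \<in> set_pmf \<mu>" and gt: "x * sqrt n < len n w" for w
      proof (rule ccontr)
        assume neg: "\<not> (\<exists>i\<in>I. a \<le> maxfun i n w)"
        have "x * sqrt n < C * (5 * sqrt n + (\<Sum>i\<in>I. maxfun i n w))"
          using len_le_maxfun[OF w n] gt by linarith
        then have "x / C * sqrt n < 5 * sqrt n + (\<Sum>i\<in>I. maxfun i n w)"
          using C_pos by (simp add: pos_divide_less_eq mult.commute)
        moreover have "(\<Sum>i\<in>I. maxfun i n w) \<le> (\<Sum>i\<in>I. a)"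
          using neg by (intro sum_mono) (meson linear)
        then have "(\<Sum>i\<in>I. maxfun i n w) \<le> r * a" by (simp add: r_def)
        moreover have "r * a = x / C * sqrt n - 5 * sqrt n"
          using r by (simp add: a_def left_diff_distrib)
        ultimately show False by linarith
      qed
      then show "AE w in \<Omega>. x * sqrt n < len n w \<longrightarrow> (\<exists>i\<in>I. a \<le> maxfun i n w)"
        using AE_support by (auto elim!: eventually_mono)
    qed
    also have "{w \<in> space \<Omega>. \<exists>i\<in>I. a \<le> maxfun i n w} = (\<Union>i\<in>I. {w \<in> space \<Omega>. a \<le> maxfun i n w})"
      by auto
    also have "measure \<Omega> \<dots> \<le> (\<Sum>i\<in>I. Pr (\<lambda>w. a \<le> maxfun i n w))"
      by (rule \<Omega>.finite_measure_subadditive_finite[OF finite_I])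
        (auto intro!: sets_depends_below[OF depends_below_comp[OF depends_below_maxfun]])
    also have "\<dots> \<le> (\<Sum>i\<in>I. 2 * exp (real n * (1 / sqrt n)\<^sup>2 / 2 - 1 / sqrt n * a))"
      by (intro sum_mono Pr_maxfun_ge) auto
    also have "\<dots> \<le> r * (2 * exp (real n * (1 / sqrt n)\<^sup>2 / 2 - 1 / sqrt n * a))"
      by (simp add: r_def)
    also have "real n * (1 / sqrt n)\<^sup>2 / 2 - 1 / sqrt n * a = 1 / 2 - (x / C - 5) / r"
      using n by (simp add: a_def power_divide)
    also have "\<dots> = (1 / 2 + 5 / r) + - b * x"
      using r C_pos by (simp add: b_def field_simps)
    also have "r * (2 * exp \<dots>) = D * exp (- b * x)"
      by (simp only: exp_add D_def mult.assoc)
    finally show ?thesis .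
  qed
  with b D show thesis by (rule that)
qed

lemma len_nonneg: "\<forall>k. w k \<in> set_pmf \<mu> \<Longrightarrow> 0 \<le> len n w"
  using len_ge[of w n] c_pos by (meson abs_ge_zero less_imp_le mult_nonneg_nonneg order_trans)

lemma expectation_len_lower:
  obtains K where "0 < K" "\<And>n. K * sqrt n \<le> (\<integral>w. len n w \<partial>\<Omega>)"
proof -
  obtain \<gamma> \<delta> where *: "0 < \<gamma>" "0 < \<delta>" "\<And>n. 1 \<le> n \<Longrightarrow> \<delta> \<le> Pr (\<lambda>w. \<gamma> * sqrt n < len n w)"
    using Pr_len_gt_lower by blast
  have "\<gamma> * \<delta> * sqrt n \<le> (\<integral>w. len n w \<partial>\<Omega>)" for n
  proof (cases "n = 0")
    case False
    let ?Q = "\<lambda>w. \<gamma> * sqrt n < len n w"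
    have Q: "depends_below n ?Q"
      by (rule depends_below_comp[OF depends_len, where f = "\<lambda>y. \<gamma> * sqrt n < y"])
    have "\<gamma> * sqrt n * \<delta> \<le> \<gamma> * sqrt n * Pr ?Q"
      using *(1) *(3)[of n] False by (intro mult_left_mono) auto
    also have "\<dots> = (\<integral>w. \<gamma> * sqrt n * of_bool (?Q w) \<partial>\<Omega>)"
      by (simp add: Pr_eq_expectation[OF Q])
    also have "\<dots> \<le> (\<integral>w. len n w \<partial>\<Omega>)"
    proof (rule integral_mono_AE)
      show "integrable \<Omega> (\<lambda>w. \<gamma> * sqrt n * of_bool (?Q w))"
        by (rule integrable_depends_below[OF depends_below_comp[OF Q, where f = "\<lambda>b. \<gamma> * sqrt n * of_bool b"]])
      show "integrable \<Omega> (len n)" by (rule integrable_depends_below[OF depends_len])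
      show "AE w in \<Omega>. \<gamma> * sqrt n * of_bool (?Q w) \<le> len n w"
        using AE_support by eventually_elim (simp add: len_nonneg)
    qed
    finally show ?thesis by (simp add: mult_ac)
  qed (simp add: len_0)
  then show thesis using *(1,2) by (intro that[of "\<gamma> * \<delta>"]) auto
qed

text \<open>The length in units of sqrt n is at most the number of natural numbers below it, so its
  mean is at most a sum of tail probabilities. These are dominated by a geometric series that does
  not depend on n.\<close>

lemma expectation_len_upper:
  obtains K where "0 < K" "\<And>n. (\<integral>w. len n w \<partial>\<Omega>) \<le> K * sqrt n"
proof -
  obtain b D where *: "0 < b" "0 < D" "\<And>n x. 0 \<le> x \<Longrightarrow> Pr (\<lambda>w. x * sqrt n < len n w) \<le> D * exp (- b * x)"
    using Pr_len_gt_upper by blast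
  define K where "K = D / (1 - exp (- b))"
  have K: "0 < K" using * by (simp add: K_def)
  have "(\<integral>w. len n w \<partial>\<Omega>) \<le> K * sqrt n" for n
  proof (cases "n = 0")
    case False
    then have n: "0 < sqrt n" by simp
    obtain B where B: "\<And>w. (\<forall>k. w k \<in> set_pmf \<mu>) \<Longrightarrow> \<bar>len n w / sqrt n\<bar> \<le> B"
      by (rule bounded_depends_below[OF depends_below_comp[OF depends_len[of n], where f = "\<lambda>y. y / sqrt n"]]) (rule that)
    \<comment> \<open>The almost sure bound, which depends on n, only makes the sum finite; it
      disappears in the geometric series.\<close>
    define N where "N = nat \<lceil>B\<rceil>"
    have layer: "len n w / sqrt n \<le> (\<Sum>k<N. of_bool (real k * sqrt n < len n w))"
      if w: "\<forall>k. w k \<in> set_pmf \<mu>" for w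
    proof -
      have y0: "0 \<le> len n w / sqrt n" using len_nonneg[OF w] by simp
      define m where "m = nat \<lceil>len n w / sqrt n\<rceil>"
      have "len n w / sqrt n \<le> B" using B[OF w] by linarith
      then have mN: "m \<le> N" unfolding m_def N_def by (intro nat_mono ceiling_mono)
      have "len n w / sqrt n \<le> real m" unfolding m_def by linarith
      also have "\<dots> = (\<Sum>k<m. of_bool (real k * sqrt n < len n w))"
      proof -
        have "real k * sqrt n < len n w" if "k < m" for k
        proof -
          have "real k < len n w / sqrt n" using that unfolding m_def by linarith
          then show ?thesis using n by (simp add: pos_less_divide_eq)
        qed
        then show ?thesis by simp
      qed
      also have "\<dots> \<le> (\<Sum>k<N. of_bool (real k * sqrt n < len n w))"
        using mN by (intro sum_mono2) auto
      finally show ?thesis .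
    qed
    have dep: "depends_below n (\<lambda>w. real k * sqrt n < len n w)" for k
      by (rule depends_below_comp[OF depends_len, where f = "\<lambda>y. real k * sqrt n < y"])
    have "(\<integral>w. len n w / sqrt n \<partial>\<Omega>) \<le> (\<integral>w. (\<Sum>k<N. of_bool (real k * sqrt n < len n w)) \<partial>\<Omega>)"
    proof (rule integral_mono_AE)
      show "integrable \<Omega> (\<lambda>w. len n w / sqrt n)"
        by (rule integrable_depends_below[OF depends_below_comp[OF depends_len, where f = "\<lambda>y. y / sqrt n"]])
      show "integrable \<Omega> (\<lambda>w. (\<Sum>k<N. of_bool (real k * sqrt n < len n w)) :: real)"
        by (rule integrable_depends_below[OF depends_below_comp[OF depends_len,
            where f = "\<lambda>y. \<Sum>k<N. of_bool (real k * sqrt n < y)"]])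
      show "AE w in \<Omega>. len n w / sqrt n \<le> (\<Sum>k<N. of_bool (real k * sqrt n < len n w))"
        using AE_support by eventually_elim (rule layer)
    qed
    also have "\<dots> = (\<Sum>k<N. (\<integral>w. of_bool (real k * sqrt n < len n w) \<partial>\<Omega>))"
    proof (rule Bochner_Integration.integral_sum)
      fix k
      show "integrable \<Omega> (\<lambda>w. of_bool (real k * sqrt n < len n w) :: real)"
        by (rule integrable_depends_below[OF depends_below_comp[OF dep[of k], where f = of_bool]])
    qed
    also have "\<dots> = (\<Sum>k<N. Pr (\<lambda>w. real k * sqrt n < len n w))"
      by (intro sum.cong refl Pr_eq_expectation[OF dep, symmetric])
    also have "\<dots> \<le> (\<Sum>k<N. D * exp (- b) ^ k)"
    proof (rule sum_mono)
      fix k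
      have "Pr (\<lambda>w. real k * sqrt n < len n w) \<le> D * exp (- b * real k)" by (rule *(3)) simp
      then show "Pr (\<lambda>w. real k * sqrt n < len n w) \<le> D * exp (- b) ^ k"
        by (simp only: exp_of_nat2_mult)
    qed
    also have "\<dots> = D * (\<Sum>k<N. exp (- b) ^ k)" by (simp add: sum_distrib_left)
    also have "\<dots> \<le> D * suminf (\<lambda>k. exp (- b) ^ k)"
      using * by (intro mult_left_mono sum_le_suminf summable_geometric) auto
    also have "\<dots> = K" using * by (subst suminf_geometric) (auto simp: K_def)
    finally show ?thesis using n by (simp add: pos_divide_le_eq)
  qed (simp add: len_0)
  with K show thesis by (rule that)
qed

end

context walk_length_bounds
begin

text \<open>With N = 2^(j+1) and a^2 = 8 2^j ln j, the optimal choice l = a/N makes the exponent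
  -a^2/(2N) = -2 ln j. The probabilities are then at most 2/j^2, and the first Borel-Cantelli lemma
  applies.\<close>

lemma AE_maxfun_dyadic:
  assumes i: "i \<in> I"
  shows "AE w in \<Omega>. \<forall>\<^sub>F j in sequentially. maxfun i (2 ^ Suc j) w < sqrt (8 * 2 ^ j * ln (real j))"
proof -
  let ?a = "\<lambda>j. sqrt (8 * 2 ^ j * ln (real j))"
  let ?E = "\<lambda>j. {w \<in> space \<Omega>. ?a j \<le> maxfun i (2 ^ Suc j) w}"
  have bound: "measure \<Omega> (?E j) \<le> 2 * (1 / real j ^ 2)" if j: "1 \<le> j" for j
  proof -
    let ?N = "2 ^ Suc j :: nat"
    have "0 \<le> 8 * 2 ^ j * ln (real j)" using j by simp
    then have a: "0 \<le> ?a j" "?a j * ?a j = 8 * 2 ^ j * ln (real j)" by simp_all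
    have "measure \<Omega> (?E j) \<le> 2 * exp (real ?N * (?a j / real ?N)\<^sup>2 / 2 - ?a j / real ?N * ?a j)"
      by (rule Pr_maxfun_ge[OF i]) (use a in simp)
    also have "real ?N * (?a j / real ?N)\<^sup>2 / 2 - ?a j / real ?N * ?a j = - (?a j * ?a j) / (2 * real ?N)"
      by (simp add: power2_eq_square field_simps)
    also have "\<dots> = - (2 * ln (real j))" unfolding a(2) by simp
    also have "exp \<dots> = 1 / real j ^ 2"
      using j by (simp add: exp_minus inverse_eq_divide exp_double power2_eq_square flip: mult_2)
    finally show ?thesis .
  qed
  have "summable (\<lambda>j. measure \<Omega> (?E j))"
  proof (rule summable_comparison_test)
    show "\<exists>N. \<forall>j\<ge>N. norm (measure \<Omega> (?E j)) \<le> 2 * (1 / real j ^ 2)"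
      using bound by (intro exI[of _ 1]) simp
    have "summable (\<lambda>j. 1 / real j ^ 2)"
      using inverse_power_summable[of 2, where 'a = real] by (simp add: inverse_eq_divide)
    then show "summable (\<lambda>j. 2 * (1 / real j ^ 2))" by (rule summable_mult)
  qed
  then have "AE w in \<Omega>. \<forall>\<^sub>F j in sequentially. w \<in> space \<Omega> - ?E j"
  proof (intro borel_cantelli_AE1)
    show "?E j \<in> sets \<Omega>" for j
      by (rule sets_depends_below[OF depends_below_comp[OF depends_below_maxfun,
          where f = "\<lambda>y. ?a j \<le> y"]])
  qed (simp_all add: \<Omega>.emeasure_eq_measure)
  then show ?thesis
    by (rule eventually_mono) (auto elim!: eventually_mono simp: not_le)
qed

lemma len_eventually_small:
  obtains K where "0 < K"
    "AE w in \<Omega>. \<forall>\<^sub>F n in sequentially. len n w \<le> K * sqrt (real n * ln (ln (real n)))"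
proof -
  have large: "\<forall>\<^sub>F n in sequentially. 1 \<le> ln (ln (real n))"
  proof -
    have "filterlim (\<lambda>n. ln (ln (real n))) at_top sequentially"
      by (intro filterlim_compose[OF ln_at_top] filterlim_real_sequentially)
    then show ?thesis by (simp add: filterlim_at_top)
  qed
  \<comment> \<open>Monotonicity of the maxima carries the dyadic bound to all n with 2^j \<le> n <
    2^(j+1). For large n, ln j \<le> 2 ln ln n, so 8 2^j ln j \<le> 16 n ln ln n; hence the factor
    4.\<close>
  have small: "\<forall>\<^sub>F n in sequentially. maxfun i n w \<le> 4 * sqrt (real n * ln (ln (real n)))"
    if dy: "\<forall>\<^sub>F j in sequentially. maxfun i (2 ^ Suc j) w < sqrt (8 * 2 ^ j * ln (real j))" for i w
  proof -
    obtain J where J: "\<And>j. J \<le> j \<Longrightarrow> maxfun i (2 ^ Suc j) w < sqrt (8 * 2 ^ j * ln (real j))"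
      using dy unfolding eventually_sequentially by blast
    show ?thesis
      using large eventually_ge_at_top[of "2 ^ (J + 1)"]
    proof eventually_elim
      case (elim n)
      have "0 < n" using elim(2) by (metis gr0I le_zero_eq power_eq_0_iff zero_neq_numeral)
      obtain j where j: "2 ^ j \<le> n" "n < 2 ^ Suc j"
        using ex_power_ivl1[of 2 n] \<open>0 < n\<close> by auto
      have "(2 :: nat) ^ (J + 1) < 2 ^ Suc j" using elim(2) j by linarith
      then have jJ: "J + 1 \<le> j" by (simp add: power_strict_increasing_iff less_Suc_eq_le del: power_Suc)
      have nj: "2 ^ j \<le> real n" using j(1) by (metis of_nat_le_iff of_nat_numeral of_nat_power)
      have "real j * ln 2 = ln (2 ^ j)" by (simp add: ln_realpow)
      also have "\<dots> \<le> ln (real n)" using nj \<open>0 < n\<close> by (subst ln_le_cancel_iff) auto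
      finally have "real j * ln 2 \<le> ln (real n)" .
      moreover have "1 / 2 \<le> ln (2 :: real)"
        using ln_le_minus_one[of "1 / 2 :: real"] by (simp add: ln_div)
      then have "real j * (1 / 2) \<le> real j * ln 2"
        by (intro mult_left_mono) auto
      ultimately have jn: "real j \<le> 2 * ln (real n)" by linarith
      have "ln (real j) \<le> ln (2 * ln (real n))"
        using jJ jn by (subst ln_le_cancel_iff) auto
      also have "\<dots> = ln 2 + ln (ln (real n))"
        using jJ jn by (subst ln_mult) auto
      also have "\<dots> \<le> 2 * ln (ln (real n))"
        using elim(1) ln_le_minus_one[of "2 :: real"] by simp
      finally have lnj: "ln (real j) \<le> 2 * ln (ln (real n))" .
      have "maxfun i n w \<le> maxfun i (2 ^ Suc j) w" using j by (intro maxfun_mono) simp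
      also have "\<dots> \<le> sqrt (8 * 2 ^ j * ln (real j))" using J[of j] jJ by simp
      also have "\<dots> \<le> sqrt (4\<^sup>2 * (real n * ln (ln (real n))))"
      proof (rule real_sqrt_le_mono)
        have "2 ^ j * ln (real j) \<le> real n * (2 * ln (ln (real n)))"
          using nj lnj jJ by (intro mult_mono) auto
        then show "8 * 2 ^ j * ln (real j) \<le> 4\<^sup>2 * (real n * ln (ln (real n)))"
          by (simp add: mult_ac)
      qed
      also have "\<dots> = 4 * sqrt (real n * ln (ln (real n)))" by (simp add: real_sqrt_mult)
      finally show ?case .
    qed
  qed
  define K where "K = C * (5 + 4 * real (card I))"
  have K: "0 < K" using C_pos by (simp add: K_def add_pos_nonneg)
  have "AE w in \<Omega>. \<forall>i\<in>I. \<forall>\<^sub>F j in sequentially. maxfun i (2 ^ Suc j) w < sqrt (8 * 2 ^ j * ln (real j))"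
    using finite_I AE_maxfun_dyadic by (simp add: AE_finite_all)
  then have "AE w in \<Omega>. \<forall>\<^sub>F n in sequentially. len n w \<le> K * sqrt (real n * ln (ln (real n)))"
    using AE_support
  proof eventually_elim
    case (elim w)
    then have "\<forall>\<^sub>F n in sequentially. \<forall>i\<in>I. maxfun i n w \<le> 4 * sqrt (real n * ln (ln (real n)))"
      using finite_I small by (simp add: eventually_ball_finite_distrib)
    then show ?case
      using large eventually_ge_at_top[of 1]
    proof eventually_elim
      case (elim n)
      let ?s = "sqrt (real n * ln (ln (real n)))"
      have "sqrt (real n) \<le> ?s"
        using mult_left_mono[OF elim(2), of "real n"] by (intro real_sqrt_le_mono) simp
      moreover have "(\<Sum>i\<in>I. maxfun i n w) \<le> (\<Sum>i\<in>I. 4 * ?s)"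
        using elim(1) by (intro sum_mono) auto
      ultimately have "5 * sqrt n + (\<Sum>i\<in>I. maxfun i n w) \<le> (5 + 4 * real (card I)) * ?s"
        unfolding sum_constant distrib_right by linarith
      then have "C * (5 * sqrt n + (\<Sum>i\<in>I. maxfun i n w)) \<le> C * ((5 + 4 * real (card I)) * ?s)"
        using C_pos by (intro mult_left_mono) auto
      then show ?case
        using len_le_maxfun[OF \<open>\<forall>k. w k \<in> set_pmf \<mu>\<close> elim(3)] by (simp add: K_def mult.assoc)
    qed
  qed
  with K show thesis by (rule that)
qed

lemma AE_limsup_len:
  "AE w in \<Omega>. 0 < limsup (\<lambda>n. ereal (len n w / (real n * ln (ln (real n))) powr (1 / 2)))
     \<and> limsup (\<lambda>n. ereal (len n w / (real n * ln (ln (real n))) powr (1 / 2))) < \<infinity>"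
proof -
  obtain K where K: "0 < K"
    and up: "AE w in \<Omega>. \<forall>\<^sub>F n in sequentially. len n w \<le> K * sqrt (real n * ln (ln (real n)))"
    by (rule len_eventually_small)
  obtain k where k: "0 < k"
    and lo: "AE w in \<Omega>. \<exists>\<^sub>\<infinity>n. k * sqrt (real n * ln (ln (real n))) \<le> \<bar>real_of_int (height h 0 n w)\<bar>"
    by (rule height_infinitely_often_large)
  have pos: "\<forall>\<^sub>F n in sequentially. 0 < real n * ln (ln (real n))"
  proof -
    have "filterlim (\<lambda>n. ln (ln (real n))) at_top sequentially"
      by (intro filterlim_compose[OF ln_at_top] filterlim_real_sequentially)
    then have "\<forall>\<^sub>F n in sequentially. 0 < ln (ln (real n))"
      by (auto simp: filterlim_at_top_dense)
    then show ?thesis using eventually_gt_at_top[of 0] by eventually_elim simp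
  qed
  show ?thesis
    using up lo AE_support
  proof eventually_elim
    case (elim w)
    let ?a = "\<lambda>n. len n w / (real n * ln (ln (real n))) powr (1 / 2)"
    have "\<forall>\<^sub>F n in sequentially. ereal (?a n) \<le> ereal K"
      using elim(1) pos
    proof eventually_elim
      case (elim n)
      then show ?case by (simp add: powr_half_sqrt pos_divide_le_eq)
    qed
    then have "limsup (\<lambda>n. ereal (?a n)) \<le> ereal K" by (rule Limsup_bounded)
    then have 1: "limsup (\<lambda>n. ereal (?a n)) < \<infinity>" by auto
    have "\<exists>\<^sub>F n in sequentially. k * sqrt (real n * ln (ln (real n))) \<le> \<bar>real_of_int (height h 0 n w)\<bar>"
      using elim(2) by (simp add: cofinite_eq_sequentially)
    then have "\<exists>\<^sub>F n in sequentially. ereal (c * k) \<le> ereal (?a n)"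
    proof (rule frequently_rev_mp)
      show "\<forall>\<^sub>F n in sequentially. k * sqrt (real n * ln (ln (real n))) \<le> \<bar>real_of_int (height h 0 n w)\<bar>
          \<longrightarrow> ereal (c * k) \<le> ereal (?a n)"
        using pos
      proof eventually_elim
        case (elim n)
        show ?case
        proof
          assume "k * sqrt (real n * ln (ln (real n))) \<le> \<bar>real_of_int (height h 0 n w)\<bar>"
          then have "c * (k * sqrt (real n * ln (ln (real n)))) \<le> c * \<bar>real_of_int (height h 0 n w)\<bar>"
            using c_pos by (intro mult_left_mono) auto
          also have "\<dots> \<le> len n w" by (rule len_ge) (rule \<open>\<forall>k. w k \<in> set_pmf \<mu>\<close>)
          finally show "ereal (c * k) \<le> ereal (?a n)"
            using elim by (simp add: powr_half_sqrt pos_le_divide_eq mult.assoc)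
        qed
      qed
    qed
    then have "\<not> limsup (\<lambda>n. ereal (?a n)) < ereal (c * k)"
      using Limsup_lessD[of sequentially "\<lambda>n. ereal (?a n)" "ereal (c * k)"]
      by (auto simp: frequently_def not_le elim!: eventually_mono)
    then have "0 < limsup (\<lambda>n. ereal (?a n))"
      using c_pos k by (auto simp: not_less intro: less_le_trans[of 0 "ereal (c * k)"])
    with 1 show ?case by blast
  qed
qed

end

section \<open>Word length\<close>

context group
begin

lemma foldr_mult_append:
  assumes "set us \<subseteq> carrier G" "set vs \<subseteq> carrier G"
  shows "foldr (\<otimes>) (us @ vs) \<one> = foldr (\<otimes>) us \<one> \<otimes> foldr (\<otimes>) vs \<one>"
proof -
  have closed: "foldr (\<otimes>) ws \<one> \<in> carrier G" if "set ws \<subseteq> carrier G" for ws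
    using that by (induction ws) auto
  show ?thesis
    using assms(1) by (induction us) (auto simp: assms(2) closed m_assoc)
qed

context
  fixes S
  assumes S: "finite_sym_generating_set G S"
begin

lemma S_carrier: "S \<subseteq> carrier G"
  using S by (simp add: finite_sym_generating_set_def)

lemma ex_word:
  assumes "g \<in> carrier G"
  shows "\<exists>ws. set ws \<subseteq> S \<and> foldr (\<otimes>) ws \<one> = g"
proof -
  have "g \<in> generate G S" using assms S by (simp add: finite_sym_generating_set_def)
  then show ?thesis
  proof (induction rule: generate.induct)
    case one
    then show ?case by (intro exI[of _ "[]"]) simp
  next
    case (incl h)
    then show ?case using S_carrier by (intro exI[of _ "[h]"]) auto
  next
    case (inv h)
    then have "inv h \<in> S" using S by (simp add: finite_sym_generating_set_def)
    then show ?case using S_carrier by (intro exI[of _ "[inv h]"]) auto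
  next
    case (eng h1 h2)
    then obtain us vs where "set us \<subseteq> S" "foldr (\<otimes>) us \<one> = h1" "set vs \<subseteq> S" "foldr (\<otimes>) vs \<one> = h2"
      by blast
    moreover from this have "foldr (\<otimes>) (us @ vs) \<one> = h1 \<otimes> h2"
      using S_carrier by (subst foldr_mult_append) auto
    ultimately show ?case by (intro exI[of _ "us @ vs"]) auto
  qed
qed

lemma word_length_le: "set ws \<subseteq> S \<Longrightarrow> foldr (\<otimes>) ws \<one> = g \<Longrightarrow> word_length G S g \<le> length ws"
  unfolding word_length_def by (rule Least_le) blast

lemma shortest_word:
  assumes "g \<in> carrier G"
  obtains ws where "length ws = word_length G S g" "set ws \<subseteq> S" "foldr (\<otimes>) ws \<one> = g"
proof -
  have "\<exists>n ws. length ws = n \<and> set ws \<subseteq> S \<and> foldr (\<otimes>) ws \<one> = g" using ex_word[OF assms] by blast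
  then have "\<exists>ws. length ws = word_length G S g \<and> set ws \<subseteq> S \<and> foldr (\<otimes>) ws \<one> = g"
    unfolding word_length_def by (rule LeastI_ex)
  then show thesis using that by blast
qed

lemma word_length_one: "word_length G S \<one> = 0"
  using word_length_le[of "[]" \<one>] by simp

lemma word_length_mult:
  assumes "g \<in> carrier G" "h \<in> carrier G"
  shows "word_length G S (g \<otimes> h) \<le> word_length G S g + word_length G S h"
proof -
  obtain us where us: "length us = word_length G S g" "set us \<subseteq> S" "foldr (\<otimes>) us \<one> = g"
    by (rule shortest_word[OF assms(1)])
  obtain vs where vs: "length vs = word_length G S h" "set vs \<subseteq> S" "foldr (\<otimes>) vs \<one> = h"
    by (rule shortest_word[OF assms(2)])
  have "word_length G S (g \<otimes> h) \<le> length (us @ vs)"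
  proof (rule word_length_le)
    have "foldr (\<otimes>) (us @ vs) \<one> = foldr (\<otimes>) us \<one> \<otimes> foldr (\<otimes>) vs \<one>"
      using us(2) vs(2) S_carrier by (intro foldr_mult_append) auto
    then show "foldr (\<otimes>) (us @ vs) \<one> = g \<otimes> h" by (simp only: us(3) vs(3))
  qed (use us vs in auto)
  then show ?thesis using us vs by simp
qed

text \<open>A homomorphism to the integers is Lipschitz for the word length. It is applied to the
  height.\<close>

lemma abs_hom_le_word_length:
  fixes f :: "'a \<Rightarrow> int"
  assumes hom: "\<And>g h. g \<in> carrier G \<Longrightarrow> h \<in> carrier G \<Longrightarrow> f (g \<otimes> h) = f g + f h"
  obtains c :: real where "0 < c" "\<And>g. g \<in> carrier G \<Longrightarrow> c * \<bar>real_of_int (f g)\<bar> \<le> real (word_length G S g)"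
proof -
  \<comment> \<open>The summand 1 keeps M positive when f vanishes on S.\<close>
  define M where "M = 1 + (\<Sum>s\<in>S. \<bar>real_of_int (f s)\<bar>)"
  have finS: "finite S" using S by (simp add: finite_sym_generating_set_def)
  have M: "0 < M" unfolding M_def by (rule add_pos_nonneg) (auto intro: sum_nonneg)
  have gen: "\<bar>real_of_int (f s)\<bar> \<le> M" if "s \<in> S" for s
    using member_le_sum[OF that, of "\<lambda>s. \<bar>real_of_int (f s)\<bar>"] finS by (simp add: M_def)
  have f1: "f \<one> = 0" using hom[of \<one> \<one>] by simp
  have word: "\<bar>real_of_int (f (foldr (\<otimes>) ws \<one>))\<bar> \<le> M * real (length ws)" if "set ws \<subseteq> S" for ws
    using that
  proof (induction ws)
    case (Cons s ws)
    have "foldr (\<otimes>) ws \<one> \<in> carrier G"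
      using Cons.prems S_carrier by (induction ws) auto
    then have "f (foldr (\<otimes>) (s # ws) \<one>) = f s + f (foldr (\<otimes>) ws \<one>)"
      using Cons.prems S_carrier hom by auto
    then show ?case using Cons gen[of s] by (simp add: distrib_left)
  qed (simp add: f1)
  have "1 / M * \<bar>real_of_int (f g)\<bar> \<le> real (word_length G S g)" if g: "g \<in> carrier G" for g
  proof -
    obtain ws where ws: "length ws = word_length G S g" "set ws \<subseteq> S" "foldr (\<otimes>) ws \<one> = g"
      by (rule shortest_word[OF g])
    then show ?thesis using word[OF ws(2)] M by (simp add: pos_divide_le_eq mult.commute)
  qed
  then show thesis using M by (intro that[of "1 / M"]) auto
qed

end

end

section \<open>The group\<close>

lemma int_adjoin_of_int: "of_int a \<in> int_adjoin \<rho>"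
  unfolding int_adjoin_def by (rule range_eqI[of _ _ "[:a:]"]) (simp add: hom_distribs)

lemma int_adjoin_add: "x \<in> int_adjoin \<rho> \<Longrightarrow> y \<in> int_adjoin \<rho> \<Longrightarrow> x + y \<in> int_adjoin \<rho>"
  unfolding int_adjoin_def by (auto simp: hom_distribs[symmetric] poly_add[symmetric] simp del: poly_add)

lemma int_adjoin_mult: "x \<in> int_adjoin \<rho> \<Longrightarrow> y \<in> int_adjoin \<rho> \<Longrightarrow> x * y \<in> int_adjoin \<rho>"
  unfolding int_adjoin_def by (auto simp: hom_distribs[symmetric] poly_mult[symmetric] simp del: poly_mult)

lemma countable_int_adjoin: "countable (int_adjoin \<rho>)"
proof -
  have "countable (UNIV :: int poly set)"
    by (rule countableI'[of "to_nat \<circ> coeffs"]) (auto intro!: inj_compose simp: inj_def coeffs_eq_iff)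
  then show ?thesis unfolding int_adjoin_def by (rule countable_image)
qed

lemma countable_adjoin_vec: "countable (adjoin_vec \<rho> d)"
proof -
  have "adjoin_vec \<rho> d \<subseteq> vec_of_list ` lists (int_adjoin \<rho>)"
  proof
    fix v
    assume "v \<in> adjoin_vec \<rho> d"
    then have "set (list_of_vec v) \<subseteq> int_adjoin \<rho>"
      by (auto simp: adjoin_vec_def set_list_of_vec vec_set_def)
    then show "v \<in> vec_of_list ` lists (int_adjoin \<rho>)"
      by (intro image_eqI[of _ _ "list_of_vec v"]) (auto simp: vec_list)
  qed
  then show ?thesis
    by (rule countable_subset) (intro countable_image countable_lists countable_int_adjoin)
qed

locale semidirect =
  fixes \<rho> :: complex and d :: nat and \<phi> :: "complex vec \<Rightarrow> complex vec"
  assumes aut: "linear_automorphism \<rho> d \<phi>"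
begin

definition V where "V = adjoin_vec \<rho> d"

definition G where "G = semidirect_Z \<rho> d \<phi>"

definition \<Phi> :: "int \<Rightarrow> complex vec \<Rightarrow> complex vec" where "\<Phi> = int_funpow V \<phi>"

definition M where "M = matrix_of d \<phi>"

lemma M_carrier: "M \<in> carrier_mat d d" by (simp add: M_def matrix_of_def)

lemma V_carrier: "v \<in> V \<Longrightarrow> v \<in> carrier_vec d" by (simp add: V_def adjoin_vec_def)

lemma V_zero: "0\<^sub>v d \<in> V"
  using int_adjoin_of_int[of 0] by (auto simp: V_def adjoin_vec_def)

lemma V_add: "v \<in> V \<Longrightarrow> w \<in> V \<Longrightarrow> v + w \<in> V"
  by (auto simp: V_def adjoin_vec_def int_adjoin_add)

lemma V_smult: "a \<in> int_adjoin \<rho> \<Longrightarrow> v \<in> V \<Longrightarrow> a \<cdot>\<^sub>v v \<in> V"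
  by (auto simp: V_def adjoin_vec_def int_adjoin_mult)

lemma V_unit: "i < d \<Longrightarrow> unit_vec d i \<in> V"
  using int_adjoin_of_int[of 0] int_adjoin_of_int[of 1] by (auto simp: V_def adjoin_vec_def unit_vec_def)

lemma uminus_smult: "v \<in> carrier_vec d \<Longrightarrow> - v = (- 1 :: complex) \<cdot>\<^sub>v v"
  by (intro eq_vecI) auto

lemma V_uminus: "v \<in> V \<Longrightarrow> - v \<in> V"
  using V_smult[of "- 1" v] int_adjoin_of_int[of "- 1"] by (simp add: uminus_smult V_carrier)

lemma bij: "bij_betw \<phi> V V"
  and \<phi>_add: "v \<in> V \<Longrightarrow> w \<in> V \<Longrightarrow> \<phi> (v + w) = \<phi> v + \<phi> w"
  and \<phi>_smult: "a \<in> int_adjoin \<rho> \<Longrightarrow> v \<in> V \<Longrightarrow> \<phi> (a \<cdot>\<^sub>v v) = a \<cdot>\<^sub>v \<phi> v"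
  using aut by (auto simp: linear_automorphism_def V_def)

lemma \<phi>_V: "v \<in> V \<Longrightarrow> \<phi> v \<in> V"
  using bij by (rule bij_betw_apply)

lemma \<phi>_zero: "\<phi> (0\<^sub>v d) = 0\<^sub>v d"
proof -
  have "\<phi> (0 \<cdot>\<^sub>v 0\<^sub>v d) = 0 \<cdot>\<^sub>v \<phi> (0\<^sub>v d)"
    using int_adjoin_of_int[of 0] by (intro \<phi>_smult V_zero) simp
  moreover have "(0 :: complex) \<cdot>\<^sub>v 0\<^sub>v d = 0\<^sub>v d" by (intro eq_vecI) auto
  moreover have "0 \<cdot>\<^sub>v \<phi> (0\<^sub>v d) = 0\<^sub>v d" using V_carrier[OF \<phi>_V[OF V_zero]] by (intro eq_vecI) auto
  ultimately show ?thesis by simp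
qed

text \<open>Linearity of \<phi> holds on V and for scalars in the ring, so v is built up one
  coordinate at a time through truncations that stay in V.\<close>

lemma \<phi>_eq_matrix:
  assumes v: "v \<in> V"
  shows "\<phi> v = M *\<^sub>v v"
proof -
  let ?t = "\<lambda>k. vec d (\<lambda>i. if i < k then v $ i else 0)"
  have vi: "v $ i \<in> int_adjoin \<rho>" if "i < d" for i
    using v that by (auto simp: V_def adjoin_vec_def)
  have tV: "?t k \<in> V" for k
    using vi int_adjoin_of_int[of 0] by (auto simp: V_def adjoin_vec_def)
  have trunc: "\<phi> (?t k) = vec d (\<lambda>i. \<Sum>j<k. \<phi> (unit_vec d j) $ i * v $ j)" if "k \<le> d" for k
    using that
  proof (induction k)
    case 0
    have "?t 0 = 0\<^sub>v d" by (intro eq_vecI) auto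
    then show ?case by (auto simp: \<phi>_zero intro!: eq_vecI)
  next
    case (Suc k)
    then have k: "k < d" by simp
    have "?t (Suc k) = ?t k + v $ k \<cdot>\<^sub>v unit_vec d k"
      using k by (intro eq_vecI) (auto simp: unit_vec_def less_Suc_eq)
    then have "\<phi> (?t (Suc k)) = \<phi> (?t k) + v $ k \<cdot>\<^sub>v \<phi> (unit_vec d k)"
      using k by (simp add: \<phi>_add tV V_smult V_unit vi \<phi>_smult)
    also have "\<dots> = vec d (\<lambda>i. \<Sum>j<Suc k. \<phi> (unit_vec d j) $ i * v $ j)"
      using Suc k V_carrier[OF \<phi>_V[OF V_unit[OF k]]] by (intro eq_vecI) auto
    finally show ?case .
  qed
  have "?t d = v" using V_carrier[OF v] by (intro eq_vecI) auto
  then have "\<phi> v = vec d (\<lambda>i. \<Sum>j<d. \<phi> (unit_vec d j) $ i * v $ j)"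
    using trunc[of d] by simp
  also have "\<dots> = M *\<^sub>v v"
    using V_carrier[OF v] by (intro eq_vecI) (auto simp: M_def matrix_of_def scalar_prod_def lessThan_atLeast0)
  finally show ?thesis .
qed

lemma inv_\<phi>_V: "v \<in> V \<Longrightarrow> inv_into V \<phi> v \<in> V"
  using bij by (metis bij_betw_imp_surj_on inv_into_into)

lemma \<phi>_inv: "v \<in> V \<Longrightarrow> \<phi> (inv_into V \<phi> v) = v"
  using bij by (rule bij_betw_inv_into_right)

lemma \<Phi>_0 [simp]: "\<Phi> 0 v = v" by (simp add: \<Phi>_def int_funpow_def)

lemma \<Phi>_V: "v \<in> V \<Longrightarrow> \<Phi> m v \<in> V"
proof -
  assume v: "v \<in> V"
  have "(\<phi> ^^ n) v \<in> V" "(inv_into V \<phi> ^^ n) v \<in> V" for n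
    by (induction n) (auto simp: v \<phi>_V inv_\<phi>_V)
  then show ?thesis by (simp add: \<Phi>_def int_funpow_def)
qed

lemma \<Phi>_Suc:
  assumes v: "v \<in> V"
  shows "\<Phi> (m + 1) v = \<phi> (\<Phi> m v)"
proof (cases "0 \<le> m")
  case True
  then show ?thesis by (simp add: \<Phi>_def int_funpow_def nat_add_distrib)
next
  case False
  define n where "n = nat (- m - 1)"
  have m: "m = - int (Suc n)" using False by (simp add: n_def)
  have "\<Phi> m v = inv_into V \<phi> ((inv_into V \<phi> ^^ n) v)" by (simp add: \<Phi>_def int_funpow_def m del: of_nat_Suc)
  moreover have "\<Phi> (m + 1) v = (inv_into V \<phi> ^^ n) v"
    by (cases n) (simp_all add: \<Phi>_def int_funpow_def m nat_add_distrib)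
  ultimately show ?thesis using \<Phi>_V[OF v, of "m + 1"] by (simp add: \<phi>_inv)
qed

lemma \<phi>_inject: "v \<in> V \<Longrightarrow> w \<in> V \<Longrightarrow> \<phi> v = \<phi> w \<Longrightarrow> v = w"
  using bij by (meson bij_betw_imp_inj_on inj_onD)

text \<open>Negative powers are iterates of the inverse, so the downward step applies \<phi> to both
  sides and cancels it by injectivity.\<close>

lemma \<Phi>_add_int:
  assumes v: "v \<in> V"
  shows "\<Phi> (m + n) v = \<Phi> m (\<Phi> n v)"
proof (induction m rule: int_induct[where k = 0])
  case (step1 i)
  then show ?case using \<Phi>_Suc[OF v, of "i + n"] \<Phi>_Suc[OF \<Phi>_V[OF v], of i n] by (simp add: algebra_simps)
next
  case (step2 i)
  have "\<phi> (\<Phi> (i - 1 + n) v) = \<phi> (\<Phi> (i - 1) (\<Phi> n v))"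
    using step2 \<Phi>_Suc[OF v, of "i - 1 + n"] \<Phi>_Suc[OF \<Phi>_V[OF v], of "i - 1" n] by simp
  then show ?case by (rule \<phi>_inject[rotated 2]) (intro \<Phi>_V v)+
qed simp

lemma \<Phi>_1: "v \<in> V \<Longrightarrow> \<Phi> 1 v = \<phi> v"
  using \<Phi>_Suc[of v 0] by simp

lemma \<Phi>_add:
  assumes "v \<in> V" "w \<in> V"
  shows "\<Phi> m (v + w) = \<Phi> m v + \<Phi> m w"
proof (induction m rule: int_induct[where k = 0])
  case (step1 i)
  then show ?case by (simp add: \<Phi>_Suc assms V_add \<phi>_add \<Phi>_V)
next
  case (step2 i)
  have "\<phi> (\<Phi> (i - 1) (v + w)) = \<phi> (\<Phi> (i - 1) v + \<Phi> (i - 1) w)"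
    using step2 \<Phi>_Suc[OF V_add[OF assms], of "i - 1"] \<Phi>_Suc[OF assms(1), of "i - 1"] \<Phi>_Suc[OF assms(2), of "i - 1"]
    by (simp add: \<phi>_add \<Phi>_V assms)
  then show ?case by (rule \<phi>_inject[rotated 2]) (intro \<Phi>_V V_add assms)+
qed simp

lemma \<Phi>_zero: "\<Phi> m (0\<^sub>v d) = 0\<^sub>v d"
proof (induction m rule: int_induct[where k = 0])
  case (step1 i)
  then show ?case by (simp add: \<Phi>_Suc V_zero \<phi>_zero)
next
  case (step2 i)
  have "\<phi> (\<Phi> (i - 1) (0\<^sub>v d)) = \<phi> (0\<^sub>v d)"
    using step2 \<Phi>_Suc[OF V_zero, of "i - 1"] by (simp add: \<phi>_zero)
  then show ?case by (rule \<phi>_inject[rotated 2]) (intro \<Phi>_V V_zero)+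
qed simp

lemma carrier_G: "carrier G = V \<times> UNIV"
  and mult_G: "(v, m) \<otimes>\<^bsub>G\<^esub> (w, n) = (v + \<Phi> m w, m + n)"
  and one_G: "\<one>\<^bsub>G\<^esub> = (0\<^sub>v d, 0)"
  by (simp_all add: G_def semidirect_Z_def V_def \<Phi>_def)

lemma uminus_add: "v \<in> V \<Longrightarrow> - v + v = 0\<^sub>v d"
  by (rule uminus_l_inv_vec[OF V_carrier])

lemma group_G: "group G"
proof (rule groupI)
  fix x y z
  assume "x \<in> carrier G" "y \<in> carrier G" "z \<in> carrier G"
  then obtain u l v m w n where xyz: "x = (u, l)" "y = (v, m)" "z = (w, n)" "u \<in> V" "v \<in> V" "w \<in> V"
    by (auto simp: carrier_G)
  then show "x \<otimes>\<^bsub>G\<^esub> y \<otimes>\<^bsub>G\<^esub> z = x \<otimes>\<^bsub>G\<^esub> (y \<otimes>\<^bsub>G\<^esub> z)"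
    by (simp add: mult_G \<Phi>_add \<Phi>_add_int \<Phi>_V add.assoc)
      (intro assoc_add_vec[of _ d] V_carrier \<Phi>_V, auto)
next
  fix x
  assume "x \<in> carrier G"
  then obtain v m where x: "x = (v, m)" "v \<in> V" by (auto simp: carrier_G)
  then have "(\<Phi> (- m) (- v), - m) \<otimes>\<^bsub>G\<^esub> x = \<one>\<^bsub>G\<^esub>"
    by (simp add: mult_G one_G \<Phi>_add[symmetric] V_uminus uminus_add \<Phi>_zero)
  then show "\<exists>y\<in>carrier G. y \<otimes>\<^bsub>G\<^esub> x = \<one>\<^bsub>G\<^esub>"
    using x by (intro bexI[of _ "(\<Phi> (- m) (- v), - m)"]) (auto simp: carrier_G \<Phi>_V V_uminus)
  show "\<one>\<^bsub>G\<^esub> \<otimes>\<^bsub>G\<^esub> x = x" using V_carrier[OF x(2)] by (simp add: mult_G one_G x)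
qed (auto simp: carrier_G mult_G one_G V_add \<Phi>_V V_zero)

end

text \<open>A telescoping sum: exponents are reduced modulo N at the price of a multiple of t^N -
  1.\<close>

lemma monom_mod_decomposition:
  "monom (1 :: int) s = monom 1 (s mod N) + (\<Sum>j<s div N. monom 1 (s mod N + N * j)) * (monom 1 N - 1)"
proof -
  have "(\<Sum>j<k. monom (1 :: int) (r + N * j)) * (monom 1 N - 1) = monom 1 (r + N * k) - monom 1 r" for r k
  proof (induction k)
    case (Suc k)
    then show ?case by (simp add: distrib_right right_diff_distrib mult_monom algebra_simps)
  qed simp
  from this[of "s mod N" "s div N"] show ?thesis by simp
qed

text \<open>Distinct j give distinct exponents r + N j.\<close>

lemma coeff_arithmetic_progression:
  assumes "0 < N"
  shows "\<bar>coeff (\<Sum>j<k. monom (1 :: int) (r + N * j)) i\<bar> \<le> 1"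
proof -
  have "coeff (\<Sum>j<k. monom (1 :: int) (r + N * j)) i = (\<Sum>j<k. if r + N * j = i then 1 else 0)"
    by (simp add: coeff_sum coeff_monom)
  also have "\<dots> = int (card {j. j < k \<and> r + N * j = i})"
    by (subst sum.inter_filter[symmetric]) (auto intro!: arg_cong[of _ _ card])
  finally have "coeff (\<Sum>j<k. monom (1 :: int) (r + N * j)) i = int (card {j. j < k \<and> r + N * j = i})" .
  moreover have "{j. j < k \<and> r + N * j = i} \<subseteq> {(i - r) div N}" using assms by auto
  then have "card {j. j < k \<and> r + N * j = i} \<le> 1" by (metis card_mono finite.emptyI finite.insertI is_singletonI is_singleton_altdef)
  ultimately show ?thesis by simp
qed

section \<open>Word lengths of vectors\<close>

locale semidirect_generated = semidirect +
  fixes S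
  assumes S: "finite_sym_generating_set G S"
begin

sublocale G: group G by (rule group_G)

definition wl :: "complex vec \<times> int \<Rightarrow> real" where "wl g = real (word_length G S g)"

definition len :: "complex vec \<Rightarrow> real" where "len v = wl (v, 0)"

text \<open>The cost of conjugating by (0, 1) or (0, -1), that is, of applying \<phi> or its
  inverse. These two elements need not lie in S.\<close>

definition \<tau> where "\<tau> = wl (0\<^sub>v d, 1) + wl (0\<^sub>v d, - 1)"

lemma wl_nonneg: "0 \<le> wl g" by (simp add: wl_def)

lemma len_nonneg: "0 \<le> len v" by (simp add: len_def wl_nonneg)

lemma \<tau>_nonneg: "0 \<le> \<tau>" by (simp add: \<tau>_def wl_nonneg)

lemma wl_mult: "g \<in> carrier G \<Longrightarrow> h \<in> carrier G \<Longrightarrow> wl (g \<otimes>\<^bsub>G\<^esub> h) \<le> wl g + wl h"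
  using G.word_length_mult[OF S, of g h] by (simp add: wl_def)

lemma len_zero: "len (0\<^sub>v d) = 0"
  using G.word_length_one[OF S] by (simp add: len_def wl_def one_G)

lemma V_add_zero: "v \<in> V \<Longrightarrow> v + 0\<^sub>v d = v" "v \<in> V \<Longrightarrow> 0\<^sub>v d + v = v"
  using V_carrier by auto

lemma len_add:
  assumes "v \<in> V" "w \<in> V"
  shows "len (v + w) \<le> len v + len w"
  using wl_mult[of "(v, 0)" "(w, 0)"] assms by (simp add: len_def carrier_G mult_G)

text \<open>Conjugation realizes the action: (0, m) (v, 0) (0, -m) = (\<Phi> m v, 0).\<close>

lemma len_\<Phi>_unit:
  assumes v: "v \<in> V" and m: "m = 1 \<or> m = - 1"
  shows "len (\<Phi> m v) \<le> len v + \<tau>"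
proof -
  have "(0\<^sub>v d, m) \<otimes>\<^bsub>G\<^esub> (v, 0) = (\<Phi> m v, m)"
    using V_add_zero(2)[OF \<Phi>_V[OF v]] by (simp add: mult_G)
  then have "(0\<^sub>v d, m) \<otimes>\<^bsub>G\<^esub> (v, 0) \<otimes>\<^bsub>G\<^esub> (0\<^sub>v d, - m) = (\<Phi> m v, 0)"
    using V_add_zero(1)[OF \<Phi>_V[OF v]] by (simp add: mult_G \<Phi>_zero)
  then have "len (\<Phi> m v) \<le> wl ((0\<^sub>v d, m) \<otimes>\<^bsub>G\<^esub> (v, 0)) + wl (0\<^sub>v d, - m)"
    using wl_mult[of "(0\<^sub>v d, m) \<otimes>\<^bsub>G\<^esub> (v, 0)" "(0\<^sub>v d, - m)"] v
    by (simp add: len_def carrier_G V_zero mult_G V_add_zero \<Phi>_V)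
  also have "\<dots> \<le> wl (0\<^sub>v d, m) + wl (v, 0) + wl (0\<^sub>v d, - m)"
    using wl_mult[of "(0\<^sub>v d, m)" "(v, 0)"] v by (simp add: carrier_G V_zero)
  also have "\<dots> = len v + \<tau>" using m by (auto simp: len_def \<tau>_def)
  finally show ?thesis .
qed

lemma len_\<Phi>:
  assumes v: "v \<in> V"
  shows "len (\<Phi> m v) \<le> len v + \<bar>real_of_int m\<bar> * \<tau>"
proof (induction m rule: int_induct[where k = 0])
  case (step1 i)
  have "len (\<Phi> (i + 1) v) \<le> len (\<Phi> i v) + \<tau>"
    using len_\<Phi>_unit[OF \<Phi>_V[OF v], of 1 i] by (simp add: \<Phi>_add_int[OF v, symmetric] add.commute)
  then show ?case using step1 by (simp add: algebra_simps)
next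
  case (step2 i)
  have "len (\<Phi> (i - 1) v) \<le> len (\<Phi> i v) + \<tau>"
    using len_\<Phi>_unit[OF \<Phi>_V[OF v], of "- 1" i] by (simp add: \<Phi>_add_int[OF v, symmetric])
  then show ?case using step2 by (simp add: algebra_simps)
qed simp

lemma len_\<phi>: "v \<in> V \<Longrightarrow> len (\<phi> v) \<le> len v + \<tau>"
  using len_\<Phi>_unit[of v 1] by (simp add: \<Phi>_1)

lemma wl_height: "wl (0\<^sub>v d, m) \<le> \<bar>real_of_int m\<bar> * \<tau>"
proof (induction m rule: int_induct[where k = 0])
  case base
  then show ?case using len_zero by (simp add: len_def)
next
  case (step1 i)
  have "wl (0\<^sub>v d, i + 1) \<le> wl (0\<^sub>v d, i) + wl (0\<^sub>v d, 1)"
    using wl_mult[of "(0\<^sub>v d, i)" "(0\<^sub>v d, 1)"] by (simp add: carrier_G V_zero mult_G \<Phi>_zero)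
  also have "\<dots> \<le> wl (0\<^sub>v d, i) + \<tau>" by (simp add: \<tau>_def wl_nonneg)
  finally show ?case using step1 by (simp add: algebra_simps)
next
  case (step2 i)
  have "wl (0\<^sub>v d, i - 1) \<le> wl (0\<^sub>v d, i) + wl (0\<^sub>v d, - 1)"
    using wl_mult[of "(0\<^sub>v d, i)" "(0\<^sub>v d, - 1)"] by (simp add: carrier_G V_zero mult_G \<Phi>_zero)
  also have "\<dots> \<le> wl (0\<^sub>v d, i) + \<tau>" by (simp add: \<tau>_def wl_nonneg)
  finally show ?case using step2 by (simp add: algebra_simps)
qed

lemma wl_le:
  assumes "v \<in> V"
  shows "wl (v, m) \<le> len v + \<bar>real_of_int m\<bar> * \<tau>"
  using wl_mult[of "(v, 0)" "(0\<^sub>v d, m)"] wl_height[of m] assms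
  by (simp add: carrier_G V_zero mult_G V_add_zero len_def)

lemma V_smult_int: "v \<in> V \<Longrightarrow> of_int a \<cdot>\<^sub>v v \<in> V"
  by (intro V_smult int_adjoin_of_int)

lemma len_smult_nat:
  assumes v: "v \<in> V"
  shows "len (of_nat n \<cdot>\<^sub>v v) \<le> real n * len v"
proof (induction n)
  case 0
  have "0 \<cdot>\<^sub>v v = 0\<^sub>v d" using V_carrier[OF v] by (intro eq_vecI) auto
  then show ?case by (simp add: len_zero)
next
  case (Suc n)
  have "of_nat (Suc n) \<cdot>\<^sub>v v = of_nat n \<cdot>\<^sub>v v + v"
    using V_carrier[OF v] by (intro eq_vecI) (auto simp: algebra_simps)
  then show ?case
    using Suc len_add[OF V_smult_int[OF v, of "int n"] v] by (simp add: distrib_right)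
qed

text \<open>Adding the lengths for both signs gives one constant for positive and negative
  multiples.\<close>

definition \<kappa> where "\<kappa> v = len v + len (- v)"

lemma \<kappa>_nonneg: "0 \<le> \<kappa> v" by (simp add: \<kappa>_def len_nonneg)

lemma len_smult:
  assumes v: "v \<in> V"
  shows "len (of_int a \<cdot>\<^sub>v v) \<le> \<kappa> v * \<bar>real_of_int a\<bar>"
proof (cases "0 \<le> a")
  case True
  then have "len (of_int a \<cdot>\<^sub>v v) \<le> \<bar>real_of_int a\<bar> * len v"
    using len_smult_nat[OF v, of "nat a"] by simp
  also have "\<dots> \<le> \<bar>real_of_int a\<bar> * \<kappa> v" by (intro mult_left_mono) (simp_all add: \<kappa>_def len_nonneg)
  finally show ?thesis by (simp add: mult.commute)
next
  case False
  have "of_int a \<cdot>\<^sub>v v = of_nat (nat (- a)) \<cdot>\<^sub>v (- v)"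
    using V_carrier[OF v] False by (intro eq_vecI) auto
  then have "len (of_int a \<cdot>\<^sub>v v) \<le> \<bar>real_of_int a\<bar> * len (- v)"
    using len_smult_nat[OF V_uminus[OF v], of "nat (- a)"] False by simp
  also have "\<dots> \<le> \<bar>real_of_int a\<bar> * \<kappa> v" by (intro mult_left_mono) (simp_all add: \<kappa>_def len_nonneg)
  finally show ?thesis by (simp add: mult.commute)
qed

text \<open>For v in V this is P(\<phi>) v. It is written with the matrix so that the results on
  \<open>poly_act\<close> apply.\<close>

definition act :: "int poly \<Rightarrow> complex vec \<Rightarrow> complex vec" where
  "act P v = poly_act M (of_int_poly P) v"

lemma act_0: "v \<in> V \<Longrightarrow> act 0 v = 0\<^sub>v d"
  using carrier_vecD[OF V_carrier] by (simp add: act_def)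

text \<open>The matrix is known to agree with \<phi> on V, so the recursion and the membership in V
  are proved together.\<close>

lemma act_pCons_and_V:
  assumes v: "v \<in> V"
  shows "act (pCons a P) v = of_int a \<cdot>\<^sub>v v + \<phi> (act P v) \<and> act P v \<in> V"
proof (induction P arbitrary: a)
  case 0
  have "M *\<^sub>v 0\<^sub>v d = 0\<^sub>v d" using M_carrier by (intro eq_vecI) auto
  then show ?case
    using V_carrier[OF v]
    by (simp add: act_def hom_distribs poly_act_pCons[OF M_carrier] \<phi>_zero V_zero)
next
  case (pCons b P)
  then have P: "act (pCons b P) v = of_int b \<cdot>\<^sub>v v + \<phi> (act P v)" "act P v \<in> V" by blast+
  then have in_V: "act (pCons b P) v \<in> V" by (simp add: V_add V_smult_int v \<phi>_V)
  have "act (pCons a (pCons b P)) v = of_int a \<cdot>\<^sub>v v + M *\<^sub>v act (pCons b P) v"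
    unfolding act_def of_int_hom.map_poly_pCons_hom poly_act_pCons[OF M_carrier V_carrier[OF v]] ..
  then show ?case using in_V by (simp add: \<phi>_eq_matrix)
qed

lemmas act_pCons = act_pCons_and_V[THEN conjunct1]
  and act_V = act_pCons_and_V[THEN conjunct2]

lemma act_diff: "v \<in> V \<Longrightarrow> act (P - Q) v = act P v - act Q v"
  by (simp add: act_def hom_distribs poly_act_minus[OF M_carrier V_carrier])

lemma act_add: "v \<in> V \<Longrightarrow> act (P + Q) v = act P v + act Q v"
  by (simp add: act_def hom_distribs poly_act_add[OF M_carrier V_carrier])

lemma act_mult: "v \<in> V \<Longrightarrow> act (P * Q) v = act P (act Q v)"
  by (simp add: act_def hom_distribs poly_act_mult[OF M_carrier V_carrier])

lemma act_zero_vec: "act P (0\<^sub>v d) = 0\<^sub>v d"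
  by (simp add: act_def poly_act_zero_vec[OF M_carrier])

lemma act_monom:
  assumes v: "v \<in> V"
  shows "act (monom a s) v = of_int a \<cdot>\<^sub>v \<Phi> (int s) v"
proof (induction s)
  case 0
  have "v + 0\<^sub>v d = v" using V_add_zero(1)[OF v] .
  then show ?case
    using v V_add_zero(1)[OF V_smult_int[OF v]] by (simp add: monom_0 act_pCons act_0 \<phi>_zero)
next
  case (Suc s)
  have "0 \<cdot>\<^sub>v v = 0\<^sub>v d" using V_carrier[OF v] by (intro eq_vecI) auto
  then have "act (monom a (Suc s)) v = 0\<^sub>v d + \<phi> (of_int a \<cdot>\<^sub>v \<Phi> (int s) v)"
    using Suc v by (simp add: monom_Suc act_pCons)
  also have "\<dots> = \<phi> (of_int a \<cdot>\<^sub>v \<Phi> (int s) v)"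
    by (intro V_add_zero \<phi>_V V_smult_int \<Phi>_V v)
  also have "\<dots> = of_int a \<cdot>\<^sub>v \<Phi> (int s + 1) v"
    by (simp add: \<phi>_smult int_adjoin_of_int \<Phi>_V \<Phi>_Suc v)
  finally show ?case by (simp add: add.commute)
qed

text \<open>Horner's scheme: a coefficient a costs \<kappa> v |a|, and each application of \<phi>
  costs \<tau>.\<close>

lemma len_act:
  assumes v: "v \<in> V" and "\<And>i. n \<le> i \<Longrightarrow> coeff P i = 0"
  shows "len (act P v) \<le> (\<Sum>i<n. \<kappa> v * \<bar>real_of_int (coeff P i)\<bar> + \<tau>)"
  using assms(2)
proof (induction n arbitrary: P)
  case 0
  then have "P = 0" by (simp add: poly_eq_iff)
  then show ?case by (simp add: act_0 v len_zero)
next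
  case (Suc n)
  obtain a p where P: "P = pCons a p" by (cases P)
  have "coeff p i = 0" if "n \<le> i" for i using Suc.prems[of "Suc i"] that by (simp add: P)
  then have IH: "len (act p v) \<le> (\<Sum>i<n. \<kappa> v * \<bar>real_of_int (coeff p i)\<bar> + \<tau>)" by (rule Suc.IH)
  have "len (act P v) \<le> len (of_int a \<cdot>\<^sub>v v) + len (\<phi> (act p v))"
    unfolding P act_pCons[OF v] by (intro len_add V_smult_int \<phi>_V act_V v)
  also have "\<dots> \<le> \<kappa> v * \<bar>real_of_int a\<bar> + (len (act p v) + \<tau>)"
    by (intro add_mono len_smult len_\<phi> act_V v)
  finally show ?case using IH unfolding sum.lessThan_Suc_shift by (simp add: P)
qed

text \<open>Since q(\<phi>) kills u, subtracting multiples of q does not change the vector, so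
  \<open>length_log_bound\<close> applies. Its linear bound comes from Horner's scheme, with K =
  \<kappa> u + \<tau>.\<close>

lemma len_log_bound:
  assumes u: "u \<in> V" and q: "act q u = 0\<^sub>v d"
    and dominant: "(\<Sum>i\<in>{..degree q} - {m}. \<bar>coeff q i\<bar>) < \<bar>coeff q m\<bar>"
  obtains C where "0 \<le> C"
    "\<And>R P n. (\<And>i. \<bar>coeff P i\<bar> \<le> int n) \<Longrightarrow>
      len (\<Phi> (- int R) (act P u)) \<le> C * (real R + real (degree P) + ln (real n + 2) + 1)"
proof (rule length_log_bound[where L = "\<lambda>R P. len (\<Phi> (- int R) (act P u))" and q = q and m = m and K = "\<kappa> u + \<tau>"])
  fix R P
  have "0 \<cdot>\<^sub>v u + \<phi> (act P u) = \<phi> (act P u)"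
  proof -
    have "0 \<cdot>\<^sub>v u = 0\<^sub>v d" using V_carrier[OF u] by (intro eq_vecI) auto
    then show ?thesis using V_add_zero(2)[OF \<phi>_V[OF act_V[OF u]]] by simp
  qed
  then have "\<Phi> (- int (Suc R)) (act (pCons 0 P) u) = \<Phi> (- int (Suc R)) (\<Phi> 1 (act P u))"
    using u by (simp add: act_pCons \<Phi>_1 act_V)
  also have "\<dots> = \<Phi> (- int R) (act P u)"
    by (simp add: \<Phi>_add_int[OF act_V[OF u], symmetric])
  finally show "len (\<Phi> (- int (Suc R)) (act (pCons 0 P) u)) = len (\<Phi> (- int R) (act P u))" by simp
next
  fix R P F
  have "act (P - F * q) u = act P u - 0\<^sub>v d"
    using u q by (simp add: act_diff act_mult act_zero_vec)
  also have "\<dots> = act P u" using V_carrier[OF act_V[OF u]] by auto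
  finally show "len (\<Phi> (- int R) (act (P - F * q) u)) = len (\<Phi> (- int R) (act P u))" by simp
next
  fix R :: nat and P and B :: real
  assume P: "\<And>i. \<bar>real_of_int (coeff P i)\<bar> \<le> B"
  then have B: "0 \<le> B" by (meson abs_ge_zero order_trans)
  have "len (\<Phi> (- int R) (act P u)) \<le> len (act P u) + real R * \<tau>"
    using len_\<Phi>[OF act_V[OF u], of "- int R" P] by simp
  also have "len (act P u) \<le> (\<Sum>i<Suc (degree P). \<kappa> u * \<bar>real_of_int (coeff P i)\<bar> + \<tau>)"
    by (rule len_act[OF u]) (simp add: coeff_eq_0)
  also have "\<dots> \<le> (\<Sum>i<Suc (degree P). \<kappa> u * B + \<tau>)"
    by (intro sum_mono add_mono mult_left_mono P \<kappa>_nonneg order_refl)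
  also have "\<dots> + real R * \<tau> = (real (degree P) + 1) * (\<kappa> u * B + \<tau>) + real R * \<tau>" by simp
  also have "\<dots> \<le> (real (degree P) + 1) * ((\<kappa> u + \<tau>) * (B + 1)) + real R * ((\<kappa> u + \<tau>) * (B + 1))"
  proof (intro add_mono mult_left_mono)
    have "0 \<le> \<tau> * B" "0 \<le> \<kappa> u * B" using B \<tau>_nonneg \<kappa>_nonneg by simp_all
    then show "\<kappa> u * B + \<tau> \<le> (\<kappa> u + \<tau>) * (B + 1)" "\<tau> \<le> (\<kappa> u + \<tau>) * (B + 1)"
      using \<kappa>_nonneg[of u] \<tau>_nonneg by (simp_all add: algebra_simps)
  qed simp_all
  also have "\<dots> = (\<kappa> u + \<tau>) * (real R + real (degree P) + 1) * (B + 1)" by (simp add: algebra_simps)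
  finally show "len (\<Phi> (- int R) (act P u)) \<le> (\<kappa> u + \<tau>) * (real R + real (degree P) + 1) * (B + 1)"
    by simp
next
  show "0 \<le> \<kappa> u + \<tau>" by (simp add: \<kappa>_nonneg \<tau>_nonneg)
qed (use dominant that in blast)+

end

section \<open>Splitting the displacement by residues modulo N\<close>

context semidirect_generated
begin

text \<open>Reducing exponents modulo \<open>N\<close> splits the displacement into residue classes plus a vector
  in the image of \<open>\<phi>\<^sup>N - 1\<close>, on which \<open>q(\<phi>)\<close> vanishes.\<close>

lemma len_exponent_sum:
  assumes b: "b \<in> V" and N: "0 < N"
    and q: "act (pCons 0 (q * (monom 1 N - 1))) b = 0\<^sub>v d"
    and dominant: "(\<Sum>i\<in>{..degree q} - {m}. \<bar>coeff q i\<bar>) < \<bar>coeff q m\<bar>"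
  obtains K where "0 \<le> K"
    "\<And>n r (e :: nat \<Rightarrow> int) (s :: nat \<Rightarrow> int).
      (\<And>k. k < n \<Longrightarrow> \<bar>e k\<bar> \<le> 1) \<Longrightarrow> (\<And>k. k < n \<Longrightarrow> \<bar>s k\<bar> \<le> int r) \<Longrightarrow>
      len (\<Phi> (- int (N * r)) (act (\<Sum>k<n. monom (e k) (nat (s k + int (N * r)))) b))
        \<le> K * (1 + ln (real n + 2) + real r
             + (\<Sum>i<N. \<bar>real_of_int (\<Sum>k<n. if s k mod int N = int i then e k else 0)\<bar>))"
proof -
  define u where "u = act (monom 1 N - 1) b"
  have u: "u \<in> V" unfolding u_def by (rule act_V[OF b])
  have "act q u \<in> V" by (rule act_V[OF u])
  have "0 \<cdot>\<^sub>v b = 0\<^sub>v d" using V_carrier[OF b] by (intro eq_vecI) auto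
  \<comment> \<open>The additional factor t of the annihilating polynomial appears as one
    application of \<phi>, which is then cancelled.\<close>
  then have "\<phi> (act q u) = 0\<^sub>v d"
    using q V_add_zero(2)[OF \<phi>_V[OF act_V[OF u, of q]]] b by (simp add: act_pCons u_def act_mult)
  then have qu: "act q u = 0\<^sub>v d"
    by (intro \<phi>_inject[OF \<open>act q u \<in> V\<close> V_zero]) (simp add: \<phi>_zero)
  obtain C where C: "0 \<le> C" and bound: "\<And>R P n. (\<And>i. \<bar>coeff P i\<bar> \<le> int n) \<Longrightarrow>
      len (\<Phi> (- int R) (act P u)) \<le> C * (real R + real (degree P) + ln (real n + 2) + 1)"
    by (rule len_log_bound[OF u qu dominant]) (rule that, assumption, blast)
  \<comment> \<open>Generous multiples of the three costs, so that the final difference is visibly a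
    sum of nonnegative terms.\<close>
  define K where "K = 2 * (real N * \<tau>) + \<kappa> b + 3 * (real N * C)"
  have parts: "0 \<le> real N * \<tau>" "0 \<le> \<kappa> b" "0 \<le> real N * C"
    using \<tau>_nonneg \<kappa>_nonneg C by simp_all
  have "len (\<Phi> (- int (N * r)) (act (\<Sum>k<n. monom (e k) (nat (s k + int (N * r)))) b))
        \<le> K * (1 + ln (real n + 2) + real r
             + (\<Sum>i<N. \<bar>real_of_int (\<Sum>k<n. if s k mod int N = int i then e k else 0)\<bar>))"
    if e: "\<And>k. k < n \<Longrightarrow> \<bar>e k\<bar> \<le> 1" and s: "\<And>k. k < n \<Longrightarrow> \<bar>s k\<bar> \<le> int r"
    for n r and e s :: "nat \<Rightarrow> int"
  proof -
    \<comment> \<open>The shift by N r makes every exponent nonnegative and, being a multiple of N,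
      keeps the residue of s k.\<close>
    define t where "t k = nat (s k + int (N * r))" for k
    define g where "g k = (\<Sum>j<t k div N. monom (1 :: int) (t k mod N + N * j))" for k
    define W where "W = (\<Sum>k<n. monom (e k) (t k mod N))"
    define E where "E = (\<Sum>k<n. Polynomial.smult (e k) (g k))"
    have rN: "r \<le> N * r" using N by simp
    have t_int: "int (t k) = s k + int (N * r)" if "k < n" for k
      using s[OF that] rN unfolding t_def by linarith
    have t_le: "t k \<le> 2 * (N * r)" if "k < n" for k
      using t_int[OF that] s[OF that] rN by linarith
    have t_mod: "int (t k mod N) = s k mod int N" if "k < n" for k
      using t_int[OF that] by (simp add: zmod_int)
    have "monom (e k) (t k) = monom (e k) (t k mod N) + Polynomial.smult (e k) (g k) * (monom 1 N - 1)" for k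
      using arg_cong[OF monom_mod_decomposition[of "t k" N], of "Polynomial.smult (e k)"]
      by (simp add: smult_add_right smult_monom g_def)
    then have Q: "(\<Sum>k<n. monom (e k) (t k)) = W + E * (monom 1 N - 1)"
      unfolding W_def E_def by (simp add: sum.distrib sum_distrib_right)
    have coeff_W: "coeff W i = (\<Sum>k<n. if s k mod int N = int i then e k else 0)" for i
    proof -
      have "t k mod N = i \<longleftrightarrow> s k mod int N = int i" if "k < n" for k
        using t_mod[OF that] by (metis of_nat_eq_iff)
      then show ?thesis unfolding W_def coeff_sum coeff_monom by (intro sum.cong) auto
    qed
    have coeff_W_0: "coeff W i = 0" if "N \<le> i" for i
      unfolding W_def coeff_sum using that N by (intro sum.neutral) (auto simp: coeff_monom not_less[symmetric])
    \<comment> \<open>This crude bound is the source of the term ln (n + 2).\<close>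
    have coeff_E: "\<bar>coeff E i\<bar> \<le> int n" for i
    proof -
      have "\<bar>coeff E i\<bar> \<le> (\<Sum>k<n. \<bar>e k * coeff (g k) i\<bar>)"
        unfolding E_def by (simp add: coeff_sum)
      also have "\<dots> \<le> (\<Sum>k<n. 1)"
      proof (rule sum_mono)
        fix k
        assume "k \<in> {..<n}"
        then show "\<bar>e k * coeff (g k) i\<bar> \<le> 1"
          using mult_mono[OF e[of k] coeff_arithmetic_progression[OF N, of "t k mod N" "t k div N" i]]
          by (simp add: abs_mult g_def)
      qed
      finally show ?thesis by simp
    qed
    have deg_E: "degree E \<le> 2 * (N * r)"
    proof (rule degree_le, intro allI impI)
      fix i
      assume i: "2 * (N * r) < i"
      have "coeff (g k) i = 0" if k: "k < n" for k
      proof -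
        have "t k mod N + N * j \<noteq> i" if j: "j < t k div N" for j
        proof -
          have "N * j \<le> N * (t k div N)" using j by (intro mult_le_mono) auto
          then have "t k mod N + N * j \<le> t k" using mult_div_mod_eq[of N "t k"] by linarith
          then show ?thesis using t_le[OF k] i by linarith
        qed
        then show ?thesis unfolding g_def coeff_sum by (intro sum.neutral) (auto simp: coeff_monom)
      qed
      then show "coeff E i = 0" by (simp add: E_def coeff_sum)
    qed
    let ?R = "- int (N * r)" and ?S = "\<Sum>i<N. \<bar>real_of_int (\<Sum>k<n. if s k mod int N = int i then e k else 0)\<bar>"
      and ?l = "ln (real n + 2)"
    have "act (\<Sum>k<n. monom (e k) (t k)) b = act W b + act E u"
      unfolding Q by (simp add: act_add act_mult b u_def)
    then have "\<Phi> ?R (act (\<Sum>k<n. monom (e k) (t k)) b) = \<Phi> ?R (act W b) + \<Phi> ?R (act E u)"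
      by (simp add: \<Phi>_add act_V b u)
    then have "len (\<Phi> ?R (act (\<Sum>k<n. monom (e k) (t k)) b)) \<le> len (\<Phi> ?R (act W b)) + len (\<Phi> ?R (act E u))"
      by (simp add: len_add \<Phi>_V act_V b u)
    moreover have "len (\<Phi> ?R (act W b)) \<le> real N * \<tau> * real r + (\<kappa> b * ?S + real N * \<tau>)"
    proof -
      have "len (act W b) \<le> (\<Sum>i<N. \<kappa> b * \<bar>real_of_int (coeff W i)\<bar> + \<tau>)"
        by (rule len_act[OF b coeff_W_0])
      also have "\<dots> = \<kappa> b * ?S + real N * \<tau>"
        by (simp only: coeff_W sum.distrib sum_distrib_left sum_constant card_lessThan)
      finally show ?thesis
        using len_\<Phi>[OF act_V[OF b], of ?R W] by (simp add: mult_ac)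
    qed
    moreover have "len (\<Phi> ?R (act E u)) \<le> C * (3 * (real N * real r) + ?l + 1)"
    proof -
      have "len (\<Phi> ?R (act E u)) \<le> C * (real (N * r) + real (degree E) + ?l + 1)"
        by (rule bound[OF coeff_E])
      also have "\<dots> \<le> C * (3 * (real N * real r) + ?l + 1)"
      proof (rule mult_left_mono[OF _ C])
        have "real (degree E) \<le> real (2 * (N * r))" using deg_E by (rule of_nat_mono)
        then show "real (N * r) + real (degree E) + ?l + 1 \<le> 3 * (real N * real r) + ?l + 1" by simp
      qed
      finally show ?thesis .
    qed
    moreover have "real N * \<tau> * real r + (\<kappa> b * ?S + real N * \<tau>) + C * (3 * (real N * real r) + ?l + 1)
        \<le> K * (1 + ?l + real r + ?S)"
    proof -
      have S: "0 \<le> ?S" by (rule sum_nonneg) simp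
      have l: "0 \<le> ?l" by simp
      have CN: "C \<le> real N * C" using mult_right_mono[of 1 "real N" C] N C by simp
      have "K * (1 + ?l + real r + ?S) - (real N * \<tau> * real r + (\<kappa> b * ?S + real N * \<tau>) + C * (3 * (real N * real r) + ?l + 1))
         = real N * \<tau> * (1 + real r) + 2 * (real N * \<tau>) * (?l + ?S) + \<kappa> b * (1 + ?l + real r)
           + 3 * (real N * C) * ?S + (3 * (real N * C) - C) * (1 + ?l)"
        unfolding K_def by (simp add: algebra_simps)
      also have "\<dots> \<ge> 0"
        using parts S l CN \<tau>_nonneg C by (intro add_nonneg_nonneg mult_nonneg_nonneg) auto
      finally show ?thesis by simp
    qed
    ultimately show ?thesis unfolding t_def by linarith
  qed
  moreover have "0 \<le> K" using parts by (simp add: K_def)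
  ultimately show thesis using that by blast
qed

text \<open>The type \<open>complex vec\<close> contains vectors of all dimensions and has no common
  zero, so finite sums are folded over a list starting from \<open>0\<^sub>v d\<close>.\<close>

definition vsum :: "('b \<Rightarrow> complex vec) \<Rightarrow> 'b list \<Rightarrow> complex vec" where
  "vsum f bs = foldr (\<lambda>b acc. f b + acc) bs (0\<^sub>v d)"

lemma vsum_simps [simp]: "vsum f [] = 0\<^sub>v d" "vsum f (b # bs) = f b + vsum f bs"
  by (simp_all add: vsum_def)

lemma vsum_V: "(\<And>b. b \<in> set bs \<Longrightarrow> f b \<in> V) \<Longrightarrow> vsum f bs \<in> V"
  by (induction bs) (auto simp: V_zero V_add)

lemma vsum_add:
  assumes "\<And>b. b \<in> set bs \<Longrightarrow> f b \<in> V" "\<And>b. b \<in> set bs \<Longrightarrow> g b \<in> V"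
  shows "vsum (\<lambda>b. f b + g b) bs = vsum f bs + vsum g bs"
  using assms
proof (induction bs)
  case (Cons b bs)
  have "f b \<in> carrier_vec d" "g b \<in> carrier_vec d" "vsum f bs \<in> carrier_vec d" "vsum g bs \<in> carrier_vec d"
    using Cons.prems by (auto intro!: V_carrier vsum_V)
  then show ?case using Cons by (intro eq_vecI) auto
qed (auto intro: eq_vecI)

lemma vsum_zero: "(\<And>b. b \<in> set bs \<Longrightarrow> f b = 0\<^sub>v d) \<Longrightarrow> vsum f bs = 0\<^sub>v d"
  by (induction bs) auto

lemma vsum_single:
  assumes "distinct bs" "c \<in> set bs" "f c \<in> V" "\<And>b. b \<in> set bs \<Longrightarrow> b \<noteq> c \<Longrightarrow> f b = 0\<^sub>v d"
  shows "vsum f bs = f c"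
  using assms
proof (induction bs)
  case (Cons b bs)
  show ?case
  proof (cases "b = c")
    case True
    then have "vsum f bs = 0\<^sub>v d" using Cons.prems by (intro vsum_zero) auto
    then show ?thesis using True Cons.prems V_add_zero by simp
  next
    case False
    then have "c \<in> set bs" using Cons.prems by auto
    then have "vsum f bs = f c" using Cons by auto
    moreover have "f b = 0\<^sub>v d" using Cons.prems False by auto
    ultimately show ?thesis using Cons.prems V_add_zero by simp
  qed
qed simp

lemma len_\<Phi>_vsum:
  assumes "\<And>b. b \<in> set bs \<Longrightarrow> f b \<in> V"
  shows "len (\<Phi> m (vsum f bs)) \<le> (\<Sum>b\<leftarrow>bs. len (\<Phi> m (f b)))"
  using assms
proof (induction bs)
  case (Cons b bs)
  have "len (\<Phi> m (vsum f (b # bs))) \<le> len (\<Phi> m (f b)) + len (\<Phi> m (vsum f bs))"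
    using Cons.prems by (simp add: \<Phi>_add vsum_V len_add \<Phi>_V)
  then show ?case using Cons by simp
qed (simp add: \<Phi>_zero len_zero)

end

section \<open>Comparing growth with the square root\<close>

lemma piecewise_linear_mono:
  assumes mono: "\<And>m n :: nat. m \<le> n \<Longrightarrow> g m \<le> g n" and xy: "0 \<le> x" "x \<le> y"
  shows "piecewise_linear g x \<le> piecewise_linear g y"
proof -
  let ?m = "nat \<lfloor>x\<rfloor>" and ?n = "nat \<lfloor>y\<rfloor>"
  have fr: "0 \<le> frac z" "frac z < 1" for z :: real by (simp_all add: frac_lt_1)
  have form: "piecewise_linear g z = g (nat \<lfloor>z\<rfloor>) + frac z * (g (nat \<lfloor>z\<rfloor> + 1) - g (nat \<lfloor>z\<rfloor>))" for z
    by (simp add: piecewise_linear_def algebra_simps)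
  have diff: "0 \<le> g (k + 1) - g k" for k using mono[of k "k + 1"] by simp
  have "?m \<le> ?n" using xy by (intro nat_mono floor_mono)
  then consider "?m = ?n" | "?m + 1 \<le> ?n" by linarith
  then show ?thesis
  proof cases
    case 1
    then have "\<lfloor>x\<rfloor> = \<lfloor>y\<rfloor>" using xy by (simp add: eq_nat_nat_iff)
    then have "frac x \<le> frac y" using xy(2) by (simp add: frac_def)
    then show ?thesis unfolding form 1 by (intro add_left_mono mult_right_mono diff)
  next
    case 2
    have "piecewise_linear g x \<le> g ?m + 1 * (g (?m + 1) - g ?m)"
      unfolding form using fr[of x] by (intro add_left_mono mult_right_mono diff) auto
    also have "\<dots> \<le> g ?n" using mono[OF 2] by simp
    also have "\<dots> \<le> piecewise_linear g y"
      unfolding form using fr(1)[of y] diff[of ?n] by simp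
    finally show ?thesis .
  qed
qed

lemma piecewise_linear_le:
  assumes "\<And>n. f n \<le> K * g n" "0 \<le> x"
  shows "piecewise_linear f x \<le> K * piecewise_linear g x"
proof -
  have "(1 - frac x) * f (nat \<lfloor>x\<rfloor>) \<le> (1 - frac x) * (K * g (nat \<lfloor>x\<rfloor>))"
    using frac_lt_1[of x] by (intro mult_left_mono assms) simp
  moreover have "frac x * f (nat \<lfloor>x\<rfloor> + 1) \<le> frac x * (K * g (nat \<lfloor>x\<rfloor> + 1))"
    by (intro mult_left_mono assms) simp
  ultimately show ?thesis by (simp add: piecewise_linear_def algebra_simps)
qed

lemma piecewise_linear_nonneg: "(\<And>n. 0 \<le> f n) \<Longrightarrow> 0 \<le> piecewise_linear f x"
  using frac_lt_1[of x] by (auto simp: piecewise_linear_def intro!: add_nonneg_nonneg)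

text \<open>In \<open>dominated\<close> one constant scales both value and argument. Taking it to be
  at least 1 lets the monotonicity of g absorb the scaled argument.\<close>

lemma same_growth_if_bounded_ratio:
  assumes K: "0 < K" "\<And>n. f n \<le> K * g n" and k: "0 < k" "\<And>n. k * g n \<le> f n"
    and mono: "\<And>m n :: nat. m \<le> n \<Longrightarrow> g m \<le> g n" and g: "\<And>n. 0 \<le> g n"
  shows "same_growth f g"
proof -
  have fg: "piecewise_linear f x \<le> max 1 K * piecewise_linear g (max 1 K * x)" if x: "0 \<le> x" for x
  proof -
    have "piecewise_linear f x \<le> K * piecewise_linear g x" by (rule piecewise_linear_le[OF K(2) x])
    also have "\<dots> \<le> max 1 K * piecewise_linear g (max 1 K * x)"
      using x K mult_right_mono[of 1 "max 1 K" x]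
      by (intro mult_mono piecewise_linear_mono mono piecewise_linear_nonneg g) auto
    finally show ?thesis .
  qed
  let ?c = "max 1 (1 / k)"
  have f: "0 \<le> f n" for n using k(2)[of n] k(1) g[of n] mult_nonneg_nonneg[of k "g n"] by linarith
  have gf: "g n \<le> 1 / k * f n" for n using k(2)[of n] k(1) by (simp add: field_simps)
  have gf': "piecewise_linear g x \<le> ?c * piecewise_linear f (?c * x)" if x: "0 \<le> x" for x
  proof -
    \<comment> \<open>As f need not be monotone, the argument is enlarged in g before g is compared
      with f.\<close>
    have "piecewise_linear g x \<le> piecewise_linear g (?c * x)"
      using x mult_right_mono[of 1 ?c x] by (intro piecewise_linear_mono mono) auto
    also have "\<dots> \<le> 1 / k * piecewise_linear f (?c * x)"
      using x by (intro piecewise_linear_le gf) simp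
    also have "\<dots> \<le> ?c * piecewise_linear f (?c * x)"
      by (intro mult_right_mono piecewise_linear_nonneg f) simp
    finally show ?thesis .
  qed
  show ?thesis
    unfolding same_growth_def dominated_def
  proof (rule conjI)
    show "\<exists>c>0. \<forall>x\<ge>0. piecewise_linear f x \<le> c * piecewise_linear g (c * x)"
      using fg by (intro exI[of _ "max 1 K"]) auto
    show "\<exists>c>0. \<forall>x\<ge>0. piecewise_linear g x \<le> c * piecewise_linear f (c * x)"
      using gf' by (intro exI[of _ ?c]) auto
  qed
qed

section \<open>The random walk\<close>

lemma (in walk_length_bounds) escape_exponent_half:
  assumes \<Omega>: "increments G \<mu> = \<Omega>" and len: "walk_length G S = len"
  shows "escape_exponent G S \<mu> (1 / 2)"
  unfolding escape_exponent_def
proof (intro conjI)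
  obtain \<gamma> \<delta> where lower: "0 < \<gamma>" "0 < \<delta>" "\<And>n. 1 \<le> n \<Longrightarrow> \<delta> \<le> Pr (\<lambda>w. \<gamma> * sqrt n < len n w)"
    using Pr_len_gt_lower by blast
  obtain b D where upper: "0 < b" "0 < D" "\<And>n x. 0 \<le> x \<Longrightarrow> Pr (\<lambda>w. x * sqrt n < len n w) \<le> D * exp (- b * x)"
    using Pr_len_gt_upper by blast
  show "tight_degree_of_escape G S \<mu> (1 / 2)"
    unfolding tight_degree_of_escape_def \<Omega> len
  proof (intro conjI exI allI impI)
    show "0 < \<gamma>" "0 < \<delta>" "0 < (1 :: real)" "0 < b" "0 < D" by (simp_all add: lower upper)
    show "\<delta> \<le> \<P>(\<xi> in \<Omega>. len n \<xi> > \<gamma> * real n powr (1 / 2))" if "1 \<le> n" for n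
      using lower(3)[OF that] by (simp add: powr_half_sqrt)
    show "\<P>(\<xi> in \<Omega>. len n \<xi> > x * real n powr (1 / 2)) \<le> D * exp (- b * x powr 1)" if "0 \<le> x" for x n
      using upper(3)[OF that, of n] that by (simp add: powr_half_sqrt)
  qed
  obtain K where K: "0 < K" "\<And>n. (\<integral>w. len n w \<partial>\<Omega>) \<le> K * sqrt n"
    using expectation_len_upper by blast
  obtain k where k: "0 < k" "\<And>n. k * sqrt n \<le> (\<integral>w. len n w \<partial>\<Omega>)"
    using expectation_len_lower by blast
  show "displacement_exponent G S \<mu> (1 / 2)"
    unfolding displacement_exponent_def \<Omega> len
    by (rule same_growth_if_bounded_ratio[of K _ _ k]) (use K k in \<open>auto simp: powr_half_sqrt\<close>)
  show "law_of_iterated_logarithm G S \<mu> (1 / 2)"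
    unfolding law_of_iterated_logarithm_def \<Omega> len Let_def by (rule AE_limsup_len)
qed

context semidirect_generated
begin

definition U where "U = insert (0\<^sub>v d) (fst ` S \<union> uminus ` fst ` S)"

definition T where "T = insert (0\<^sub>v d, 1) (insert (0\<^sub>v d, - 1) (U \<times> {0 :: int}))"

definition \<mu> where "\<mu> = pmf_of_set T"

lemma finite_S: "finite S" and S_carrier: "S \<subseteq> carrier G"
  using S by (simp_all add: finite_sym_generating_set_def)

lemma U_V: "u \<in> U \<Longrightarrow> u \<in> V"
  using S_carrier by (auto simp: U_def carrier_G V_zero V_uminus)

lemma finite_U: "finite U" using finite_S by (simp add: U_def)

lemma uminus_uminus_V: "v \<in> V \<Longrightarrow> - (- v) = v"
  using V_carrier by (intro eq_vecI) auto

lemma uminus_zero: "- 0\<^sub>v d = (0\<^sub>v d :: complex vec)" by (intro eq_vecI) auto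

lemma uminus_U: "u \<in> U \<Longrightarrow> - u \<in> U"
proof -
  assume "u \<in> U"
  then consider "u = 0\<^sub>v d" | "u \<in> fst ` S" | a where "u = - a" "a \<in> fst ` S"
    by (auto simp: U_def)
  then show ?thesis
  proof cases
    case 3
    then have "a \<in> V" using S_carrier by (auto simp: carrier_G)
    then show ?thesis using 3 by (simp add: uminus_uminus_V U_def)
  qed (simp_all add: U_def uminus_zero)
qed

lemma T_carrier: "T \<subseteq> carrier G"
  by (auto simp: T_def carrier_G V_zero U_V)

lemma finite_T: "finite T" "T \<noteq> {}" by (simp_all add: T_def finite_U)

lemma set_\<mu>: "set_pmf \<mu> = T" unfolding \<mu>_def by (rule set_pmf_of_set[OF finite_T(2,1)])

lemma inv_T:
  assumes "g \<in> T"
  shows "inv\<^bsub>G\<^esub> g \<in> T"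
proof -
  have shift: "inv\<^bsub>G\<^esub> (0\<^sub>v d, m) = (0\<^sub>v d, - m)" for m
    by (rule G.inv_equality) (auto simp: mult_G one_G carrier_G V_zero \<Phi>_zero)
  have vec: "inv\<^bsub>G\<^esub> (u, 0) = (- u, 0)" if "u \<in> V" for u
    using that by (intro G.inv_equality) (auto simp: mult_G one_G carrier_G V_uminus uminus_add)
  show ?thesis
    using assms by (auto simp: T_def shift vec U_V uminus_U)
qed

text \<open>A generator (v, m) in S is (v, 0) (0, m), where v lies in U and (0, m) is a power of (0,
  1).\<close>

lemma generate_T: "generate G T = carrier G"
proof
  show "generate G T \<subseteq> carrier G" by (rule G.generate_incl[OF T_carrier])
  have shift: "(0\<^sub>v d, m) \<in> generate G T" for m
  proof (induction m rule: int_induct[where k = 0])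
    case base
    show ?case using generate.one[of G T] by (simp add: one_G)
  next
    case (step1 i)
    have "(0\<^sub>v d, i) \<otimes>\<^bsub>G\<^esub> (0\<^sub>v d, 1) \<in> generate G T"
      by (intro generate.eng step1 generate.incl) (simp add: T_def)
    then show ?case by (simp add: mult_G \<Phi>_zero)
  next
    case (step2 i)
    have "(0\<^sub>v d, i) \<otimes>\<^bsub>G\<^esub> (0\<^sub>v d, - 1) \<in> generate G T"
      by (intro generate.eng step2 generate.incl) (simp add: T_def)
    then show ?case by (simp add: mult_G \<Phi>_zero)
  qed
  have "s \<in> generate G T" if s: "s \<in> S" for s
  proof -
    have v: "fst s \<in> U" using s by (auto simp: U_def)
    then have "(fst s, 0) \<otimes>\<^bsub>G\<^esub> (0\<^sub>v d, snd s) \<in> generate G T"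
      by (intro generate.eng shift generate.incl) (auto simp: T_def)
    then show ?thesis using v by (simp add: mult_G V_add_zero U_V)
  qed
  then have "generate G S \<subseteq> generate G T"
    by (intro G.generate_subgroup_incl G.generate_is_subgroup T_carrier) auto
  then show "carrier G \<subseteq> generate G T" using S by (simp add: finite_sym_generating_set_def)
qed

lemma adapted_\<mu>: "adapted G \<mu>"
  unfolding adapted_def set_\<mu>
proof (intro conjI ballI)
  fix g
  assume g: "g \<in> carrier G"
  have "g \<in> T \<longleftrightarrow> inv\<^bsub>G\<^esub> g \<in> T" using inv_T[of g] inv_T[of "inv\<^bsub>G\<^esub> g"] g by auto
  then show "pmf \<mu> g = pmf \<mu> (inv\<^bsub>G\<^esub> g)"
    by (simp add: \<mu>_def pmf_of_set[OF finite_T(2,1)] indicator_def)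
qed (rule T_carrier, rule finite_T, rule generate_T)

lemma expectation_\<mu>:
  fixes f :: "complex vec \<times> int \<Rightarrow> real"
  shows "measure_pmf.expectation \<mu> f = (f (0\<^sub>v d, 1) + f (0\<^sub>v d, - 1) + (\<Sum>u\<in>U. f (u, 0))) / (card U + 2)"
proof -
  have "sum f (U \<times> {0}) = (\<Sum>u\<in>U. f (u, 0))"
  proof -
    have "U \<times> {0 :: int} = (\<lambda>u. (u, 0)) ` U" by auto
    then show ?thesis by (simp add: sum.reindex inj_on_def)
  qed
  moreover have "card (U \<times> {0 :: int}) = card U" by (simp add: card_cartesian_product)
  ultimately show ?thesis
    unfolding \<mu>_def integral_pmf_of_set[OF finite_T(2,1)] using finite_U by (simp add: T_def)
qed

text \<open>The choice depends only on \<open>{u, - u}\<close>, so opposite steps have the same representative and are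
  counted by \<open>\<eta>\<close> with opposite signs.\<close>

definition rep :: "complex vec \<Rightarrow> complex vec" where "rep u = (SOME x. x = u \<or> x = - u)"

lemma rep_cases: "rep u = u \<or> rep u = - u"
  unfolding rep_def by (rule someI[of _ u]) simp

lemma rep_uminus: "u \<in> V \<Longrightarrow> rep (- u) = rep u"
  unfolding rep_def by (simp add: uminus_uminus_V disj_commute)

lemma rep_rep: "u \<in> V \<Longrightarrow> rep (rep u) = rep u"
  using rep_cases[of u] rep_uminus[of u] by auto

definition \<eta> :: "complex vec \<Rightarrow> complex vec \<times> int \<Rightarrow> int" where
  "\<eta> b x = of_bool (x = (b, 0)) - of_bool (x = (- b, 0))"

lemma abs_\<eta>: "\<bar>\<eta> b x\<bar> \<le> 1" by (simp add: \<eta>_def)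

text \<open>One vector from each pair of opposite nonzero steps, so that a step is counted by at
  most one b.\<close>

definition B where "B = rep ` (U - {0\<^sub>v d})"

lemma B_facts:
  assumes "b \<in> B"
  shows "b \<in> U" "b \<in> V" "b \<noteq> 0\<^sub>v d" "- b \<noteq> 0\<^sub>v d" "rep b = b" "- b \<noteq> b"
proof -
  obtain u where u: "b = rep u" "u \<in> U" "u \<noteq> 0\<^sub>v d" using assms by (auto simp: B_def)
  show "b \<in> U" using rep_cases[of u] u uminus_U by auto
  then show V: "b \<in> V" by (rule U_V)
  have "- u \<noteq> 0\<^sub>v d" using u(3) uminus_uminus_V[OF U_V[OF u(2)]] by (metis uminus_zero)
  then show nz: "b \<noteq> 0\<^sub>v d" using u rep_cases[of u] by auto
  then show "- b \<noteq> 0\<^sub>v d" using uminus_uminus_V[OF V] by (metis uminus_zero)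
  show "rep b = b" using rep_rep[OF U_V[OF u(2)]] u(1) by simp
  \<comment> \<open>If b were its own opposite, \<eta> b would vanish on the step (b, 0).\<close>
  show "- b \<noteq> b"
  proof
    assume "- b = b"
    then have "b $ i = 0" if "i < d" for i
    proof -
      have "(- b) $ i = - (b $ i)" using that V_carrier[OF V] by simp
      then have "b $ i + b $ i = 0" unfolding \<open>- b = b\<close> by (simp only: eq_neg_iff_add_eq_0)
      then have "2 * b $ i = 0" by simp
      then show ?thesis by simp
    qed
    then have "b = 0\<^sub>v d" using V_carrier[OF V] by (intro eq_vecI) auto
    then show False using nz by simp
  qed
qed

lemma finite_B: "finite B" by (simp add: B_def finite_U)

lemma \<Phi>_uminus:
  assumes v: "v \<in> V"
  shows "\<Phi> m (- v) = (- 1) \<cdot>\<^sub>v \<Phi> m v"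
proof -
  have sum: "\<Phi> m (- v) + \<Phi> m v = 0\<^sub>v d"
    by (simp add: \<Phi>_add[symmetric] v V_uminus uminus_add \<Phi>_zero)
  then have "\<Phi> m (- v) $ i + \<Phi> m v $ i = 0" if "i < d" for i
    using that index_add_vec(1)[of i "\<Phi> m v" "\<Phi> m (- v)"] V_carrier[OF \<Phi>_V[OF v, of m]] by (simp add: sum)
  then show ?thesis
    using V_carrier[OF \<Phi>_V[OF v, of m]] V_carrier[OF \<Phi>_V[OF V_uminus[OF v], of m]]
    by (intro eq_vecI) (auto simp: add_eq_0_iff2)
qed

text \<open>Only b = \<open>rep (fst x)\<close> can contribute, with the sign that turns it into
  \<open>fst x\<close>. If \<open>fst x\<close> is zero, as for the steps (0, 1) and (0, -1), all
  terms vanish.\<close>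

lemma step_decomposition:
  assumes bs: "distinct bs" "set bs = B" and x: "x \<in> T"
  shows "\<Phi> s (fst x) = vsum (\<lambda>b. of_int (\<eta> b x) \<cdot>\<^sub>v \<Phi> s b) bs"
proof -
  have zero: "of_int (\<eta> b x) \<cdot>\<^sub>v \<Phi> s b = 0\<^sub>v d" if "b \<in> B" "\<eta> b x = 0" for b
    using V_carrier[OF \<Phi>_V[OF B_facts(2)[OF that(1)], of s]] that(2) by (intro eq_vecI) auto
  show ?thesis
  proof (cases "fst x = 0\<^sub>v d")
    case True
    then have "\<eta> b x = 0" if "b \<in> B" for b
      using B_facts[OF that] by (auto simp: \<eta>_def)
    then have "vsum (\<lambda>b. of_int (\<eta> b x) \<cdot>\<^sub>v \<Phi> s b) bs = 0\<^sub>v d"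
      unfolding bs(2)[symmetric] by (intro vsum_zero zero) (simp_all add: bs(2))
    then show ?thesis using True by (simp add: \<Phi>_zero)
  next
    case False
    then have "x \<noteq> (0\<^sub>v d, m)" for m by (metis fst_conv)
    then have "x \<in> U \<times> {0}" using x by (simp add: T_def)
    then obtain u where xu: "x = (u, 0)" "u \<in> U" by blast
    then have u: "x = (u, 0)" "u \<in> U" "u \<noteq> 0\<^sub>v d" using False by simp_all
    let ?c = "rep u"
    have c: "?c \<in> B" using u by (auto simp: B_def)
    have other: "\<eta> b x = 0" if "b \<in> B" "b \<noteq> ?c" for b
    proof -
      have "u \<noteq> b" using B_facts(5)[OF that(1)] that(2) by auto
      moreover have "u \<noteq> - b" using B_facts(5)[OF that(1)] that(2) rep_uminus[OF B_facts(2)[OF that(1)]] by auto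
      ultimately show ?thesis by (simp add: \<eta>_def u)
    qed
    have "vsum (\<lambda>b. of_int (\<eta> b x) \<cdot>\<^sub>v \<Phi> s b) bs = of_int (\<eta> ?c x) \<cdot>\<^sub>v \<Phi> s ?c"
    proof (rule vsum_single[where f = "\<lambda>b. of_int (\<eta> b x) \<cdot>\<^sub>v \<Phi> s b"])
      show "of_int (\<eta> ?c x) \<cdot>\<^sub>v \<Phi> s ?c \<in> V" by (intro V_smult_int \<Phi>_V B_facts(2) c)
      show "of_int (\<eta> b x) \<cdot>\<^sub>v \<Phi> s b = 0\<^sub>v d" if "b \<in> set bs" "b \<noteq> ?c" for b
        using that other by (intro zero) (simp_all add: bs(2))
    qed (use bs c in simp_all)
    also have "\<dots> = \<Phi> s u"
      using rep_cases[of u]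
    proof
      assume eq: "rep u = u"
      then have "\<eta> u x = 1" using B_facts(6)[OF c] by (auto simp: \<eta>_def u)
      then show ?thesis using V_carrier[OF \<Phi>_V[OF U_V[OF u(2)], of s]] eq by (intro eq_vecI) auto
    next
      assume eq: "rep u = - u"
      then have nu: "u = - ?c" using uminus_uminus_V[OF U_V[OF u(2)]] by simp
      then have "\<eta> ?c x = - 1" using B_facts(6)[OF c] by (auto simp: \<eta>_def u)
      then show ?thesis using \<Phi>_uminus[OF B_facts(2)[OF c], of s] nu by simp
    qed
    finally show ?thesis by (simp add: u)
  qed
qed

lemma walk_position:
  assumes w: "\<forall>k. w k \<in> T"
  shows "snd (walk G n w) = height snd 0 n w" "fst (walk G n w) \<in> V"
proof -
  have "walk G n w \<in> carrier G \<and> snd (walk G n w) = height snd 0 n w"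
  proof (induction n)
    case (Suc n)
    have "w n \<in> carrier G" using w T_carrier by blast
    with Suc have "walk G (Suc n) w \<in> carrier G" by simp
    moreover have "snd (walk G (Suc n) w) = snd (walk G n w) + snd (w n)"
      by (cases "walk G n w"; cases "w n") (simp add: mult_G)
    ultimately show ?case using Suc by (simp add: height_def)
  qed (simp add: one_G carrier_G V_zero)
  then show "snd (walk G n w) = height snd 0 n w" "fst (walk G n w) \<in> V"
    by (auto simp: carrier_G)
qed

text \<open>A step made at height h enters the displacement through \<Phi> h. Applying \<Phi> R
  makes all exponents nonnegative, so that the result is a sum of polynomials in \<phi> applied to
  the vectors b.\<close>

lemma walk_exponent_sums:
  assumes w: "\<forall>k. w k \<in> T" and bs: "distinct bs" "set bs = B"
    and R: "\<And>k. k < n \<Longrightarrow> 0 \<le> height snd 0 k w + R"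
  shows "\<Phi> R (fst (walk G n w))
    = vsum (\<lambda>b. act (\<Sum>k<n. monom (\<eta> b (w k)) (nat (height snd 0 k w + R))) b) bs"
  using R
proof (induction n)
  case 0
  have "vsum (\<lambda>b. act 0 b) bs = 0\<^sub>v d"
    using bs B_facts(2) by (intro vsum_zero act_0) blast
  then show ?case by (simp add: one_G \<Phi>_zero)
next
  case (Suc n)
  let ?h = "height snd 0 n w" and ?P = "\<lambda>b. \<Sum>k<n. monom (\<eta> b (w k)) (nat (height snd 0 k w + R))"
  have hR: "0 \<le> ?h + R" by (rule Suc.prems) simp
  have "w n \<in> carrier G" using w T_carrier by blast
  then have wV: "fst (w n) \<in> V" by (auto simp: carrier_G)
  have "fst (walk G (Suc n) w) = fst (walk G n w) + \<Phi> ?h (fst (w n))"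
    using walk_position(1)[OF w, of n] by (cases "walk G n w"; cases "w n") (simp add: mult_G)
  then have "\<Phi> R (fst (walk G (Suc n) w)) = \<Phi> R (fst (walk G n w) + \<Phi> ?h (fst (w n)))"
    by (rule arg_cong)
  also have "\<dots> = \<Phi> R (fst (walk G n w)) + \<Phi> R (\<Phi> ?h (fst (w n)))"
    by (intro \<Phi>_add walk_position(2)[OF w] \<Phi>_V wV)
  also have "\<Phi> R (\<Phi> ?h (fst (w n))) = \<Phi> (?h + R) (fst (w n))"
    by (simp only: \<Phi>_add_int[OF wV, symmetric] add.commute[of R])
  also have "\<Phi> (?h + R) (fst (w n)) = vsum (\<lambda>b. of_int (\<eta> b (w n)) \<cdot>\<^sub>v \<Phi> (?h + R) b) bs"
    using w by (intro step_decomposition bs) blast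
  also have "\<Phi> R (fst (walk G n w)) = vsum (\<lambda>b. act (?P b) b) bs"
    using Suc.prems by (intro Suc.IH) auto
  also have "vsum (\<lambda>b. act (?P b) b) bs + vsum (\<lambda>b. of_int (\<eta> b (w n)) \<cdot>\<^sub>v \<Phi> (?h + R) b) bs
      = vsum (\<lambda>b. act (?P b) b + of_int (\<eta> b (w n)) \<cdot>\<^sub>v \<Phi> (?h + R) b) bs"
    using bs B_facts(2) by (intro vsum_add[symmetric]) (auto intro!: act_V V_smult_int \<Phi>_V)
  also have "\<dots> = vsum (\<lambda>b. act (\<Sum>k<Suc n. monom (\<eta> b (w k)) (nat (height snd 0 k w + R))) b) bs"
  proof -
    have "act (?P b) b + of_int (\<eta> b (w n)) \<cdot>\<^sub>v \<Phi> (?h + R) b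
        = act (\<Sum>k<Suc n. monom (\<eta> b (w k)) (nat (height snd 0 k w + R))) b" if "b \<in> set bs" for b
      using that bs B_facts(2)[of b] hR by (simp add: act_add act_monom)
    then show ?thesis unfolding vsum_def by (intro foldr_cong) auto
  qed
  finally show ?case .
qed

end

section \<open>Residue counts along the walk and the final estimate\<close>

context semidirect_generated
begin

text \<open>The index \<open>None\<close> stands for the height itself, \<open>Some (b, j)\<close> for the signed number of steps
  \<open>b\<close> made at heights congruent to \<open>j\<close> modulo \<open>N\<close>.\<close>

definition residue_increment :: "nat \<Rightarrow> (complex vec \<times> nat) option \<Rightarrow> int \<Rightarrow> complex vec \<times> int \<Rightarrow> real" where
  "residue_increment N i s x = (case i of None \<Rightarrow> of_int (snd x)
     | Some (b, j) \<Rightarrow> if s mod int N = int j then of_int (\<eta> b x) else 0)"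

definition max_functional :: "nat \<Rightarrow> (complex vec \<times> nat) option \<Rightarrow> nat \<Rightarrow> (nat \<Rightarrow> complex vec \<times> int) \<Rightarrow> real" where
  "max_functional N i n w = Max ((\<lambda>k. \<bar>functional snd (residue_increment N i) 0 k w\<bar>) ` {..n})"

lemma max_functional_ge: "k \<le> n \<Longrightarrow> \<bar>functional snd (residue_increment N i) 0 k w\<bar> \<le> max_functional N i n w"
  unfolding max_functional_def by (rule Max_ge) auto

lemma functional_None: "functional snd (residue_increment N None) 0 k w = of_int (height snd 0 k w)"
  by (simp add: functional_def residue_increment_def height_def)

lemma functional_Some:
  "functional snd (residue_increment N (Some (b, j))) 0 n w
    = of_int (\<Sum>k<n. if height snd 0 k w mod int N = int j then \<eta> b (w k) else 0)"
  by (simp add: functional_def residue_increment_def) (rule sum.cong, auto)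

text \<open>For each b, \<open>len_exponent_sum\<close> is applied along the path with e = \<eta> b,
  s the height and r the largest absolute height up to time n. The residue sums are then values of
  the functionals at time n, and r is bounded by the maximum of the functional with index
  \<open>None\<close>.\<close>

lemma walk_length_le:
  assumes N: "0 < N"
    and dominant: "(\<Sum>i\<in>{..degree q} - {m}. \<bar>coeff q i\<bar>) < \<bar>coeff q m\<bar>"
    and q: "\<And>v. v \<in> V \<Longrightarrow> act (pCons 0 (q * (monom 1 N - 1))) v = 0\<^sub>v d"
  obtains C where "0 < C"
    "\<And>n w. (\<forall>k. w k \<in> T) \<Longrightarrow> walk_length G S n w
      \<le> C * (1 + ln (real n + 2) + (\<Sum>i\<in>insert None (Some ` (B \<times> {..<N})). max_functional N i n w))"
proof -
  let ?P = "\<lambda>b K. 0 \<le> K \<and> (\<forall>n r (e :: nat \<Rightarrow> int) (s :: nat \<Rightarrow> int).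
      (\<forall>k<n. \<bar>e k\<bar> \<le> 1) \<longrightarrow> (\<forall>k<n. \<bar>s k\<bar> \<le> int r) \<longrightarrow>
      len (\<Phi> (- int (N * r)) (act (\<Sum>k<n. monom (e k) (nat (s k + int (N * r)))) b))
        \<le> K * (1 + ln (real n + 2) + real r
             + (\<Sum>i<N. \<bar>real_of_int (\<Sum>k<n. if s k mod int N = int i then e k else 0)\<bar>)))"
  have "\<exists>K. ?P b K" if b: "b \<in> B" for b
  proof -
    obtain K where "0 \<le> K"
      "\<And>n r (e :: nat \<Rightarrow> int) (s :: nat \<Rightarrow> int).
      (\<And>k. k < n \<Longrightarrow> \<bar>e k\<bar> \<le> 1) \<Longrightarrow> (\<And>k. k < n \<Longrightarrow> \<bar>s k\<bar> \<le> int r) \<Longrightarrow>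
      len (\<Phi> (- int (N * r)) (act (\<Sum>k<n. monom (e k) (nat (s k + int (N * r)))) b))
        \<le> K * (1 + ln (real n + 2) + real r
             + (\<Sum>i<N. \<bar>real_of_int (\<Sum>k<n. if s k mod int N = int i then e k else 0)\<bar>))"
      by (rule len_exponent_sum[OF B_facts(2)[OF b] N q[OF B_facts(2)[OF b]] dominant]) (rule that, assumption, blast)
    then show ?thesis by (intro exI[of _ K]) simp
  qed
  then have "\<forall>b\<in>B. \<exists>K. ?P b K" by blast
  from bchoice[OF this] obtain K where K: "\<And>b. b \<in> B \<Longrightarrow> ?P b (K b)" by blast
  obtain bs where bs: "distinct bs" "set bs = B" using finite_distinct_list[OF finite_B] by blast
  \<comment> \<open>The constants K b pay for the vector and \<tau> for the final height; the
    summand 1 makes C positive.\<close>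
  define C where "C = (\<Sum>b\<in>B. K b) + \<tau> + 1"
  have K0: "0 \<le> K b" if "b \<in> B" for b using K[OF that] by blast
  have sumK: "0 \<le> (\<Sum>b\<in>B. K b)" using K0 by (intro sum_nonneg) auto
  have "walk_length G S n w
      \<le> C * (1 + ln (real n + 2) + (\<Sum>i\<in>insert None (Some ` (B \<times> {..<N})). max_functional N i n w))"
    if w: "\<forall>k. w k \<in> T" for n w
  proof -
    define r where "r = Max ((\<lambda>k. nat \<bar>height snd 0 k w\<bar>) ` {..n})"
    have r_ge: "\<bar>height snd 0 k w\<bar> \<le> int r" if "k \<le> n" for k
    proof -
      have "nat \<bar>height snd 0 k w\<bar> \<le> r" unfolding r_def using that by (intro Max_ge) auto
      then show ?thesis by linarith
    qed
    have "r \<in> (\<lambda>k. nat \<bar>height snd 0 k w\<bar>) ` {..n}" unfolding r_def by (intro Max_in) auto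
    then obtain k where "k \<le> n" "r = nat \<bar>height snd 0 k w\<bar>" by auto
    then have r_le: "real r \<le> max_functional N None n w"
      using max_functional_ge[of k n N None w] by (simp add: functional_None)
    let ?R = "int (N * r)" and ?l = "ln (real n + 2)"
    let ?W = "\<lambda>b i. functional snd (residue_increment N (Some (b, i))) 0 n w"
    let ?Q = "\<lambda>b. \<Sum>k<n. monom (\<eta> b (w k)) (nat (height snd 0 k w + ?R))"
    define F where "F = (\<Sum>i\<in>Some ` (B \<times> {..<N}). max_functional N i n w)"
    have max0: "0 \<le> max_functional N i n w" for i
      using max_functional_ge[of 0 n N i w] by simp
    have F0: "0 \<le> F" unfolding F_def using max0 by (intro sum_nonneg)
    have ln0: "0 \<le> ?l" by simp
    define Y where "Y = 1 + ?l + (max_functional N None n w + F)"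
    have Y: "(\<Sum>i\<in>insert None (Some ` (B \<times> {..<N})). max_functional N i n w) = max_functional N None n w + F"
      unfolding F_def using finite_B by (subst sum.insert) auto
    have summand: "len (\<Phi> (- ?R) (act (?Q b) b)) \<le> K b * Y" if b: "b \<in> B" for b
    proof -
      have "len (\<Phi> (- ?R) (act (?Q b) b)) \<le> K b * (1 + ?l + real r
           + (\<Sum>i<N. \<bar>real_of_int (\<Sum>k<n. if height snd 0 k w mod int N = int i then \<eta> b (w k) else 0)\<bar>))"
        using K[OF b] r_ge abs_\<eta> by simp
      also have "\<dots> = K b * (1 + ?l + real r + (\<Sum>i<N. \<bar>?W b i\<bar>))"
        by (simp only: functional_Some)
      also have "\<dots> \<le> K b * Y"
      proof (rule mult_left_mono[OF _ K0[OF b]])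
        have "(\<Sum>i<N. \<bar>?W b i\<bar>) \<le> (\<Sum>i<N. max_functional N (Some (b, i)) n w)"
          by (intro sum_mono max_functional_ge order_refl)
        also have "\<dots> = (\<Sum>i\<in>(\<lambda>j. Some (b, j)) ` {..<N}. max_functional N i n w)"
          by (subst sum.reindex) (auto simp: inj_on_def)
        also have "\<dots> \<le> F"
          unfolding F_def using b finite_B max0 by (intro sum_mono2) auto
        finally show "1 + ?l + real r + (\<Sum>i<N. \<bar>?W b i\<bar>) \<le> Y" using r_le by (simp add: Y_def)
      qed
      finally show ?thesis .
    qed
    let ?v = "fst (walk G n w)"
    have vV: "?v \<in> V" by (rule walk_position(2)[OF w])
    have "r \<le> N * r" using N by simp
    then have "0 \<le> height snd 0 k w + ?R" if "k < n" for k
      using r_ge[of k] that by linarith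
    from walk_exponent_sums[OF w bs this]
    have "\<Phi> ?R ?v = vsum (\<lambda>b. act (?Q b) b) bs" .
    then have "?v = \<Phi> (- ?R) (vsum (\<lambda>b. act (?Q b) b) bs)"
      using \<Phi>_add_int[OF vV, of "- ?R" ?R] by simp
    then have "len ?v = len (\<Phi> (- ?R) (vsum (\<lambda>b. act (?Q b) b) bs))" by (rule arg_cong)
    also have "\<dots> \<le> (\<Sum>b\<leftarrow>bs. len (\<Phi> (- ?R) (act (?Q b) b)))"
      using bs B_facts(2) by (intro len_\<Phi>_vsum act_V) blast
    also have "\<dots> = (\<Sum>b\<in>B. len (\<Phi> (- ?R) (act (?Q b) b)))"
      using bs by (simp only: sum_list_distinct_conv_sum_set)
    also have "\<dots> \<le> (\<Sum>b\<in>B. K b * Y)" by (intro sum_mono summand)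
    finally have v: "len ?v \<le> (\<Sum>b\<in>B. K b) * Y" by (simp add: sum_distrib_right)
    have "walk_length G S n w = wl (?v, snd (walk G n w))" by (simp add: walk_length_def wl_def)
    also have "\<dots> \<le> len ?v + \<bar>real_of_int (snd (walk G n w))\<bar> * \<tau>" by (rule wl_le[OF vV])
    also have "\<dots> \<le> (\<Sum>b\<in>B. K b) * Y + Y * \<tau>"
    proof (intro add_mono v mult_right_mono \<tau>_nonneg)
      have "\<bar>real_of_int (snd (walk G n w))\<bar> \<le> real r"
        using r_ge[of n] by (simp add: walk_position(1)[OF w])
      then show "\<bar>real_of_int (snd (walk G n w))\<bar> \<le> Y"
        using r_le F0 ln0 unfolding Y_def by linarith
    qed
    also have "\<dots> \<le> C * Y"
    proof -
      have "0 \<le> Y" using max0[of None] F0 ln0 unfolding Y_def by linarith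
      then show ?thesis by (simp add: C_def algebra_simps)
    qed
    finally show ?thesis by (simp only: Y_def Y)
  qed
  moreover have "0 < C" unfolding C_def using sumK \<tau>_nonneg by linarith
  ultimately show thesis using that by blast
qed

text \<open>Two of the \<open>card U + 2\<close> equally likely steps change the height.\<close>

lemma expectation_height_law:
  fixes F :: "int \<Rightarrow> real"
  defines "p \<equiv> 2 / (real (card U) + 2)"
  shows "measure_pmf.expectation \<mu> (\<lambda>x. F (snd x)) = p / 2 * F 1 + p / 2 * F (- 1) + (1 - p) * F 0"
proof -
  have *: "p / 2 = 1 / (real (card U) + 2)" "1 - p = real (card U) / (real (card U) + 2)"
    by (simp_all add: p_def field_simps)
  show ?thesis unfolding expectation_\<mu> * by (simp add: add_divide_distrib add.commute)
qed

text \<open>At every height b and -b are equally likely and count with opposite signs; the steps (0,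
  1) and (0, -1) balance for the index \<open>None\<close>.\<close>

lemma expectation_residue_increment:
  assumes "i \<in> insert None (Some ` (B \<times> {..<N}))"
  shows "measure_pmf.expectation \<mu> (residue_increment N i s) = 0"
proof (cases i)
  case None
  then show ?thesis unfolding expectation_\<mu> by (simp add: residue_increment_def)
next
  case (Some a)
  then obtain b j where i: "i = Some (b, j)" and b: "b \<in> B" using assms by auto
  have "(\<Sum>u\<in>U. \<eta> b (u, 0)) = (\<Sum>u\<in>U. of_bool (u = b)) - (\<Sum>u\<in>U. of_bool (u = - b))"
    by (simp add: \<eta>_def sum_subtractf)
  also have "\<dots> = 0"
    using finite_U B_facts(1)[OF b] uminus_U[OF B_facts(1)[OF b]] by (simp add: of_bool_def)
  finally have *: "(\<Sum>u\<in>U. \<eta> b (u, 0)) = 0" .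
  have "(\<Sum>u\<in>U. residue_increment N i s (u, 0)) = (if s mod int N = int j then of_int (\<Sum>u\<in>U. \<eta> b (u, 0)) else 0)"
    by (simp add: i residue_increment_def)
  then have "(\<Sum>u\<in>U. residue_increment N i s (u, 0)) = 0" by (simp only: * of_int_0 if_cancel)
  moreover have "residue_increment N i s (0\<^sub>v d, 1) = 0" "residue_increment N i s (0\<^sub>v d, - 1) = 0"
    by (simp_all add: i residue_increment_def \<eta>_def)
  ultimately show ?thesis unfolding expectation_\<mu> by simp
qed

lemma depends_below_walk_length: "depends_below n (walk_length G S n)"
proof (rule depends_belowI)
  fix w w' :: "nat \<Rightarrow> complex vec \<times> int"
  assume eq: "\<And>k. k < n \<Longrightarrow> w k = w' k"
  have "walk G k w = walk G k w'" if "k \<le> n" for k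
    using that by (induction k) (auto simp: eq)
  then show "walk_length G S n w = walk_length G S n w'" by (simp add: walk_length_def)
qed

lemma escape_exponent_\<mu>:
  assumes N: "0 < N"
    and dominant: "(\<Sum>i\<in>{..degree q} - {m}. \<bar>coeff q i\<bar>) < \<bar>coeff q m\<bar>"
    and q: "\<And>v. v \<in> V \<Longrightarrow> act (pCons 0 (q * (monom 1 N - 1))) v = 0\<^sub>v d"
  shows "escape_exponent G S \<mu> (1 / 2)"
proof -
  obtain C where C: "0 < C"
    "\<And>n w. (\<forall>k. w k \<in> T) \<Longrightarrow> walk_length G S n w
      \<le> C * (1 + ln (real n + 2) + (\<Sum>i\<in>insert None (Some ` (B \<times> {..<N})). max_functional N i n w))"
    by (rule walk_length_le[OF N dominant q]) (assumption, rule that)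
  obtain c where c: "0 < c" "\<And>g. g \<in> carrier G \<Longrightarrow> c * \<bar>real_of_int (snd g)\<bar> \<le> real (word_length G S g)"
  proof (rule G.abs_hom_le_word_length[OF S, of snd])
    show "snd (g \<otimes>\<^bsub>G\<^esub> h) = snd g + snd h" for g h by (cases g; cases h) (simp add: mult_G)
  qed (rule that)
  interpret walk_length_bounds \<mu> "carrier G" snd "2 / (real (card U) + 2)" "walk_length G S"
    "insert None (Some ` (B \<times> {..<N}))" "residue_increment N" c C
  proof
    show "countable (carrier G)"
      unfolding carrier_G V_def by (intro countable_SIGMA countable_adjoin_vec) auto
    show "finite (set_pmf \<mu>)" "set_pmf \<mu> \<subseteq> carrier G" by (simp_all only: set_\<mu> finite_T T_carrier)
    show "0 < 2 / (real (card U) + 2)" by simp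
    show "2 / (real (card U) + 2) \<le> 1" by simp
    show "measure_pmf.expectation \<mu> (\<lambda>x. F (snd x)) = 2 / (real (card U) + 2) / 2 * F 1
        + 2 / (real (card U) + 2) / 2 * F (- 1) + (1 - 2 / (real (card U) + 2)) * F 0" for F :: "int \<Rightarrow> real"
      by (rule expectation_height_law)
    show "finite (insert None (Some ` (B \<times> {..<N})))" using finite_B by simp
    show "\<bar>residue_increment N i s x\<bar> \<le> 1" if "x \<in> set_pmf \<mu>" for i s x
    proof -
      have "\<bar>snd x\<bar> \<le> 1" using that by (auto simp: set_\<mu> T_def)
      moreover have "\<bar>real_of_int (\<eta> b x)\<bar> \<le> 1" for b using abs_\<eta>[of b x] by linarith
      ultimately show ?thesis by (auto simp: residue_increment_def split: option.split)
    qed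
    show "measure_pmf.expectation \<mu> (residue_increment N i s) = 0"
      if "i \<in> insert None (Some ` (B \<times> {..<N}))" for i s by (rule expectation_residue_increment[OF that])
    show "depends_below n (walk_length G S n)" for n by (rule depends_below_walk_length)
    show "walk_length G S 0 w = 0" for w using G.word_length_one[OF S] by (simp add: walk_length_def)
    show "0 < c" "0 < C" by (rule c C)+
    show "c * \<bar>real_of_int (height snd 0 n w)\<bar> \<le> walk_length G S n w"
      if "\<forall>k. w k \<in> set_pmf \<mu>" for n w
    proof -
      have w: "\<forall>k. w k \<in> T" using that by (simp add: set_\<mu>)
      have "walk G n w \<in> carrier G"
        using walk_position(2)[OF w, of n] by (simp add: carrier_G mem_Times_iff)
      from c(2)[OF this] show ?thesis by (simp add: walk_length_def walk_position(1)[OF w])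
    qed
    show "walk_length G S n w \<le> C * (1 + ln (real n + 2) + (\<Sum>i\<in>insert None (Some ` (B \<times> {..<N})).
        Max ((\<lambda>k. \<bar>functional snd (residue_increment N i) 0 k w\<bar>) ` {..n})))"
      if "\<forall>k. w k \<in> set_pmf \<mu>" for n w
    proof -
      have "\<forall>k. w k \<in> T" using that by (simp add: set_\<mu>)
      from C(2)[OF this, of n] show ?thesis by (simp only: max_functional_def)
    qed
  qed simp
  show ?thesis
    by (rule escape_exponent_half) (simp_all add: \<Omega>_def increments_def)
qed

end

theorem theorem3:
  fixes \<rho> :: complex
    and d :: nat
    and \<phi> :: "complex vec \<Rightarrow> complex vec"
    and p_plus p_zero :: "int poly"
    and S :: "(complex vec \<times> int) set"
  defines "G \<equiv> semidirect_Z \<rho> d \<phi>"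
  assumes "algebraic \<rho>"
    and "d \<ge> 1"
    and "linear_automorphism \<rho> d \<phi>"
    and "finite_sym_generating_set G S"
    and "char_poly (matrix_of d \<phi>) = map_poly of_int (p_plus * p_zero)"
    and "\<exists>q. laurent_multiple p_plus q \<and> EDP q"
    and "rsquarefree (map_poly of_int p_plus :: complex poly)"
    and "\<forall>z::complex. poly (map_poly of_int p_plus) z = 0 \<longrightarrow> cmod z \<noteq> 1"
    and "rsquarefree (map_poly of_int p_zero :: complex poly)"
    and "\<forall>z::complex. poly (map_poly of_int p_zero) z = 0 \<longrightarrow> cmod z = 1"
  shows "\<exists>\<mu>. adapted G \<mu> \<and> escape_exponent G S \<mu> (1/2)"
proof -
  interpret semidirect \<rho> d \<phi>
    by unfold_locales (rule assms(4))
  have G_eq: "local.G = semidirect_Z \<rho> d \<phi>" by (rule G_def)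
  interpret semidirect_generated \<rho> d \<phi> S
    by unfold_locales (use assms(5) in \<open>simp only: G_eq assms(1)\<close>)
  obtain ql where ql: "laurent_multiple p_plus ql" "EDP ql" using assms(7) by blast
  have char: "char_poly M = of_int_poly (p_plus * p_zero)"
    using assms(6) by (simp only: M_def)
  obtain N q m where N: "0 < N"
    and dominant: "(\<Sum>i\<in>{..degree q} - {m}. \<bar>coeff q i\<bar>) < \<bar>coeff q m\<bar>"
    and annihilates: "\<And>v. v \<in> carrier_vec d \<Longrightarrow>
      poly_act M (of_int_poly (pCons 0 (q * (monom 1 N - 1)))) v = 0\<^sub>v d"
    using annihilating_polynomial[OF M_carrier char ql assms(8) _ assms(10)] assms(9,11) by blast
  have "escape_exponent local.G S \<mu> (1 / 2)"
    by (rule escape_exponent_\<mu>[OF N dominant]) (simp add: act_def annihilates V_carrier)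
  with adapted_\<mu> show ?thesis unfolding G_eq assms(1) by blast
qed

end
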